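(* Let $G$ be a linear balanceable graph with at least two vertices. Then $G$ contains at least two vertices of degree at most $2$.
   Context: A hole is a chordless cycle of length at least $4$; a $4$-hole is a hole of length $4$. A signing of a bipartite graph is an assignment of weights $+1$ or $-1$ to its edges; a signed bipartite graph is balanced if the sum of the weights of the edges of every hole is $\equiv 0 \pmod 4$. A bipartite graph is balanceable if it has a signing making it balanced. A bipartite graph is linear balanceable if it is balanceable and contains no $4$-hole as an induced subgraph. *)

theory Defs
  imports Main "HOL-Number_Theory.Cong"
begin

text \<open>A graph is given by a vertex set \<open>V\<close> and a set \<open>E\<close> of two-element subsets of \<open>V\<close>.\<close>

definition finite_graph :: "'a set \<Rightarrow> 'a set set \<Rightarrow> bool" where
  "finite_graph V E \<longleftrightarrow> finite V \<and> (\<forall>e\<in>E. e \<subseteq> V \<and> card e = 2)"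

definition vertex_degree :: "'a set set \<Rightarrow> 'a \<Rightarrow> nat" where
  "vertex_degree E v = card {e \<in> E. v \<in> e}"

definition bipartite_graph :: "'a set \<Rightarrow> 'a set set \<Rightarrow> bool" where
  "bipartite_graph V E \<longleftrightarrow> finite_graph V E \<and>
     (\<exists>A B. A \<union> B = V \<and> A \<inter> B = {} \<and> (\<forall>e\<in>E. \<exists>a\<in>A. \<exists>b\<in>B. e = {a, b}))"

text \<open>A cycle is represented by the list of its vertices in cyclic order; the starting
  point and the orientation are immaterial.\<close>

definition cycle_edges :: "'a list \<Rightarrow> 'a set set" where
  "cycle_edges cs = {{cs ! i, cs ! (Suc i mod length cs)} | i. i < length cs}"

definition is_cycle :: "'a set \<Rightarrow> 'a set set \<Rightarrow> 'a list \<Rightarrow> bool" where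
  "is_cycle V E cs \<longleftrightarrow>
     3 \<le> length cs \<and> distinct cs \<and> set cs \<subseteq> V \<and> cycle_edges cs \<subseteq> E"

definition chordless :: "'a set set \<Rightarrow> 'a list \<Rightarrow> bool" where
  "chordless E cs \<longleftrightarrow> (\<forall>e\<in>E. e \<subseteq> set cs \<longrightarrow> e \<in> cycle_edges cs)"

definition is_hole :: "'a set \<Rightarrow> 'a set set \<Rightarrow> 'a list \<Rightarrow> bool" where
  "is_hole V E cs \<longleftrightarrow> is_cycle V E cs \<and> chordless E cs \<and> 4 \<le> length cs"

definition signing :: "'a set set \<Rightarrow> ('a set \<Rightarrow> int) \<Rightarrow> bool" where
  "signing E w \<longleftrightarrow> (\<forall>e\<in>E. w e = 1 \<or> w e = -1)"

definition balanced :: "'a set \<Rightarrow> 'a set set \<Rightarrow> ('a set \<Rightarrow> int) \<Rightarrow> bool" where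
  "balanced V E w \<longleftrightarrow>
     (\<forall>cs. is_hole V E cs \<longrightarrow> [(\<Sum>e\<in>cycle_edges cs. w e) = 0] (mod 4))"

definition balanceable :: "'a set \<Rightarrow> 'a set set \<Rightarrow> bool" where
  "balanceable V E \<longleftrightarrow> bipartite_graph V E \<and> (\<exists>w. signing E w \<and> balanced V E w)"

definition linear_balanceable :: "'a set \<Rightarrow> 'a set set \<Rightarrow> bool" where
  "linear_balanceable V E \<longleftrightarrow>
     balanceable V E \<and> \<not> (\<exists>cs. is_hole V E cs \<and> length cs = 4)"

end

theory Submission
  imports Defs
begin

text \<open>
  Two consequences of balanceability suffice: \<open>G\<close> has no 4-cycle, and no odd theta, i.e. if three
  connected, pairwise anticomplete sets each touch two nonadjacent vertices \<open>x\<close> and \<open>y\<close>, then \<open>x\<close> and \<open>y\<close>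
  lie on the same side of the bipartition (add up the weights of the three holes of an induced theta).

  Suppose all vertices but one, \<open>x\<close>, have degree at least 3. Consider pairs \<open>(M, C)\<close> of anticomplete
  connected sets where \<open>C\<close> avoids \<open>x\<close>, all vertices of the boundary \<open>bd C\<close> (the leaves) lie on
  one side \<open>t\<close>, each leaf has exactly one neighbour in \<open>M\<close> (its parent), and any three parents are joined
  inside \<open>M\<close> by a tripod whose centre lies on side \<open>t\<close>. Such a pair exists with \<open>M = {x}\<close>;
  take \<open>C\<close> as small as possible. Growing \<open>M\<close> into \<open>C\<close> must then always fail.

  First, no vertex of \<open>C\<close> has two leaf neighbours. Then fix a parent \<open>p0\<close>, its leaves \<open>L0\<close>, their
  neighbours \<open>E\<close> in \<open>C\<close>, and a component \<open>C1\<close> of \<open>C - E\<close>. A shortest path from \<open>E\<close> through \<open>C1\<close> to a leaf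
  with another parent, closed up through \<open>M\<close>, is a hole. Paths off this hole that jump from one of its
  vertices to another have ends on the same side, and two crossing jumps produce odd thetas. The first
  vertex of the path that is not crossed by jumps is therefore a cut point behind which a smaller pair
  is found.
\<close>

section \<open>Paths, connected sets and odd thetas\<close>

text \<open>The side condition on tripod centres drives the proof. Leaves lie on side
  \<open>t\<close>, so their neighbours in \<open>C\<close> lie on the other side; a vertex of
  \<open>C\<close> with two leaf neighbours and one further route, leading to three different
  parents, would span an odd theta with the centre. The obstacle in growing \<open>M\<close> is the
  boundary of the shrunken \<open>C\<close>: each new leaf must again have exactly one parent. If
  the new parents share a neighbour, the absence of 4-cycles ensures this; otherwise it has to be
  forced, and this is why vertices with two leaf neighbours are excluded before the layers are
  studied. In the study of the hole a third parent is essential: the tripod leg towards it lies off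
  the hole and yields jumps that end in the centre. Those can start at odd indices only, which
  bounds the reach of jumps from even indices. Degree at least 3 serves to leave a vertex while
  avoiding one or two given neighbours, so that the component to which \<open>C\<close> is to shrink
  has a starting vertex.\<close>

fun path_edges :: "'a list \<Rightarrow> 'a set set" where
  "path_edges (a # b # xs) = insert {a, b} (path_edges (b # xs))"
| "path_edges _ = {}"

lemma path_edges_append: "path_edges (xs @ y # ys) = path_edges (xs @ [y]) \<union> path_edges (y # ys)"
proof (induction xs)
  case Nil then show ?case by simp
next
  case (Cons a xs) then show ?case by (cases xs) auto
qed

lemma path_edges_rev: "path_edges (rev xs) = path_edges xs"
proof (induction xs rule: path_edges.induct)
  case (1 a b xs)
  have "path_edges (rev (a # b # xs)) = path_edges (rev xs @ b # [a])" by simp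
  also have "\<dots> = path_edges (rev xs @ [b]) \<union> path_edges [b, a]" by (rule path_edges_append)
  finally show ?case using 1 by (simp add: insert_commute)
qed auto

lemma path_edges_nth: "path_edges xs = {{xs ! i, xs ! Suc i} | i. Suc i < length xs}"
proof (induction xs rule: path_edges.induct)
  case (1 a b xs)
  have "{{(a # b # xs) ! i, (a # b # xs) ! Suc i} | i. Suc i < length (a # b # xs)}
     = insert {a, b} {{(b # xs) ! i, (b # xs) ! Suc i} | i. Suc i < length (b # xs)}" (is "?L = insert _ ?R")
  proof (intro equalityI subsetI)
    fix e assume "e \<in> ?L"
    then obtain i where "e = {(a # b # xs) ! i, (a # b # xs) ! Suc i}" "Suc i < length (a # b # xs)" by blast
    then show "e \<in> insert {a, b} ?R" by (cases i) auto
  next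
    fix e assume "e \<in> insert {a, b} ?R"
    then consider "e = {a, b}" | i where "e = {(b # xs) ! i, (b # xs) ! Suc i}" "Suc i < length (b # xs)" by blast
    then show "e \<in> ?L"
    proof cases
      case 1 then show ?thesis by (intro CollectI exI[of _ 0]) auto
    next
      case 2 then show ?thesis by (intro CollectI exI[of _ "Suc i"]) auto
    qed
  qed
  then show ?case using 1 by simp
qed auto

lemma cycle_edges_path_edges: "cycle_edges (x # xs) = path_edges (x # xs @ [x])"
proof -
  have eq: "(x # xs @ [x]) ! Suc i = (x # xs) ! (Suc i mod length (x # xs))"
    if "i < length (x # xs)" for i
  proof (cases "Suc i = length (x # xs)")
    case True then show ?thesis by (simp add: nth_append)
  next
    case False then show ?thesis using that by (simp add: nth_append)
  qed
  have eq2: "(x # xs @ [x]) ! i = (x # xs) ! i" if "i < length (x # xs)" for i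
    using that by (metis append_Cons nth_append)
  show ?thesis unfolding cycle_edges_def path_edges_nth
    using eq eq2 by (auto; metis less_Suc_eq_le length_Cons)
qed

lemma path_edges_sub: "e \<in> path_edges xs \<Longrightarrow> e \<subseteq> set xs"
  by (induction xs rule: path_edges.induct) auto

lemma finite_path_edges: "finite (path_edges xs)"
  by (induction xs rule: path_edges.induct) auto

lemma card_path_edges: "distinct xs \<Longrightarrow> xs \<noteq> [] \<Longrightarrow> Suc (card (path_edges xs)) = length xs"
proof (induction xs rule: path_edges.induct)
  case (1 a b xs)
  then have "{a, b} \<notin> path_edges (b # xs)" using path_edges_sub[of "{a, b}" "b # xs"] by auto
  then show ?case using 1 by (simp add: finite_path_edges)
qed auto

lemma path_edges_mid: "e \<in> path_edges (x # ps @ [y]) \<Longrightarrow> ps \<noteq> [] \<Longrightarrow> e \<inter> set ps \<noteq> {}"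
proof (induction ps arbitrary: x)
  case (Cons a ps)
  show ?case
  proof (cases ps)
    case Nil then show ?thesis using Cons.prems by auto
  next
    case (Cons b qs)
    then show ?thesis using Cons.prems Cons.IH[of a] by auto
  qed
qed simp

lemma sum_sign_parity:
  fixes w :: "'b \<Rightarrow> int"
  assumes "finite A" "\<And>e. e \<in> A \<Longrightarrow> w e = 1 \<or> w e = -1"
  shows "even (sum w A) \<longleftrightarrow> even (card A)"
  using assms
proof (induction A rule: finite_induct)
  case (insert x F)
  then have "odd (w x)" by (metis dvd_minus_iff insertI1 odd_one)
  then show ?case using insert by simp
qed simp

locale bipartite_relation =
  fixes adj :: "'a \<Rightarrow> 'a \<Rightarrow> bool" and s :: "'a \<Rightarrow> bool"
  assumes sym: "adj x y \<Longrightarrow> adj y x"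
    and side: "adj x y \<Longrightarrow> s x \<noteq> s y"
begin

text \<open>Connectedness of the induced subgraph in terms of cuts instead of walks, so that unions
  need no concatenation. The empty set does not count as connected. Walks are recovered in
  \<open>conn_path\<close>.\<close>

definition conn :: "'a set \<Rightarrow> bool" where
  "conn S \<longleftrightarrow> S \<noteq> {} \<and> (\<forall>T\<subseteq>S. T \<noteq> {} \<and> T \<noteq> S \<longrightarrow> (\<exists>a\<in>T. \<exists>b\<in>S - T. adj a b))"

definition tch :: "'a set \<Rightarrow> 'a \<Rightarrow> bool" where
  "tch S x \<longleftrightarrow> (\<exists>y\<in>S. adj y x)"

definition anti :: "'a set \<Rightarrow> 'a set \<Rightarrow> bool" where
  "anti S T \<longleftrightarrow> S \<inter> T = {} \<and> (\<forall>a\<in>S. \<forall>b\<in>T. \<not> adj a b)"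

definition walk :: "'a list \<Rightarrow> bool" where
  "walk xs \<longleftrightarrow> xs \<noteq> [] \<and> successively adj xs"

lemma irrefl: "\<not> adj x x" using side by blast

lemma conn_ne: "conn S \<Longrightarrow> S \<noteq> {}" by (simp add: conn_def)

lemma conn_sing [simp]: "conn {x}" by (auto simp: conn_def)

lemma conn_Un:
  assumes "conn S" "conn T" "S \<inter> T \<noteq> {} \<or> (\<exists>a\<in>S. \<exists>b\<in>T. adj a b)"
  shows "conn (S \<union> T)"
  unfolding conn_def
proof (intro conjI allI impI)
  show "S \<union> T \<noteq> {}" using assms by (auto simp: conn_def)
  fix U assume U: "U \<subseteq> S \<union> T" "U \<noteq> {} \<and> U \<noteq> S \<union> T"
  show "\<exists>a\<in>U. \<exists>b\<in>S \<union> T - U. adj a b"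
  proof (rule ccontr)
    assume no: "\<not> ?thesis"
    have S: "U \<inter> S = {} \<or> U \<inter> S = S"
      using assms(1) no unfolding conn_def by (metis Diff_iff Int_iff Un_iff inf_le2)
    have T: "U \<inter> T = {} \<or> U \<inter> T = T"
      using assms(2) no unfolding conn_def by (metis Diff_iff Int_iff Un_iff inf_le2)
    show False using S T assms(3) U no sym by blast
  qed
qed

lemma conn_insert: "conn S \<Longrightarrow> tch S x \<Longrightarrow> conn (insert x S)"
  using conn_Un[of "{x}" S] sym by (auto simp: tch_def)

lemma conn_Union:
  assumes "conn S" "\<And>T. T \<in> F \<Longrightarrow> conn T \<and> (S \<inter> T \<noteq> {} \<or> (\<exists>a\<in>S. \<exists>b\<in>T. adj a b))"
  shows "conn (S \<union> \<Union>F)"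
  unfolding conn_def
proof (intro conjI allI impI)
  show "S \<union> \<Union>F \<noteq> {}" using assms by (auto simp: conn_def)
  fix U assume U: "U \<subseteq> S \<union> \<Union>F" "U \<noteq> {} \<and> U \<noteq> S \<union> \<Union>F"
  show "\<exists>a\<in>U. \<exists>b\<in>S \<union> \<Union>F - U. adj a b"
  proof (rule ccontr)
    assume no: "\<not> ?thesis"
    have cl: "U \<inter> (S \<union> T) = {} \<or> U \<inter> (S \<union> T) = S \<union> T" if "T \<in> F" for T
    proof -
      have c: "conn (S \<union> T)" using assms that conn_Un by blast
      show ?thesis
      proof (rule ccontr)
        assume "\<not> ?thesis"
        then obtain a b where "a \<in> U \<inter> (S \<union> T)" "b \<in> S \<union> T - U \<inter> (S \<union> T)" "adj a b"
          using c unfolding conn_def by (meson inf_le2)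
        then show False using no that by blast
      qed
    qed
    have clS: "U \<inter> S = {} \<or> U \<inter> S = S"
      using assms(1) no unfolding conn_def by (metis Diff_iff Int_iff Un_iff inf_le2)
    have ne: "S \<noteq> {}" using assms(1) by (simp add: conn_def)
    show False
    proof (cases "U \<inter> S = {}")
      case True
      then have "U \<inter> T = {}" if "T \<in> F" for T using cl[OF that] ne by blast
      then show False using U True by blast
    next
      case False
      then have "S \<subseteq> U" using clS by blast
      moreover have "T \<subseteq> U" if "T \<in> F" for T using cl[OF that] ne \<open>S \<subseteq> U\<close> by blast
      ultimately show False using U by blast
    qed
  qed
qed

lemma conn_walk: "walk xs \<Longrightarrow> conn (set xs)"
  unfolding walk_def
proof (induction xs)
  case (Cons x xs)
  show ?case
  proof (cases xs)
    case Nil then show ?thesis by simp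
  next
    case (Cons y ys)
    then have "conn (set xs)" "adj x y" using Cons.IH Cons.prems by auto
    then have "conn (insert x (set xs))" using Cons by (intro conn_insert) (auto simp: tch_def intro: sym)
    then show ?thesis by simp
  qed
qed simp

text \<open>No edge of \<open>S\<close> leaves the set of vertices reachable from \<open>x\<close>
  inside \<open>S\<close>, so this set is all of \<open>S\<close>.\<close>

lemma conn_path:
  assumes "conn S" "x \<in> S" "y \<in> S"
  shows "\<exists>xs. walk xs \<and> set xs \<subseteq> S \<and> hd xs = x \<and> last xs = y"
proof -
  let ?T = "{y \<in> S. \<exists>xs. walk xs \<and> set xs \<subseteq> S \<and> hd xs = x \<and> last xs = y}"
  have x: "x \<in> ?T" using assms by (auto simp: walk_def intro!: exI[of _ "[x]"])
  have "?T = S"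
  proof (rule ccontr)
    assume "?T \<noteq> S"
    then obtain a b where ab: "a \<in> ?T" "b \<in> S - ?T" "adj a b"
      using assms(1) x unfolding conn_def
      by (metis (no_types, lifting) empty_iff mem_Collect_eq subsetI)
    then obtain xs where "walk xs" "set xs \<subseteq> S" "hd xs = x" "last xs = a" by blast
    then have "walk (xs @ [b]) \<and> set (xs @ [b]) \<subseteq> S \<and> hd (xs @ [b]) = x \<and> last (xs @ [b]) = b"
      using ab by (auto simp: walk_def successively_append_iff)
    then show False using ab by blast
  qed
  then show ?thesis using assms by blast
qed

lemma walk_rev: "walk xs \<Longrightarrow> walk (rev xs)"
  by (auto simp: walk_def intro: successively_mono sym)

definition ipath :: "'a list \<Rightarrow> bool" where
  "ipath xs \<longleftrightarrow> successively adj xs \<and> distinct xs \<and>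
     (\<forall>i j. i < j \<longrightarrow> j < length xs \<longrightarrow> adj (xs ! i) (xs ! j) \<longrightarrow> j = Suc i)"

lemma successively_shortcut:
  assumes "successively adj xs" "i < j" "j < length xs" "adj (xs ! i) (xs ! j)"
  shows "successively adj (take (Suc i) xs @ drop j xs)"
proof -
  have 1: "successively adj (take (Suc i) xs)" "successively adj (drop j xs)"
    using assms(1) by (metis append_take_drop_id successively_append_iff)+
  have 2: "last (take (Suc i) xs) = xs ! i" using assms by (simp add: take_Suc_conv_app_nth)
  have 3: "hd (drop j xs) = xs ! j" using assms by (simp add: hd_drop_conv_nth)
  show ?thesis using 1 2 3 assms by (simp add: successively_append_iff)
qed

lemma successively_shortcut_eq:
  assumes "successively adj xs" "i < j" "j < length xs" "xs ! i = xs ! j"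
  shows "successively adj (take i xs @ drop j xs)"
proof -
  have 1: "successively adj (take i xs)" "successively adj (drop j xs)"
    using assms(1) by (metis append_take_drop_id successively_append_iff)+
  have 3: "hd (drop j xs) = xs ! j" using assms by (simp add: hd_drop_conv_nth)
  have "i > 0 \<Longrightarrow> adj (last (take i xs)) (xs ! i)"
  proof -
    assume "i > 0"
    then obtain k where k: "i = Suc k" by (cases i) auto
    have "last (take i xs) = xs ! k" using assms k by (simp add: take_Suc_conv_app_nth)
    moreover have "adj (xs ! k) (xs ! Suc k)" using assms(1) k assms(2,3)
      by (simp add: successively_conv_nth)
    ultimately show ?thesis using k by simp
  qed
  then show ?thesis using 1 3 assms by (cases "i = 0") (auto simp: successively_append_iff)
qed

text \<open>A shortest walk from \<open>x\<close> to \<open>y\<close> with interior in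
  \<open>S\<close> is induced, because a chord or a repeated vertex allows a shortcut of the same
  kind.\<close>

lemma shortest_ipath:
  assumes S: "conn S" "tch S x" "tch S y" "x \<notin> S" "y \<notin> S" and xy: "\<not> adj x y" "x \<noteq> y"
  shows "\<exists>ps. set ps \<subseteq> S \<and> ps \<noteq> [] \<and> ipath (x # ps @ [y])"
proof -
  let ?P = "\<lambda>rs. successively adj (x # rs @ [y]) \<and> set rs \<subseteq> S"
  obtain a b where ab: "a \<in> S" "adj a x" "b \<in> S" "adj b y" using S by (auto simp: tch_def)
  obtain ps where ps: "walk ps" "set ps \<subseteq> S" "hd ps = a" "last ps = b"
    using conn_path[OF S(1)] ab by blast
  have "?P ps"
    using ps ab by (auto simp: walk_def successively_Cons successively_append_iff intro: sym)
  then obtain qs where q: "?P qs" and short: "\<And>rs. ?P rs \<Longrightarrow> length qs \<le> length rs"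
    using ex_has_least_nat[of ?P _ length] by blast
  define xs where qs: "xs = x # qs @ [y]"
  have xs: "successively adj xs" and qS: "set qs \<subseteq> S" using q by (auto simp: qs)
  have n: "length xs = Suc (Suc (length qs))" by (simp add: qs)
  have ind: "j = Suc i" if "i < j" "j < length xs" "adj (xs ! i) (xs ! j)" for i j
  proof (rule ccontr)
    assume "j \<noteq> Suc i"
    then have ij: "Suc i < j" using that by simp
    let ?ys = "take (Suc i) xs @ drop j xs"
    have suc: "successively adj ?ys" using successively_shortcut that xs by blast
    have t: "take (Suc i) xs = x # take i qs" using that n by (simp add: qs)
    have d: "drop j xs = drop (j - 1) qs @ [y]" using ij that n by (cases j) (auto simp: qs)
    have e: "?ys = x # (take i qs @ drop (j - 1) qs) @ [y]" using t d by simp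
    have "set (take i qs @ drop (j - 1) qs) \<subseteq> S" using qS by (auto dest: in_set_takeD in_set_dropD)
    then have "?P (take i qs @ drop (j - 1) qs)" using suc e by simp
    then have "length qs \<le> length (take i qs @ drop (j - 1) qs)" by (rule short)
    then show False using ij that n by simp
  qed
  have dis: "xs ! i \<noteq> xs ! j" if "i < j" "j < length xs" for i j
  proof
    assume eq: "xs ! i = xs ! j"
    \<comment> \<open>The ends are distinct and outside \<open>S\<close>, so a repetition concerns
      two interior positions, and cutting it out keeps both ends.\<close>
    have nxy: "x \<notin> set (qs @ [y])" "y \<notin> set (x # qs)" using qS S xy by auto
    have i0: "0 < i"
    proof (rule ccontr)
      assume "\<not> 0 < i"
      then have "i = 0" by simp
      then have "x = (qs @ [y]) ! (j - 1)" using eq that by (cases j) (auto simp: qs)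
      moreover have "(qs @ [y]) ! (j - 1) \<in> set (qs @ [y])" using that n by (intro nth_mem) simp
      ultimately show False using nxy by simp
    qed
    have jl: "j < Suc (length qs)"
    proof (rule ccontr)
      assume "\<not> j < Suc (length qs)"
      then have j: "j = length (x # qs)" using that n by simp
      then have "xs ! j = y" by (simp add: qs nth_append)
      moreover have "xs ! i = (x # qs) ! i" using that j by (simp add: qs nth_append nth_Cons split: nat.splits)
      moreover have "(x # qs) ! i \<in> set (x # qs)" using that j by (intro nth_mem) simp
      ultimately show False using nxy eq by metis
    qed
    have suc: "successively adj (take i xs @ drop j xs)" using successively_shortcut_eq that xs eq by blast
    have t: "take i xs = x # take (i - 1) qs" using i0 jl that by (cases i) (auto simp: qs)
    have d: "drop j xs = drop (j - 1) qs @ [y]" using jl that by (cases j) (auto simp: qs)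
    have e: "take i xs @ drop j xs = x # (take (i - 1) qs @ drop (j - 1) qs) @ [y]" using t d by simp
    have "set (take (i - 1) qs @ drop (j - 1) qs) \<subseteq> S" using qS by (auto dest: in_set_takeD in_set_dropD)
    then have "?P (take (i - 1) qs @ drop (j - 1) qs)" using suc e by simp
    then have "length qs \<le> length (take (i - 1) qs @ drop (j - 1) qs)" by (rule short)
    then show False using i0 that jl by simp
  qed
  have "distinct xs" using dis by (metis distinct_conv_nth nat_neq_iff)
  then have ip: "ipath xs" using ind xs by (auto simp: ipath_def)
  have "qs \<noteq> []" using xs xy qs by auto
  then show ?thesis using ip qs qS by blast
qed

lemma ipath_path_edges:
  assumes "ipath xs" "u \<in> set xs" "v \<in> set xs" "adj u v"
  shows "{u, v} \<in> path_edges xs"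
proof -
  obtain i j where ij: "i < length xs" "j < length xs" "u = xs ! i" "v = xs ! j"
    using assms by (metis in_set_conv_nth)
  have "i \<noteq> j" using ij assms irrefl by auto
  then consider "i < j" | "j < i" by linarith
  then show ?thesis
  proof cases
    case 1
    then have "j = Suc i" using assms ij by (auto simp: ipath_def)
    then show ?thesis using ij unfolding path_edges_nth by blast
  next
    case 2
    then have "i = Suc j" using assms ij sym by (auto simp: ipath_def)
    then show ?thesis using ij unfolding path_edges_nth by (metis (mono_tags, lifting) insert_commute mem_Collect_eq)
  qed
qed

lemma ipath_side: "successively adj xs \<Longrightarrow> xs \<noteq> [] \<Longrightarrow> (s (hd xs) = s (last xs)) \<longleftrightarrow> odd (length xs)"
proof (induction xs)
  case (Cons x xs)
  show ?case
  proof (cases xs)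
    case Nil then show ?thesis by simp
  next
    case (Cons y ys)
    then have "adj x y" using Cons.prems by simp
    then have "s x \<noteq> s y" by (rule side)
    moreover have "(s (hd xs) = s (last xs)) \<longleftrightarrow> odd (length xs)" using Cons.IH Cons.prems Cons by simp
    ultimately show ?thesis using Cons by auto
  qed
qed simp

end

section \<open>The excluded configurations of a linear balanceable graph\<close>

locale theta_free = bipartite_relation +
  fixes V :: "'a set"
  assumes finV: "finite V"
    and adjV: "adj x y \<Longrightarrow> x \<in> V"
    and c4: "\<lbrakk>adj a x; adj a y; adj b x; adj b y; a \<noteq> b\<rbrakk> \<Longrightarrow> x = y"
    and theta: "\<lbrakk>conn S1; conn S2; conn S3; anti S1 S2; anti S1 S3; anti S2 S3;
       tch S1 x; tch S2 x; tch S3 x; tch S1 y; tch S2 y; tch S3 y;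
       x \<notin> S1 \<union> S2 \<union> S3; y \<notin> S1 \<union> S2 \<union> S3; \<not> adj x y\<rbrakk> \<Longrightarrow> s x = s y"

context bipartite_relation
begin

text \<open>Besides the hole itself, the edge set and the disjointness are recorded, so that the
  weight of the hole splits into the weights of its two paths.\<close>

lemma hole_of_two_paths:
  assumes E: "\<And>x y. adj x y \<longleftrightarrow> {x, y} \<in> E" and EV: "\<And>e. e \<in> E \<Longrightarrow> e \<subseteq> V \<and> card e = 2"
    and p: "ipath (x # ps @ [y])" "ps \<noteq> []" and q: "ipath (x # qs @ [y])" "qs \<noteq> []"
    and a: "anti (set ps) (set qs)"
  shows "is_hole V E (x # ps @ y # rev qs)"
    "cycle_edges (x # ps @ y # rev qs) = path_edges (x # ps @ [y]) \<union> path_edges (x # qs @ [y])"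
    "path_edges (x # ps @ [y]) \<inter> path_edges (x # qs @ [y]) = {}"
proof -
  let ?cs = "x # ps @ y # rev qs"
  show ce: "cycle_edges ?cs = path_edges (x # ps @ [y]) \<union> path_edges (x # qs @ [y])"
  proof -
    have "cycle_edges ?cs = path_edges ((x # ps) @ y # (rev qs @ [x]))" by (simp add: cycle_edges_path_edges)
    also have "\<dots> = path_edges ((x # ps) @ [y]) \<union> path_edges (y # rev qs @ [x])" by (rule path_edges_append)
    also have "y # rev qs @ [x] = rev (x # qs @ [y])" by simp
    finally show ?thesis by (simp only: path_edges_rev append_Cons)
  qed
  have dist: "distinct ?cs" using p q a by (auto simp: ipath_def anti_def)
  show dj: "path_edges (x # ps @ [y]) \<inter> path_edges (x # qs @ [y]) = {}"
  proof (rule ccontr)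
    assume "\<not> ?thesis"
    then obtain e where e: "e \<in> path_edges (x # ps @ [y])" "e \<in> path_edges (x # qs @ [y])" by blast
    then obtain z where "z \<in> e" "z \<in> set ps" using path_edges_mid[OF e(1) p(2)] by blast
    moreover have "e \<subseteq> set (x # qs @ [y])" using e(2) by (rule path_edges_sub)
    ultimately show False using dist by auto
  qed
  have peE: "path_edges xs \<subseteq> E" if "successively adj xs" for xs
    using that by (induction xs rule: path_edges.induct) (auto simp: E)
  have sub: "cycle_edges ?cs \<subseteq> E" using ce peE p q by (auto simp: ipath_def)
  have VV: "set ?cs \<subseteq> V"
  proof
    fix z assume z: "z \<in> set ?cs"
    have "z \<in> \<Union>(cycle_edges ?cs)"
    proof -
      obtain i where "i < length ?cs" "z = ?cs ! i" using z by (metis in_set_conv_nth)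
      then show ?thesis unfolding cycle_edges_def by blast
    qed
    then show "z \<in> V" using sub EV by blast
  qed
  have ch: "chordless E ?cs"
    unfolding chordless_def
  proof (intro ballI impI)
    fix e assume e: "e \<in> E" "e \<subseteq> set ?cs"
    then obtain u v where uv: "e = {u, v}" using EV card_2_iff by metis
    then have adj: "adj u v" using E e by simp
    have mem: "u \<in> set ?cs" "v \<in> set ?cs" using e uv by auto
    show "e \<in> cycle_edges ?cs"
    proof (cases "u \<in> set (x # ps @ [y]) \<and> v \<in> set (x # ps @ [y])")
      case True then show ?thesis using ipath_path_edges[OF p(1)] adj uv ce by blast
    next
      case False
      show ?thesis
      proof (cases "u \<in> set (x # qs @ [y]) \<and> v \<in> set (x # qs @ [y])")
        case True then show ?thesis using ipath_path_edges[OF q(1)] adj uv ce by blast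
      next
        case nq: False
        then have "u \<in> set ps \<and> v \<in> set qs \<or> u \<in> set qs \<and> v \<in> set ps" using mem False by auto
        then show ?thesis using a adj sym unfolding anti_def by blast
      qed
    qed
  qed
  have len: "4 \<le> length ?cs" using p(2) q(2) by (cases ps; cases qs) auto
  show "is_hole V E ?cs"
    using dist sub VV ch len unfolding is_hole_def is_cycle_def by auto
qed

end

text \<open>The signing is exploited here and nowhere else; afterwards only the absence of 4-cycles
  and of odd thetas matters.\<close>

lemma linear_balanceable_theta_free:
  assumes "linear_balanceable V E"
  shows "\<exists>s. theta_free (\<lambda>x y. {x, y} \<in> E) s V"
proof -
  from assms have bal: "bipartite_graph V E" and sq: "\<not> (\<exists>cs. is_hole V E cs \<and> length cs = 4)"
    by (auto simp: linear_balanceable_def balanceable_def)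
  from assms obtain w where w: "signing E w" "balanced V E w"
    by (auto simp: linear_balanceable_def balanceable_def)
  from bal obtain A B where fg: "finite_graph V E" and AB: "A \<union> B = V" "A \<inter> B = {}"
    "\<forall>e\<in>E. \<exists>a\<in>A. \<exists>b\<in>B. e = {a, b}" by (auto simp: bipartite_graph_def)
  have EV: "\<And>e. e \<in> E \<Longrightarrow> e \<subseteq> V \<and> card e = 2" using fg by (auto simp: finite_graph_def)
  let ?adj = "\<lambda>x y. {x, y} \<in> E" and ?s = "\<lambda>x. x \<in> A"
  interpret bipartite_relation ?adj ?s
  proof
    show "{y, x} \<in> E" if "{x, y} \<in> E" for x y using that by (simp add: insert_commute)
    show "(x \<in> A) \<noteq> (y \<in> A)" if "{x, y} \<in> E" for x y
      using AB that by (metis IntI doubleton_eq_iff empty_iff)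
  qed
  have "theta_free ?adj ?s V"
  proof
    show "finite V" using fg by (simp add: finite_graph_def)
    show "x \<in> V" if "{x, y} \<in> E" for x y using EV that by blast
    show "x = y" if h: "{a, x} \<in> E" "{a, y} \<in> E" "{b, x} \<in> E" "{b, y} \<in> E" "a \<noteq> b" for a x b y
    proof (rule ccontr)
      assume ne: "x \<noteq> y"
      \<comment> \<open>Bipartiteness forbids both diagonals, so every 4-cycle is already a
        hole.\<close>
      have sd: "(a \<in> A) \<noteq> (x \<in> A)" "(a \<in> A) \<noteq> (y \<in> A)" "(b \<in> A) \<noteq> (x \<in> A)" "(b \<in> A) \<noteq> (y \<in> A)"
        using side h by blast+
      have nab: "{a, b} \<notin> E" using sd side by metis
      have ip: "ipath (a # [x] @ [b])" "ipath (a # [y] @ [b])"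
        using h ne sd nab
        by (auto simp: ipath_def less_Suc_eq insert_commute)
      have an: "anti (set [x]) (set [y])" using ne sd side by (auto simp: anti_def)
      have "is_hole V E (a # [x] @ b # rev [y])"
        by (rule hole_of_two_paths(1)[OF _ EV ip(1) _ ip(2) _ an]) auto
      then have "is_hole V E [a, x, b, y] \<and> length [a, x, b, y] = 4" by simp
      then show False using sq by blast
    qed
    show "(x \<in> A) = (y \<in> A)"
      if c: "conn S1" "conn S2" "conn S3" and an: "anti S1 S2" "anti S1 S3" "anti S2 S3"
        and tx: "tch S1 x" "tch S2 x" "tch S3 x" and ty: "tch S1 y" "tch S2 y" "tch S3 y"
        and xn: "x \<notin> S1 \<union> S2 \<union> S3" and yn: "y \<notin> S1 \<union> S2 \<union> S3" and nadj: "{x, y} \<notin> E" for S1 S2 S3 x y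
    proof (rule ccontr)
      assume ns: "(x \<in> A) \<noteq> (y \<in> A)"
      then have xy: "x \<noteq> y" by auto
      obtain p1 where p1: "set p1 \<subseteq> S1" "p1 \<noteq> []" "ipath (x # p1 @ [y])"
        using shortest_ipath[OF c(1) tx(1) ty(1) _ _ _ xy] xn yn nadj by blast
      obtain p2 where p2: "set p2 \<subseteq> S2" "p2 \<noteq> []" "ipath (x # p2 @ [y])"
        using shortest_ipath[OF c(2) tx(2) ty(2) _ _ _ xy] xn yn nadj by blast
      obtain p3 where p3: "set p3 \<subseteq> S3" "p3 \<noteq> []" "ipath (x # p3 @ [y])"
        using shortest_ipath[OF c(3) tx(3) ty(3) _ _ _ xy] xn yn nadj by blast
      have an': "anti (set p1) (set p2)" "anti (set p1) (set p3)" "anti (set p2) (set p3)"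
        using an p1 p2 p3 unfolding anti_def by blast+
      let ?W = "\<lambda>p. \<Sum>e\<in>path_edges (x # p @ [y]). w e"
      have hol: "[?W p + ?W q = 0] (mod 4)"
        if "p \<noteq> []" "ipath (x # p @ [y])" "q \<noteq> []" "ipath (x # q @ [y])" "anti (set p) (set q)" for p q
      proof -
        note h = hole_of_two_paths[OF refl EV that(2,1,4,3,5)]
        have "[(\<Sum>e\<in>cycle_edges (x # p @ y # rev q). w e) = 0] (mod 4)"
          using w(2) h(1) by (simp add: balanced_def)
        then show ?thesis using sum.union_disjoint[OF finite_path_edges finite_path_edges h(3), of w] h(2) by simp
      qed
      have par: "odd (?W p)" if "p \<noteq> []" "ipath (x # p @ [y])" for p
      proof -
        have suc: "successively ?adj (x # p @ [y])" "distinct (x # p @ [y])" using that by (auto simp: ipath_def)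
        have "even (length (x # p @ [y]))" using ipath_side[OF suc(1)] ns by simp
        then have oc: "odd (card (path_edges (x # p @ [y])))" using card_path_edges[OF suc(2)] by (metis even_Suc list.discI)
        have "path_edges zs \<subseteq> E" if "successively ?adj zs" for zs
          using that by (induction zs rule: path_edges.induct) auto
        then have "\<And>e. e \<in> path_edges (x # p @ [y]) \<Longrightarrow> w e = 1 \<or> w e = -1"
          using suc(1) w(1) unfolding signing_def by blast
        then have "even (?W p) \<longleftrightarrow> even (card (path_edges (x # p @ [y])))"
          by (intro sum_sign_parity finite_path_edges)
        then show ?thesis using oc by simp
      qed
      \<comment> \<open>Adding the first two congruences and subtracting the third gives
        \<open>2 * ?W p1 = 0\<close> modulo 4, so \<open>?W p1\<close> would be even. It is odd,
        because a path between opposite sides has an odd number of edges.\<close>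
      have "[?W p1 + ?W p2 = 0] (mod 4)" "[?W p1 + ?W p3 = 0] (mod 4)" "[?W p2 + ?W p3 = 0] (mod 4)"
        using hol p1 p2 p3 an' by blast+
      moreover have "odd (?W p1)" "odd (?W p2)" "odd (?W p3)" using par p1 p2 p3 by blast+
      ultimately show False unfolding cong_def by presburger
    qed
  qed
  then show ?thesis by blast
qed

section \<open>States\<close>

context theta_free
begin

text \<open>The component of \<open>x\<close> in the subgraph induced on \<open>A\<close>; it is
  empty if \<open>x\<close> is not in \<open>A\<close>.\<close>

definition cmp :: "'a set \<Rightarrow> 'a \<Rightarrow> 'a set" where
  "cmp A x = {y. \<exists>xs. walk xs \<and> set xs \<subseteq> A \<and> hd xs = x \<and> last xs = y}"

lemma walk_prefix:
  assumes "walk xs" "z \<in> set xs"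
  shows "\<exists>ys. walk ys \<and> set ys \<subseteq> set xs \<and> hd ys = hd xs \<and> last ys = z"
proof -
  obtain as bs where xs: "xs = as @ z # bs" using assms(2) split_list by metis
  have "walk (as @ [z])" using assms(1) by (auto simp: walk_def xs successively_append_iff)
  moreover have "hd (as @ [z]) = hd xs" by (cases as) (auto simp: xs)
  ultimately show ?thesis using xs by (intro exI[of _ "as @ [z]"]) auto
qed

lemma cmp_self: "x \<in> A \<Longrightarrow> x \<in> cmp A x"
  by (auto simp: cmp_def walk_def intro!: exI[of _ "[x]"])

lemma cmp_sub: "cmp A x \<subseteq> A"
  by (auto simp: cmp_def walk_def)

lemma cmp_step: "y \<in> cmp A x \<Longrightarrow> z \<in> A \<Longrightarrow> adj y z \<Longrightarrow> z \<in> cmp A x"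
proof -
  assume y: "y \<in> cmp A x" and z: "z \<in> A" "adj y z"
  then obtain xs where "walk xs" "set xs \<subseteq> A" "hd xs = x" "last xs = y" by (auto simp: cmp_def)
  then have "walk (xs @ [z]) \<and> set (xs @ [z]) \<subseteq> A \<and> hd (xs @ [z]) = x \<and> last (xs @ [z]) = z"
    using z by (auto simp: walk_def successively_append_iff)
  then show ?thesis unfolding cmp_def by blast
qed

lemma cmp_conn: assumes "x \<in> A" shows "conn (cmp A x)"
proof -
  let ?F = "{set xs | xs. walk xs \<and> set xs \<subseteq> A \<and> hd xs = x}"
  have "conn ({x} \<union> \<Union>?F)"
  proof (rule conn_Union)
    fix T assume "T \<in> ?F"
    then show "conn T \<and> ({x} \<inter> T \<noteq> {} \<or> (\<exists>a\<in>{x}. \<exists>b\<in>T. adj a b))"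
      using conn_walk by (auto simp: walk_def)
  qed simp
  moreover have "{x} \<union> \<Union>?F = cmp A x"
  proof (intro equalityI subsetI)
    fix y assume "y \<in> {x} \<union> \<Union>?F"
    then consider "y = x" | xs where "walk xs" "set xs \<subseteq> A" "hd xs = x" "y \<in> set xs" by blast
    then show "y \<in> cmp A x"
    proof cases
      case 1 then show ?thesis using cmp_self[OF assms] by simp
    next
      case 2 then show ?thesis using walk_prefix[OF 2(1,4)] unfolding cmp_def by blast
    qed
  next
    fix y assume "y \<in> cmp A x"
    then obtain xs where "walk xs" "set xs \<subseteq> A" "hd xs = x" "last xs = y" by (auto simp: cmp_def)
    moreover then have "y \<in> set xs" by (auto simp: walk_def)
    ultimately show "y \<in> {x} \<union> \<Union>?F" by blast
  qed
  ultimately show ?thesis by simp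
qed

text \<open>Provides a route through \<open>M\<close> that stops just before \<open>q\<close>: the
  component of \<open>p\<close> in \<open>M - {q}\<close> can be left inside \<open>M\<close> only
  through \<open>q\<close>.\<close>

lemma conn_minus:
  assumes "conn M" "p \<in> M" "q \<in> M" "p \<noteq> q"
  shows "\<exists>S. S \<subseteq> M - {q} \<and> conn S \<and> p \<in> S \<and> tch S q"
proof -
  let ?S = "cmp (M - {q}) p"
  have p: "p \<in> M - {q}" using assms by simp
  have S: "?S \<subseteq> M - {q}" "conn ?S" "p \<in> ?S" using cmp_sub cmp_conn[OF p] cmp_self[OF p] by blast+
  then have "?S \<subseteq> M" "?S \<noteq> {}" "?S \<noteq> M" using assms(3) by blast+
  then obtain a b where "a \<in> ?S" "b \<in> M - ?S" "adj a b"
    using assms(1) unfolding conn_def by (elim conjE allE[of _ ?S]) auto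
  then have "b = q" using cmp_step[of a "M - {q}" p b] by blast
  then have "tch ?S q" using \<open>a \<in> ?S\<close> \<open>adj a b\<close> by (auto simp: tch_def)
  then show ?thesis using S by blast
qed

lemma conn_adjoin:
  assumes "conn M" "\<And>x. x \<in> X \<Longrightarrow> \<exists>m\<in>M. adj x m"
  shows "conn (M \<union> X)"
proof -
  have "conn (M \<union> \<Union>((\<lambda>x. {x}) ` X))"
  proof (rule conn_Union[OF assms(1)])
    fix T assume "T \<in> (\<lambda>x. {x}) ` X"
    then obtain x where x: "x \<in> X" "T = {x}" by blast
    obtain m where "m \<in> M" "adj x m" using assms(2)[OF x(1)] by blast
    then show "conn T \<and> (M \<inter> T \<noteq> {} \<or> (\<exists>a\<in>M. \<exists>b\<in>T. adj a b))" using x(2) sym by auto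
  qed
  then show ?thesis by simp
qed

definition bd :: "'a set \<Rightarrow> 'a set" where
  "bd C = {x. x \<notin> C \<and> (\<exists>y\<in>C. adj x y)}"

definition deg3 :: "'a \<Rightarrow> bool" where
  "deg3 v \<longleftrightarrow> 3 \<le> card {y. adj v y}"

lemma deg3_avoid: "deg3 v \<Longrightarrow> \<exists>y. adj v y \<and> y \<noteq> a \<and> y \<noteq> b"
proof (rule ccontr)
  assume d: "deg3 v" and no: "\<not> (\<exists>y. adj v y \<and> y \<noteq> a \<and> y \<noteq> b)"
  then have "{y. adj v y} \<subseteq> {a, b}" by blast
  then have "card {y. adj v y} \<le> card {a, b}" by (intro card_mono) auto
  also have "\<dots> \<le> 2" by (simp add: card_insert_if)
  finally show False using d by (simp add: deg3_def)
qed

text \<open>The tripod of the overview with centre \<open>z\<close>. The legs are connected sets and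
  not paths, so that prolonging a leg is just a union.\<close>

definition tri :: "'a set \<Rightarrow> bool \<Rightarrow> 'a \<Rightarrow> 'a \<Rightarrow> 'a \<Rightarrow> bool" where
  "tri M t a b c \<longleftrightarrow> (\<exists>z A B D. z \<in> M \<and> s z = t \<and> A \<subseteq> M \<and> B \<subseteq> M \<and> D \<subseteq> M \<and>
     conn A \<and> conn B \<and> conn D \<and> a \<in> A \<and> b \<in> B \<and> c \<in> D \<and> z \<notin> A \<union> B \<union> D \<and>
     tch A z \<and> tch B z \<and> tch D z \<and> anti A B \<and> anti A D \<and> anti B D)"

text \<open>A parent is a vertex of \<open>M\<close> that has a leaf at present: when
  \<open>C\<close> shrinks and a vertex loses its last leaf, tripods at that vertex are no longer
  demanded.\<close>

definition par :: "'a set \<Rightarrow> 'a set \<Rightarrow> 'a \<Rightarrow> bool" where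
  "par M C p \<longleftrightarrow> p \<in> M \<and> (\<exists>l\<in>bd C. adj l p)"

definition state :: "'a set \<Rightarrow> 'a set \<Rightarrow> bool \<Rightarrow> bool" where
  "state M C t \<longleftrightarrow> conn M \<and> conn C \<and> (\<forall>v\<in>C. deg3 v) \<and> anti M C \<and>
     (\<forall>l\<in>bd C. s l = t \<and> (\<exists>p\<in>M. adj l p) \<and> (\<forall>p\<in>M. \<forall>q\<in>M. adj l p \<longrightarrow> adj l q \<longrightarrow> p = q)) \<and>
     (\<forall>a b c. par M C a \<and> par M C b \<and> par M C c \<and> a \<noteq> b \<and> a \<noteq> c \<and> b \<noteq> c \<longrightarrow> tri M t a b c)"

lemma anti_sym: "anti A B \<Longrightarrow> anti B A"
  using sym unfolding anti_def by blast

lemma anti_subset: "anti A B \<Longrightarrow> A' \<subseteq> A \<Longrightarrow> B' \<subseteq> B \<Longrightarrow> anti A' B'"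
  unfolding anti_def by blast

lemma anti_Un: "anti (A \<union> B) C \<longleftrightarrow> anti A C \<and> anti B C"
  unfolding anti_def by auto

lemma anti_Un2: "anti A (B \<union> C) \<longleftrightarrow> anti A B \<and> anti A C"
  unfolding anti_def by auto

lemma tri_obtain:
  assumes "tri M t a b c"
  obtains z A B D where "z \<in> M" "s z = t" "A \<subseteq> M" "B \<subseteq> M" "D \<subseteq> M"
     "conn A" "conn B" "conn D" "a \<in> A" "b \<in> B" "c \<in> D" "z \<notin> A \<union> B \<union> D"
     "tch A z" "tch B z" "tch D z" "anti A B" "anti A D" "anti B D"
  using assms unfolding tri_def by (elim exE conjE) (rule that)

lemma triI:
  assumes "z \<in> M" "s z = t" "A \<subseteq> M" "B \<subseteq> M" "D \<subseteq> M"
     "conn A" "conn B" "conn D" "a \<in> A" "b \<in> B" "c \<in> D" "z \<notin> A \<union> B \<union> D"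
     "tch A z" "tch B z" "tch D z" "anti A B" "anti A D" "anti B D"
  shows "tri M t a b c"
  unfolding tri_def using assms by (intro exI conjI)

lemma tri_swap1: assumes "tri M t a b c" shows "tri M t b a c"
proof -
  from assms obtain z A B D where h: "z \<in> M" "s z = t" "A \<subseteq> M" "B \<subseteq> M" "D \<subseteq> M"
     "conn A" "conn B" "conn D" "a \<in> A" "b \<in> B" "c \<in> D" "z \<notin> A \<union> B \<union> D"
     "tch A z" "tch B z" "tch D z" "anti A B" "anti A D" "anti B D" by (rule tri_obtain)
  show ?thesis by (rule triI[of z M t B A D]) (use h anti_sym in auto)
qed

lemma tri_swap2: assumes "tri M t a b c" shows "tri M t a c b"
proof -
  from assms obtain z A B D where h: "z \<in> M" "s z = t" "A \<subseteq> M" "B \<subseteq> M" "D \<subseteq> M"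
     "conn A" "conn B" "conn D" "a \<in> A" "b \<in> B" "c \<in> D" "z \<notin> A \<union> B \<union> D"
     "tch A z" "tch B z" "tch D z" "anti A B" "anti A D" "anti B D" by (rule tri_obtain)
  show ?thesis by (rule triI[of z M t A D B]) (use h anti_sym in auto)
qed

lemma tri_mono: assumes "tri M t a b c" "M \<subseteq> M'" shows "tri M' t a b c"
proof -
  from assms(1) obtain z A B D where h: "z \<in> M" "s z = t" "A \<subseteq> M" "B \<subseteq> M" "D \<subseteq> M"
     "conn A" "conn B" "conn D" "a \<in> A" "b \<in> B" "c \<in> D" "z \<notin> A \<union> B \<union> D"
     "tch A z" "tch B z" "tch D z" "anti A B" "anti A D" "anti B D" by (rule tri_obtain)
  show ?thesis by (rule triI[of z M' t A B D]) (use h assms(2) in auto)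
qed

lemma tri_star:
  assumes "z \<in> M" "s z = t" "a \<in> M" "b \<in> M" "c \<in> M" "adj a z" "adj b z" "adj c z"
    "a \<noteq> b" "a \<noteq> c" "b \<noteq> c"
  shows "tri M t a b c"
proof -
  have "s a = s b" "s a = s c" using assms(6-8) side by blast+
  then have "\<not> adj a b" "\<not> adj a c" "\<not> adj b c" using side by metis+
  then show ?thesis using assms irrefl
    by (intro triI[of z M t "{a}" "{b}" "{c}"]) (auto simp: tch_def anti_def)
qed

text \<open>The leg of \<open>p\<close> swallows \<open>Q\<close>. As \<open>p\<close> is the only
  vertex of \<open>M\<close> seen from \<open>Q\<close>, the other two legs stay anticomplete to
  it.\<close>

lemma tri_ext:
  assumes "tri M t p a b" "conn Q" "Q \<inter> M = {}" "\<And>x y. x \<in> Q \<Longrightarrow> y \<in> M \<Longrightarrow> adj x y \<Longrightarrow> y = p"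
    "tch Q p" "u \<in> Q"
  shows "tri (M \<union> Q) t u a b"
proof -
  from assms(1) obtain z A B D where h: "z \<in> M" "s z = t" "A \<subseteq> M" "B \<subseteq> M" "D \<subseteq> M"
     "conn A" "conn B" "conn D" "p \<in> A" "a \<in> B" "b \<in> D" "z \<notin> A \<union> B \<union> D"
     "tch A z" "tch B z" "tch D z" "anti A B" "anti A D" "anti B D" by (rule tri_obtain)
  have "conn (A \<union> Q)" using h(6,9) assms(2,5) sym by (intro conn_Un) (auto simp: tch_def)
  moreover have "anti (A \<union> Q) Z" if "anti A Z" "Z \<subseteq> M" for Z
  proof -
    have "p \<notin> Z" using that(1) h(9) by (auto simp: anti_def)
    then have "anti Q Z" using assms(3,4) that(2) unfolding anti_def by blast
    then show ?thesis using that(1) by (simp add: anti_Un)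
  qed
  then have "anti (A \<union> Q) B" "anti (A \<union> Q) D" using h by simp_all
  moreover have "tch (A \<union> Q) z" using h(13) by (auto simp: tch_def)
  moreover have "z \<notin> (A \<union> Q) \<union> B \<union> D" using h assms(3) by blast
  ultimately show ?thesis using h assms(6)
    by (intro triI[of z "M \<union> Q" t "A \<union> Q" B D]) auto
qed

lemma stateD:
  assumes "state M C t"
  shows "conn M" "conn C" "v \<in> C \<Longrightarrow> deg3 v" "anti M C" "l \<in> bd C \<Longrightarrow> s l = t"
    "l \<in> bd C \<Longrightarrow> \<exists>p\<in>M. adj l p" "l \<in> bd C \<Longrightarrow> p \<in> M \<Longrightarrow> q \<in> M \<Longrightarrow> adj l p \<Longrightarrow> adj l q \<Longrightarrow> p = q"
    "par M C a \<Longrightarrow> par M C b \<Longrightarrow> par M C c \<Longrightarrow> a \<noteq> b \<Longrightarrow> a \<noteq> c \<Longrightarrow> b \<noteq> c \<Longrightarrow> tri M t a b c"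
proof -
  note d = assms[unfolded state_def]
  show "conn M" "conn C" "anti M C" using d by simp_all
  show "v \<in> C \<Longrightarrow> deg3 v" using d by simp
  show "l \<in> bd C \<Longrightarrow> s l = t" "l \<in> bd C \<Longrightarrow> \<exists>p\<in>M. adj l p" using d by simp_all
  show "l \<in> bd C \<Longrightarrow> p \<in> M \<Longrightarrow> q \<in> M \<Longrightarrow> adj l p \<Longrightarrow> adj l q \<Longrightarrow> p = q" using d by simp
  show "par M C a \<Longrightarrow> par M C b \<Longrightarrow> par M C c \<Longrightarrow> a \<noteq> b \<Longrightarrow> a \<noteq> c \<Longrightarrow> b \<noteq> c \<Longrightarrow> tri M t a b c" using d by simp
qed

lemma stateI:
  assumes "conn M" "conn C" "\<And>v. v \<in> C \<Longrightarrow> deg3 v" "anti M C" "\<And>l. l \<in> bd C \<Longrightarrow> s l = t"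
    "\<And>l. l \<in> bd C \<Longrightarrow> \<exists>p\<in>M. adj l p"
    "\<And>l p q. l \<in> bd C \<Longrightarrow> p \<in> M \<Longrightarrow> q \<in> M \<Longrightarrow> adj l p \<Longrightarrow> adj l q \<Longrightarrow> p = q"
    "\<And>a b c. par M C a \<Longrightarrow> par M C b \<Longrightarrow> par M C c \<Longrightarrow> a \<noteq> b \<Longrightarrow> a \<noteq> c \<Longrightarrow> b \<noteq> c \<Longrightarrow> tri M t a b c"
  shows "state M C t"
  unfolding state_def using assms by simp

lemma state_leaf:
  assumes "state M C t" "l \<in> bd C"
  shows "l \<notin> M" "l \<notin> C" "p \<in> M \<Longrightarrow> q \<in> M \<Longrightarrow> adj l p \<Longrightarrow> adj l q \<Longrightarrow> p = q"
proof -
  show "l \<notin> C" using assms(2) by (simp add: bd_def)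
  show "l \<notin> M" using assms(2) stateD(4)[OF assms(1)] by (auto simp: bd_def anti_def)
  show "p \<in> M \<Longrightarrow> q \<in> M \<Longrightarrow> adj l p \<Longrightarrow> adj l q \<Longrightarrow> p = q" by (rule stateD(7)[OF assms])
qed

lemma state_inner:
  assumes "state M C t" "e \<in> C"
  shows "e \<notin> M" "q \<in> M \<Longrightarrow> \<not> adj e q" "q \<in> M \<Longrightarrow> \<not> adj q e"
  using stateD(4)[OF assms(1)] assms(2) sym[of e q] by (auto simp: anti_def)

section \<open>Ways of making new states\<close>

lemma state_sub:
  assumes "state M C t" "C' \<subseteq> C" "conn C'" "bd C' \<subseteq> bd C"
  shows "state M C' t"
proof -
  note S = stateD[OF assms(1)]
  have pr: "par M C' p \<Longrightarrow> par M C p" for p using assms(4) by (auto simp: par_def)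
  show ?thesis
  proof (rule stateI)
    show "anti M C'" using S(4) assms(2) by (rule anti_subset[OF _ order_refl])
    show "\<And>l p q. l \<in> bd C' \<Longrightarrow> p \<in> M \<Longrightarrow> q \<in> M \<Longrightarrow> adj l p \<Longrightarrow> adj l q \<Longrightarrow> p = q"
      using S(7) assms(4) by (meson subsetD)
    show "\<And>a b c. par M C' a \<Longrightarrow> par M C' b \<Longrightarrow> par M C' c \<Longrightarrow> a \<noteq> b \<Longrightarrow> a \<noteq> c \<Longrightarrow> b \<noteq> c \<Longrightarrow> tri M t a b c"
      using S(8) pr by simp
  qed (use S(1,3,5,6) assms in auto)
qed

text \<open>A fresh start that is independent of any earlier \<open>M\<close>. Two parents of one
  leaf would close a 4-cycle through \<open>z\<close>, and \<open>z\<close> is the tripod centre for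
  any three parents.\<close>

lemma star_state:
  assumes B: "\<And>b. b \<in> B \<Longrightarrow> adj b z" and C: "conn C" "\<And>v. v \<in> C \<Longrightarrow> deg3 v"
    and an: "anti (insert z B) C" and bd: "\<And>l. l \<in> bd C \<Longrightarrow> \<exists>b\<in>B. adj l b"
  shows "state (insert z B) C (s z)"
proof -
  have cM: "conn (insert z B)" using conn_adjoin[of "{z}" B] B by simp
  have bz: "l \<noteq> z" "s l = s z" "\<not> adj l z" if "l \<in> bd C" for l
  proof -
    obtain b where b: "b \<in> B" "adj l b" using bd[OF \<open>l \<in> bd C\<close>] by blast
    have "l \<notin> insert z B" using an that unfolding bd_def anti_def by blast
    then show "l \<noteq> z" by simp
    show "s l = s z" using side[OF b(2)] side[OF B[OF b(1)]] by metis
    then show "\<not> adj l z" using side by metis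
  qed
  have un: "p = q" if "l \<in> bd C" "p \<in> insert z B" "q \<in> insert z B" "adj l p" "adj l q" for l p q
  proof -
    have "p \<in> B" "q \<in> B" using bz(3)[OF that(1)] that(2-5) by auto
    then show ?thesis using c4[of l p q z] bz[OF that(1)] that(4,5) B[THEN sym] by metis
  qed
  have tt: "tri (insert z B) (s z) a b c"
    if "par (insert z B) C a" "par (insert z B) C b" "par (insert z B) C c" "a \<noteq> b" "a \<noteq> c" "b \<noteq> c" for a b c
  proof -
    have "p \<in> B" if "par (insert z B) C p" for p using that bz by (auto simp: par_def)
    then show ?thesis using that B by (intro tri_star[of z]) auto
  qed
  have ex: "\<exists>p\<in>insert z B. adj l p" if "l \<in> bd C" for l using bd[OF that] by blast
  show ?thesis by (rule stateI[OF cM C an bz(2) ex un tt])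
qed

text \<open>Of three parents in \<open>X0 \<union> X1\<close>, two hang at the same vertex
  \<open>p0\<close> or \<open>p1\<close>, which becomes the centre; if the third hangs at the other
  one, it is reached by a leg through \<open>M\<close>. So \<open>p0\<close> and \<open>p1\<close>
  both have to lie on the new side. A leaf might have one parent in each star, hence the assumption
  \<open>u\<close>.\<close>

lemma two_star_state:
  assumes M: "conn M" "p0 \<in> M" "p1 \<in> M" "p0 \<noteq> p1" "s p0 = t" "s p1 = t"
    and X0: "\<And>x. x \<in> X0 \<Longrightarrow> x \<notin> M \<and> adj x p0 \<and> (\<forall>q\<in>M. adj x q \<longrightarrow> q = p0)"
    and X1: "\<And>x. x \<in> X1 \<Longrightarrow> x \<notin> M \<and> adj x p1 \<and> (\<forall>q\<in>M. adj x q \<longrightarrow> q = p1)"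
    and C: "conn C" "\<And>v. v \<in> C \<Longrightarrow> deg3 v" "anti (M \<union> X0 \<union> X1) C"
    and b: "\<And>l. l \<in> bd C \<Longrightarrow> (\<exists>b\<in>X0 \<union> X1. adj l b) \<and> (\<forall>q\<in>M. \<not> adj l q)"
    and u: "\<And>l b c. l \<in> bd C \<Longrightarrow> b \<in> X0 \<union> X1 \<Longrightarrow> c \<in> X0 \<union> X1 \<Longrightarrow> adj l b \<Longrightarrow> adj l c \<Longrightarrow> b = c"
  shows "state (M \<union> X0 \<union> X1) C t"
proof -
  let ?M = "M \<union> X0 \<union> X1"
  have "\<exists>m\<in>M. adj x m" if "x \<in> X0 \<union> X1" for x using that X0[of x] X1[of x] M(2,3) by blast
  then have cM: "conn ?M" using conn_adjoin[OF M(1), of "X0 \<union> X1"] by (simp add: Un_assoc)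
  \<comment> \<open>Formulated for generic stars, because it is applied to \<open>X0\<close>,
    \<open>X1\<close> in both orders.\<close>
  have two: "tri ?M t a b c" if Y: "Y0 \<union> Y1 = X0 \<union> X1" "q0 \<in> M" "q1 \<in> M" "q0 \<noteq> q1" "s q0 = t"
    and Y0: "\<And>x. x \<in> Y0 \<Longrightarrow> x \<notin> M \<and> adj x q0 \<and> (\<forall>q\<in>M. adj x q \<longrightarrow> q = q0)"
    and Y1: "\<And>x. x \<in> Y1 \<Longrightarrow> x \<notin> M \<and> adj x q1 \<and> (\<forall>q\<in>M. adj x q \<longrightarrow> q = q1)"
    and sq: "s q1 = t"
    and abc: "a \<in> Y0" "b \<in> Y0" "c \<in> Y0 \<union> Y1" "a \<noteq> b" "a \<noteq> c" "b \<noteq> c" for Y0 Y1 q0 q1 a b c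
  proof (cases "c \<in> Y0")
    case True
    have "a \<in> ?M" "b \<in> ?M" "c \<in> ?M" "q0 \<in> ?M" using Y(1,2) abc(1-3) by blast+
    moreover have "adj a q0" "adj b q0" "adj c q0" using Y0 abc(1,2) True by simp_all
    ultimately show ?thesis using Y(5) abc(4-6) by (intro tri_star[of q0])
  next
    case False
    then have c: "c \<in> Y1" using abc by simp
    \<comment> \<open>The leg of \<open>c\<close> runs from its base \<open>q1\<close> through
      \<open>M\<close> to the centre \<open>q0\<close>.\<close>
    obtain S where S: "S \<subseteq> M - {q0}" "conn S" "q1 \<in> S" "tch S q0"
      using conn_minus[OF M(1) Y(3,2) Y(4)[symmetric]] by blast
    note ha = Y0[OF abc(1)] and hb = Y0[OF abc(2)] and hc = Y1[OF c]
    have cS: "conn (insert c S)" using conn_insert[OF S(2)] S(3) hc sym by (auto simp: tch_def)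
    have sd: "s a = s b" "s a = s c" using side[of a q0] side[of b q0] side[of c q1] ha hb hc Y(5) sq by auto
    have nab: "\<not> adj a b" "\<not> adj a c" "\<not> adj b c" using sd side by metis+
    have sub: "{a} \<subseteq> ?M" "{b} \<subseteq> ?M" "insert c S \<subseteq> ?M" "q0 \<in> ?M" using Y(1,2) abc(1-3) S(1) by auto
    have an: "anti {a} {b}" "anti {a} (insert c S)" "anti {b} (insert c S)"
      using nab abc(4-6) ha hb S(1) unfolding anti_def by auto
    have zn: "q0 \<notin> {a} \<union> {b} \<union> insert c S" 
      using S(1) ha[THEN conjunct1] hb[THEN conjunct1] hc[THEN conjunct1] Y(2) by blast
    have "tch {a} q0" "tch {b} q0" "tch (insert c S) q0"
      using ha[THEN conjunct2, THEN conjunct1] hb[THEN conjunct2, THEN conjunct1] S(4) unfolding tch_def by auto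
    then show ?thesis
      by (intro triI[of q0 ?M t "{a}" "{b}" "insert c S"] sub an zn cS Y(5) conn_sing) simp_all
  qed
  have t0: "tri ?M t a b c" if "a \<in> X0" "b \<in> X0" "c \<in> X0 \<union> X1" "a \<noteq> b" "a \<noteq> c" "b \<noteq> c" for a b c
    by (rule two[OF refl M(2-5) X0 X1 M(6)]) (use that in simp_all)
  have t1: "tri ?M t a b c" if "a \<in> X1" "b \<in> X1" "c \<in> X0 \<union> X1" "a \<noteq> b" "a \<noteq> c" "b \<noteq> c" for a b c
    by (rule two[OF Un_commute M(3,2) M(4)[symmetric] M(6) X1 X0 M(5)]) (use that in auto)
  have tt: "tri ?M t a b c" if p: "par ?M C a" "par ?M C b" "par ?M C c" "a \<noteq> b" "a \<noteq> c" "b \<noteq> c" for a b c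
  proof -
    have in01: "q \<in> X0 \<union> X1" if "par ?M C q" for q using that b unfolding par_def by blast
    then have m: "a \<in> X0 \<union> X1" "b \<in> X0 \<union> X1" "c \<in> X0 \<union> X1" using p by blast+
    then consider "a \<in> X0" "b \<in> X0" | "a \<in> X0" "c \<in> X0" | "b \<in> X0" "c \<in> X0"
      | "a \<in> X1" "b \<in> X1" | "a \<in> X1" "c \<in> X1" | "b \<in> X1" "c \<in> X1" by blast
    then show ?thesis
    proof cases
      case 1 then show ?thesis using t0 m p by blast
    next
      case 2 then show ?thesis using tri_swap2[OF t0[of a c b]] m p by blast
    next
      case 3 then show ?thesis using tri_swap1[OF tri_swap2[OF t0[of b c a]]] m p by blast
    next
      case 4 then show ?thesis using t1 m p by blast
    next
      case 5 then show ?thesis using tri_swap2[OF t1[of a c b]] m p by blast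
    next
      case 6 then show ?thesis using tri_swap1[OF tri_swap2[OF t1[of b c a]]] m p by blast
    qed
  qed
  have sl: "s l = t" if "l \<in> bd C" for l
  proof -
    obtain q where "q \<in> X0 \<union> X1" "adj l q" using b[OF \<open>l \<in> bd C\<close>] by blast
    then have "s q \<noteq> t" using X0[of q] X1[of q] M(5,6) side[of q p0] side[of q p1] by auto
    then show ?thesis using side[OF \<open>adj l q\<close>] by blast
  qed
  have un: "p = q" if "l \<in> bd C" "p \<in> ?M" "q \<in> ?M" "adj l p" "adj l q" for l p q
    using that b[OF that(1)] u[OF that(1)] by blast
  have ex: "\<exists>p\<in>?M. adj l p" if "l \<in> bd C" for l using b[OF that] by blast
  show ?thesis by (rule stateI[OF cM C sl ex un tt])
qed

text \<open>A leaf \<open>l\<close> of \<open>p0\<close> and some neighbours \<open>B\<close> of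
  \<open>l\<close> in \<open>C\<close> join \<open>M\<close>. If at least two of three parents lie
  in \<open>B\<close>, the centre is \<open>l\<close>, with all of \<open>M\<close> as the leg of an
  old parent; if only one does, it takes over the leg of \<open>p0\<close> in an old tripod. For
  this reason no remaining leaf may have \<open>p0\<close> as parent.\<close>

lemma ext_state:
  assumes st: "state M C t" and p0: "p0 \<in> M" and l: "l \<in> bd C" "adj l p0"
    and B: "B \<subseteq> C" "\<And>e. e \<in> B \<Longrightarrow> adj e l"
    and C': "C' \<subseteq> C" "conn C'" "anti (insert l B) C'"
    and bdC: "\<And>z. z \<in> bd C' \<Longrightarrow> (z \<in> bd C \<and> \<not> adj z p0 \<and> (\<forall>e\<in>B. \<not> adj z e)) \<or> (z \<in> C \<and> (\<exists>e\<in>B. adj z e))"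
  shows "state (M \<union> insert l B) C' t"
proof -
  let ?M = "M \<union> insert l B"
  note S = stateD[OF st]
  have lM: "l \<notin> M" "\<And>q. q \<in> M \<Longrightarrow> adj l q \<Longrightarrow> q = p0" using state_leaf[OF st l(1)] l(2) p0 by blast+
  have BM: "e \<notin> M" "\<And>q. q \<in> M \<Longrightarrow> \<not> adj e q" "\<And>q. q \<in> M \<Longrightarrow> \<not> adj q e" if "e \<in> C" for e
    using state_inner[OF st that] by blast+
  have lC: "l \<notin> C" using l by (simp add: bd_def)
  have cB: "conn (insert l B)" using conn_adjoin[of "{l}" B] B(2) by simp
  have cM: "conn ?M" by (rule conn_Un[OF S(1) cB]) (use l p0 sym in blast)
  have zC: "\<not> adj z q" if "z \<in> C" "q \<in> M" for z q using that BM by blast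
  have sl: "s l = t" using S(5) l by blast
  have zl: "\<not> adj z l" "s z = t" if "z \<in> bd C'" for z
  proof -
    show st: "s z = t" using bdC[OF that] S(5) B side sl by metis
    then show "\<not> adj z l" using sl side by metis
  qed
  have un: "p = q" if h: "z \<in> bd C'" "p \<in> ?M" "q \<in> ?M" "adj z p" "adj z q" for z p q
  proof -
    from bdC[OF h(1)] show ?thesis
    proof
      assume z: "z \<in> bd C \<and> \<not> adj z p0 \<and> (\<forall>e\<in>B. \<not> adj z e)"
      then have "p \<in> M" "q \<in> M" using h zl by blast+
      then show ?thesis using S(7) z h by blast
    next
      assume z: "z \<in> C \<and> (\<exists>e\<in>B. adj z e)"
      then have "p \<in> B" "q \<in> B" using h zl zC by blast+
      moreover have "z \<noteq> l" using z lC by blast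
      ultimately show ?thesis using c4[of z p q l] h B sym by blast
    qed
  qed
  have ex: "\<exists>p\<in>?M. adj z p" if "z \<in> bd C'" for z using bdC[OF that] S(6) by blast
  have pr: "q \<in> B \<or> (par M C q \<and> q \<noteq> p0)" if q: "par ?M C' q" for q
  proof -
    obtain z where z: "z \<in> bd C'" "adj z q" "q \<in> ?M" using q by (auto simp: par_def)
    from bdC[OF z(1)] show ?thesis
    proof
      assume z': "z \<in> bd C \<and> \<not> adj z p0 \<and> (\<forall>e\<in>B. \<not> adj z e)"
      then have "q \<in> M" using z zl by blast
      then show ?thesis using z z' by (auto simp: par_def)
    next
      assume "z \<in> C \<and> (\<exists>e\<in>B. adj z e)"
      then show ?thesis using z zl zC by blast
    qed
  qed
  have pp0: "par M C p0" using l p0 by (auto simp: par_def)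
  have one: "tri ?M t e a b" if "e \<in> B" "par M C a" "par M C b" "a \<noteq> p0" "b \<noteq> p0" "a \<noteq> b" for e a b
  proof (rule tri_ext[of M t p0])
    show "tri M t p0 a b" using S(8) pp0 that by blast
    show "insert l B \<inter> M = {}" using lM BM B by blast
    show "\<And>x y. x \<in> insert l B \<Longrightarrow> y \<in> M \<Longrightarrow> adj x y \<Longrightarrow> y = p0" using lM BM B by blast
  qed (use cB l that in \<open>auto simp: tch_def\<close>)
  have two: "tri ?M t e f a" if "e \<in> B" "f \<in> B" "e \<noteq> f" "a \<in> M" for e f a
  proof -
    have sd: "s e = s f" using B that side by metis
    have nef: "\<not> adj e f" using sd side by metis
    have eC: "e \<in> C" "f \<in> C" using B that by blast+
    have an: "anti {e} {f}" "anti {e} M" "anti {f} M"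
      using nef that BM[OF eC(1)] BM[OF eC(2)] unfolding anti_def by blast+
    have "l \<notin> {e} \<union> {f} \<union> M" using lM eC lC by blast
    moreover have "tch {e} l" "tch {f} l" "tch M l" using B that l p0 sym unfolding tch_def by blast+
    ultimately show ?thesis
      by (intro triI[of l ?M t "{e}" "{f}" M] an S(1) sl) (use that in auto)
  qed
  have three: "tri ?M t e f g" if "e \<in> B" "f \<in> B" "g \<in> B" "e \<noteq> f" "e \<noteq> g" "f \<noteq> g" for e f g
    using that B sl by (intro tri_star[of l]) auto
  have zero: "tri ?M t a b c" if "par M C a" "par M C b" "par M C c" "a \<noteq> b" "a \<noteq> c" "b \<noteq> c" for a b c
    using S(8)[OF that] by (rule tri_mono) auto
  have parM: "par M C q \<Longrightarrow> q \<in> M" for q by (simp add: par_def)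
  have tt: "tri ?M t a b c" if p: "par ?M C' a" "par ?M C' b" "par ?M C' c" and d: "a \<noteq> b" "a \<noteq> c" "b \<noteq> c" for a b c
    using pr[OF p(1)] pr[OF p(2)] pr[OF p(3)]
  proof (elim disjE)
    assume "a \<in> B" "b \<in> B" "c \<in> B" then show ?thesis using three d by blast
  next
    assume "a \<in> B" "b \<in> B" "par M C c \<and> c \<noteq> p0" then show ?thesis using two d parM by blast
  next
    assume "a \<in> B" "par M C b \<and> b \<noteq> p0" "c \<in> B" then show ?thesis using tri_swap2[OF two[of a c b]] d parM by blast
  next
    assume "a \<in> B" "par M C b \<and> b \<noteq> p0" "par M C c \<and> c \<noteq> p0" then show ?thesis using one d by blast
  next
    assume "par M C a \<and> a \<noteq> p0" "b \<in> B" "c \<in> B" then show ?thesis using tri_swap1[OF tri_swap2[OF two[of b c a]]] d parM by blast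
  next
    assume "par M C a \<and> a \<noteq> p0" "b \<in> B" "par M C c \<and> c \<noteq> p0" then show ?thesis using tri_swap1[OF one[of b a c]] d by blast
  next
    assume "par M C a \<and> a \<noteq> p0" "par M C b \<and> b \<noteq> p0" "c \<in> B" then show ?thesis using tri_swap2[OF tri_swap1[OF one[of c a b]]] d by blast
  next
    assume "par M C a \<and> a \<noteq> p0" "par M C b \<and> b \<noteq> p0" "par M C c \<and> c \<noteq> p0" then show ?thesis using zero d by blast
  qed
  have "anti M C'" by (rule anti_subset[OF S(4) order_refl C'(1)])
  then have an: "anti ?M C'" using C'(3) by (simp only: anti_Un)
  have dg: "\<forall>v\<in>C'. deg3 v" using S(3) C' by blast
  show ?thesis by (rule stateI[OF cM C'(2) _ an zl(2) ex un tt]) (use dg in blast)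
qed

text \<open>Only the far end \<open>u\<close> of the absorbed set can become a parent. So at most
  one of three parents is new, and it takes over the leg of \<open>p0\<close>. Since
  \<open>u\<close> has to lie on the side of the parents, \<open>s u \<noteq> t\<close> is
  required.\<close>

lemma path_ext_state:
  assumes st: "state M C t" and p0: "p0 \<in> M" and l: "l \<in> bd C" "adj l p0"
    and W: "W \<subseteq> C" "conn (insert l W)" "u \<in> W" "s u \<noteq> t"
    and C': "C' \<subseteq> C" "conn C'" "anti (insert l W) C'"
    and bdC: "\<And>z. z \<in> bd C' \<Longrightarrow> (z \<in> bd C \<and> \<not> adj z p0 \<and> (\<forall>e\<in>W. \<not> adj z e)) \<or>
                (z \<in> C \<and> adj z u \<and> (\<forall>e\<in>W. adj z e \<longrightarrow> e = u))"
  shows "state (M \<union> insert l W) C' t"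
proof -
  let ?M = "M \<union> insert l W"
  note S = stateD[OF st]
  have lM: "l \<notin> M" "\<And>q. q \<in> M \<Longrightarrow> adj l q \<Longrightarrow> q = p0" using state_leaf[OF st l(1)] l(2) p0 by blast+
  have BM: "e \<notin> M" "\<And>q. q \<in> M \<Longrightarrow> \<not> adj e q" if "e \<in> C" for e
    using state_inner[OF st that] by blast+
  have cM: "conn ?M" by (rule conn_Un[OF S(1) W(2)]) (use l p0 sym in blast)
  have sl: "s l = t" using S(5) l by blast
  have zl: "s z = t" "\<not> adj z l" if "z \<in> bd C'" for z
  proof -
    from bdC[OF that] show st: "s z = t"
    proof
      assume "z \<in> C \<and> adj z u \<and> (\<forall>e\<in>W. adj z e \<longrightarrow> e = u)"
      then show ?thesis using W(4) side[of z u] by blast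
    qed (use S(5) in blast)
    then show "\<not> adj z l" using sl side by metis
  qed
  have cl: "\<exists>q. q \<in> ?M \<and> adj z q \<and> (\<forall>p\<in>?M. adj z p \<longrightarrow> p = q) \<and> (q = u \<or> par M C q \<and> q \<noteq> p0)" if z: "z \<in> bd C'" for z
  proof -
    from bdC[OF z] show ?thesis
    proof
      assume z': "z \<in> bd C \<and> \<not> adj z p0 \<and> (\<forall>e\<in>W. \<not> adj z e)"
      then obtain q where q: "q \<in> M" "adj z q" using S(6) by blast
      have "p = q" if "p \<in> ?M" "adj z p" for p
      proof -
        have "p \<in> M" using that z' zl(2)[OF z] by blast
        then show ?thesis using S(7) z' q that by blast
      qed
      moreover have "par M C q" using z' q by (auto simp: par_def)
      ultimately show ?thesis using q z' by blast
    next
      assume z': "z \<in> C \<and> adj z u \<and> (\<forall>e\<in>W. adj z e \<longrightarrow> e = u)"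
      have "p = u" if "p \<in> ?M" "adj z p" for p using that z' zl(2)[OF z] BM by blast
      then show ?thesis using z' W by blast
    qed
  qed
  have pr: "q = u \<or> (par M C q \<and> q \<noteq> p0)" if q: "par ?M C' q" for q
    using q cl unfolding par_def by blast
  have pp0: "par M C p0" using l p0 by (auto simp: par_def)
  have one: "tri ?M t u a b" if "par M C a" "par M C b" "a \<noteq> p0" "b \<noteq> p0" "a \<noteq> b" for a b
  proof (rule tri_ext[of M t p0])
    show "tri M t p0 a b" using S(8) pp0 that by blast
    show "insert l W \<inter> M = {}" using lM BM W by blast
    show "\<And>x y. x \<in> insert l W \<Longrightarrow> y \<in> M \<Longrightarrow> adj x y \<Longrightarrow> y = p0" using lM BM W by blast
  qed (use W l that in \<open>auto simp: tch_def\<close>)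
  have zero: "tri ?M t a b c" if "par M C a" "par M C b" "par M C c" "a \<noteq> b" "a \<noteq> c" "b \<noteq> c" for a b c
    using S(8)[OF that] by (rule tri_mono) auto
  have tt: "tri ?M t a b c" if p: "par ?M C' a" "par ?M C' b" "par ?M C' c" and d: "a \<noteq> b" "a \<noteq> c" "b \<noteq> c" for a b c
  proof -
    consider "a = u" "par M C b" "b \<noteq> p0" "par M C c" "c \<noteq> p0"
      | "b = u" "par M C a" "a \<noteq> p0" "par M C c" "c \<noteq> p0"
      | "c = u" "par M C a" "a \<noteq> p0" "par M C b" "b \<noteq> p0"
      | "par M C a" "par M C b" "par M C c"
      using pr[OF p(1)] pr[OF p(2)] pr[OF p(3)] d by blast
    then show ?thesis
    proof cases
      case 1 then show ?thesis using one[of b c] d by blast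
    next
      case 2 then show ?thesis using tri_swap1[OF one[of a c]] d by blast
    next
      case 3 then show ?thesis using tri_swap2[OF tri_swap1[OF one[of a b]]] d by blast
    next
      case 4 then show ?thesis using zero d by blast
    qed
  qed
  have "anti M C'" by (rule anti_subset[OF S(4) order_refl C'(1)])
  then have an: "anti ?M C'" using C'(3) by (simp only: anti_Un)
  have dg: "\<forall>v\<in>C'. deg3 v" using S(3) C' by blast
  have bb: "\<forall>l\<in>bd C'. s l = t \<and> (\<exists>p\<in>?M. adj l p) \<and> (\<forall>p\<in>?M. \<forall>q\<in>?M. adj l p \<longrightarrow> adj l q \<longrightarrow> p = q)"
  proof (intro ballI conjI impI)
    fix z p q assume z: "z \<in> bd C'" and h: "p \<in> ?M" "q \<in> ?M" "adj z p" "adj z q"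
    from cl[OF z] obtain r where "\<forall>p\<in>?M. adj z p \<longrightarrow> p = r" by blast
    then have "p = r" "q = r" using h by blast+
    then show "p = q" by simp
  qed (use cl zl in blast)+
  show ?thesis unfolding state_def by (intro conjI cM C'(2) an dg bb allI impI) (use tt in blast)
qed

lemma bd_cmp: "z \<in> bd (cmp A x) \<Longrightarrow> z \<notin> A"
  using cmp_step sym unfolding bd_def by blast

lemma bdI: "z \<notin> C \<Longrightarrow> y \<in> C \<Longrightarrow> adj z y \<Longrightarrow> z \<in> bd C"
  unfolding bd_def by blast

lemma bdE: assumes "z \<in> bd C" obtains y where "z \<notin> C" "y \<in> C" "adj z y" "adj y z"
  using assms sym unfolding bd_def by blast

text \<open>With a single possible parent the tripod condition is vacuous.\<close>

lemma init_state:
  assumes "conn C" "\<And>v. v \<in> C \<Longrightarrow> deg3 v" "x \<notin> C" "\<And>y. y \<in> C \<Longrightarrow> \<not> adj x y" "\<And>z. z \<in> bd C \<Longrightarrow> adj z x"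
  shows "state {x} C (\<not> s x)"
proof (rule stateI)
  show "anti {x} C" using assms(3,4) by (auto simp: anti_def)
  show "s l = (\<not> s x)" if "l \<in> bd C" for l using side[OF assms(5)[OF that]] by simp
  show "tri {x} (\<not> s x) a b c" if "par {x} C a" "par {x} C b" "a \<noteq> b" for a b c
    using that by (simp add: par_def)
qed (use assms in auto)

end

section \<open>First consequences of the minimality of \<open>C\<close>\<close>

locale minimal_state = theta_free +
  fixes M C :: "'a set" and t :: bool
  assumes st: "state M C t"
    and smallest: "state M' C' t' \<Longrightarrow> card C \<le> card C'"
begin

lemma CV: "C \<subseteq> V"
proof
  fix v assume "v \<in> C"
  then have "deg3 v" using stateD(3)[OF st] by blast
  then show "v \<in> V" using deg3_avoid adjV by blast
qed

lemma smaller: "state M' C' t' \<Longrightarrow> C' \<subseteq> C \<Longrightarrow> c \<in> C \<Longrightarrow> c \<notin> C' \<Longrightarrow> False"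
  using smallest[of M' C' t'] psubset_card_mono[of C C'] finite_subset[OF CV finV] by (metis leD psubsetI)

lemma degC: "v \<in> C \<Longrightarrow> deg3 v" using stateD(3)[OF st] .
lemma connM: "conn M" using stateD(1)[OF st] .
lemma connC: "conn C" using stateD(2)[OF st] .
lemma antiMC: "anti M C" using stateD(4)[OF st] .
lemma sbd: "l \<in> bd C \<Longrightarrow> s l = t" using stateD(5)[OF st] .
lemma parent: "l \<in> bd C \<Longrightarrow> \<exists>p\<in>M. adj l p" using stateD(6)[OF st] .
lemma parent_unique: "l \<in> bd C \<Longrightarrow> p \<in> M \<Longrightarrow> q \<in> M \<Longrightarrow> adj l p \<Longrightarrow> adj l q \<Longrightarrow> p = q" using stateD(7)[OF st] .
lemma triM: "par M C a \<Longrightarrow> par M C b \<Longrightarrow> par M C c \<Longrightarrow> a \<noteq> b \<Longrightarrow> a \<noteq> c \<Longrightarrow> b \<noteq> c \<Longrightarrow> tri M t a b c"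
  using stateD(8)[OF st] .
lemma inner: assumes "e \<in> C" shows "e \<notin> M" "q \<in> M \<Longrightarrow> \<not> adj e q" "q \<in> M \<Longrightarrow> \<not> adj q e"
  using state_inner[OF st assms] by blast+
lemma leaf: assumes "l \<in> bd C" shows "l \<notin> M" "l \<notin> C" using state_leaf[OF st assms] by blast+

lemma bd_subset: "C' \<subseteq> C \<Longrightarrow> z \<in> bd C' \<Longrightarrow> z \<in> C \<or> z \<in> bd C"
  by (auto simp: bd_def)

text \<open>Without leaves \<open>C\<close> is closed under adjacency, so the initial construction
  can be repeated inside \<open>C\<close> from any of its vertices, which is then lost.\<close>

lemma bdC_ne: "bd C \<noteq> {}"
proof
  assume e: "bd C = {}"
  have in_C: "y \<in> C" if "x \<in> C" "adj x y" for x y using e bdI[of y C x] sym[OF that(2)] that by blast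
  obtain x where x: "x \<in> C" using conn_ne[OF connC] by blast
  obtain a where a: "adj x a" using deg3_avoid[OF degC[OF x]] by blast
  have aC: "a \<in> C" using in_C x a by blast
  obtain c where c: "adj a c" "c \<noteq> x" using deg3_avoid[OF degC[OF aC]] by blast
  have cC: "c \<in> C" using in_C aC c by blast
  have "\<not> adj x c" using side[OF a] side[OF c(1)] side[of x c] by auto
  let ?R = "{y\<in>C. y \<noteq> x \<and> \<not> adj x y}" let ?C = "cmp ?R c"
  have cR: "c \<in> ?R" using cC c \<open>\<not> adj x c\<close> by simp
  have sub: "?C \<subseteq> ?R" by (rule cmp_sub)
  have "state {x} ?C (\<not> s x)"
  proof (rule init_state)
    fix z assume z: "z \<in> bd ?C"
    obtain y where y: "y \<in> ?C" "adj z y" "adj y z" using z by (elim bdE)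
    have "z \<in> C" using in_C y sub by blast
    moreover have "z \<noteq> x" using y sub by blast
    ultimately show "adj z x" using bd_cmp[OF z] sym by blast
  qed (use sub degC cmp_conn[OF cR] in auto)
  then show False using smaller[of _ ?C _ x] sub x by blast
qed

lemma anti_leg:
  assumes "l \<in> bd C" "adj l p" "p \<in> A" "A \<subseteq> M" "B \<subseteq> M" "anti A B"
  shows "anti {l} B"
proof -
  have "p \<notin> B" using assms(3,6) by (auto simp: anti_def)
  moreover have "q = p" if "q \<in> B" "adj l q" for q
    using parent_unique[of l q p] that assms by blast
  ultimately show ?thesis using leaf(1)[OF assms(1)] assms(5) by (auto simp: anti_def)
qed

text \<open>The source of most contradictions about \<open>C\<close>. Three routes lead from
  \<open>c\<close> to the centre \<open>z\<close>: through \<open>l0\<close>, through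
  \<open>l1\<close> and through \<open>Q\<close>, each continued by a leg of the tripod. As a
  neighbour of a leaf, \<open>c\<close> is not on side \<open>t\<close>, but \<open>z\<close>
  is.\<close>

lemma theta_parents:
  assumes c: "c \<in> C" and l0: "l0 \<in> bd C" "adj c l0" "adj l0 p0" "p0 \<in> M"
    and l1: "l1 \<in> bd C" "adj c l1" "adj l1 p1" "p1 \<in> M"
    and Q: "conn Q" "tch Q c" "c \<notin> Q" "tch Q p2" "Q \<inter> M = {}" "\<And>q x. q \<in> Q \<Longrightarrow> x \<in> M \<Longrightarrow> adj q x \<Longrightarrow> x = p2"
      "anti {l0} Q" "anti {l1} Q"
    and p2: "par M C p2" and d: "p0 \<noteq> p1" "p0 \<noteq> p2" "p1 \<noteq> p2"
  shows False
proof -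
  have "par M C p0" "par M C p1" using l0 l1 by (auto simp: par_def)
  then have "tri M t p0 p1 p2" using triM p2 d by blast
  then obtain z A B D where h: "z \<in> M" "s z = t" "A \<subseteq> M" "B \<subseteq> M" "D \<subseteq> M"
     "conn A" "conn B" "conn D" "p0 \<in> A" "p1 \<in> B" "p2 \<in> D" "z \<notin> A \<union> B \<union> D"
     "tch A z" "tch B z" "tch D z" "anti A B" "anti A D" "anti B D" by (rule tri_obtain)
  have cn: "conn (insert l0 A)" "conn (insert l1 B)"
    using conn_insert[OF h(6), of l0] conn_insert[OF h(7), of l1] l0 l1 h(9,10) sym by (auto simp: tch_def)
  have cQ: "conn (Q \<union> D)" using conn_Un[OF Q(1) h(8)] Q(4) h(11) by (auto simp: tch_def)
  have sd: "s l0 = s l1" using sbd l0 l1 by simp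
  have n01: "l0 \<noteq> l1" using parent_unique[of l0 p0 p1] l0 l1 d by auto
  have a01: "anti (insert l0 A) (insert l1 B)"
  proof -
    have "anti {l0} B" using anti_leg[OF l0(1,3) h(9,3,4,16)] .
    moreover have "anti {l1} A" using anti_leg[OF l1(1,3) h(10,4,3) anti_sym[OF h(16)]] .
    moreover have "anti {l0} {l1}" using n01 sd side[of l0 l1] by (auto simp: anti_def)
    ultimately show ?thesis using h(16) anti_sym anti_Un[of "{l0}" A] anti_Un2[of _ "{l1}" B] by auto
  qed
  have aQ: "anti Q A'" if "A' \<subseteq> M" "p2 \<notin> A'" for A'
    using Q(5,6) that unfolding anti_def by blast
  have p2n: "p2 \<notin> A" "p2 \<notin> B" using h(11,17,18) by (auto simp: anti_def)
  have aD: "anti (insert l (X)) (Q \<union> D)" if "l \<in> bd C" "adj l p" "p \<in> X" "X \<subseteq> M" "anti X D" "p2 \<notin> X" "anti {l} Q" for l p X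
  proof -
    have "anti {l} D" using anti_leg[OF that(1-4) h(5) that(5)] .
    moreover have "anti X Q" using aQ[OF that(4,6)] by (rule anti_sym)
    ultimately show ?thesis using that anti_Un[of "{l}" X] by (auto simp: anti_Un2)
  qed
  have nz: "\<not> adj c z" using inner(2)[OF c h(1)] .
  have "s c = s z"
  proof (rule theta[OF cn cQ a01 aD aD])
    show "tch (insert l0 A) z" "tch (insert l1 B) z" "tch (Q \<union> D) z" using h by (auto simp: tch_def)
    show "tch (insert l0 A) c" "tch (insert l1 B) c" "tch (Q \<union> D) c"
      using l0(2) l1(2) sym Q(2) by (auto simp: tch_def)
    show "c \<notin> insert l0 A \<union> insert l1 B \<union> (Q \<union> D)"
      using inner(1)[OF c] h(3-5) leaf(2) l0(1) l1(1) c Q(3) by blast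
    show "z \<notin> insert l0 A \<union> insert l1 B \<union> (Q \<union> D)"
      using h(1,12) leaf(1) l0(1) l1(1) Q(5) by blast
  qed (use l0 l1 h p2n Q nz in auto)
  then show False using side[OF l0(2)] sbd[OF l0(1)] h(2) by simp
qed

lemma sibling_unique:
  assumes "adj c l" "adj c l'" "adj l p" "adj l' p" "c \<in> C" "p \<in> M" shows "l = l'"
  using c4[of c l l' p] assms sym inner(1)[OF assms(5)] by blast

text \<open>The absence of 4-cycles makes the three parents distinct, and the leaf \<open>l2\<close>
  alone is the third route in \<open>theta_parents\<close>.\<close>

lemma two_leaves:
  assumes c: "c \<in> C" and l: "l0 \<in> bd C" "l1 \<in> bd C" "l2 \<in> bd C" "adj c l0" "adj c l1" "adj c l2"
    and d: "l0 \<noteq> l1" "l0 \<noteq> l2" "l1 \<noteq> l2"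
  shows False
proof -
  obtain p0 p1 p2 where p: "p0 \<in> M" "p1 \<in> M" "p2 \<in> M" "adj l0 p0" "adj l1 p1" "adj l2 p2"
    using parent l by metis
  have pd: "p0 \<noteq> p1" "p0 \<noteq> p2" "p1 \<noteq> p2"
    using sibling_unique[of c l0 l1 p0] sibling_unique[of c l0 l2 p0] sibling_unique[of c l1 l2 p1] c l p d by auto
  have an: "anti {l} {l2}" if "l \<in> bd C" "l \<noteq> l2" for l
    using that side[of l l2] sbd[OF that(1)] sbd[OF l(3)] by (auto simp: anti_def)
  show False
  proof (rule theta_parents[OF c l(1,4) p(4,1) l(2,5) p(5,2)])
    show "tch {l2} c" "tch {l2} p2" using l(6) p(6) sym by (auto simp: tch_def)
    show "c \<notin> {l2}" using leaf(2)[OF l(3)] c by blast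
    show "{l2} \<inter> M = {}" using leaf(1)[OF l(3)] by blast
    show "x = p2" if "q \<in> {l2}" "x \<in> M" "adj q x" for q x
      using parent_unique[OF l(3) that(2) p(3) _ p(6)] that by blast
    show "par M C p2" using p(3,6) l(3) by (auto simp: par_def)
  qed (use pd an l d in simp_all)
qed

definition nbC :: "'a \<Rightarrow> 'a set" where "nbC l = {x\<in>C. adj x l}"

end

lemma (in minimal_state) nbCD: "x \<in> nbC l \<Longrightarrow> x \<in> C" "x \<in> nbC l \<Longrightarrow> adj x l" "x \<in> nbC l \<Longrightarrow> adj l x"
  using sym by (auto simp: nbC_def)

lemma (in minimal_state) nbCI: "x \<in> C \<Longrightarrow> adj x l \<Longrightarrow> x \<in> nbC l"
  by (auto simp: nbC_def)

section \<open>A vertex with two leaf neighbours\<close>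

locale double_leaf = minimal_state +
  fixes c l0 l1 p0 p1 :: 'a
  assumes cC: "c \<in> C" and l0: "l0 \<in> bd C" "adj c l0" "adj l0 p0" "p0 \<in> M"
    and l1: "l1 \<in> bd C" "adj c l1" "adj l1 p1" "p1 \<in> M" and p01: "p0 \<noteq> p1"
begin

definition R :: "'a set" where "R = C - (nbC l0 \<union> nbC l1 \<union> nbC c)"

text \<open>The components of \<open>R\<close> that come within distance two of \<open>c\<close>, by
  way of a neighbour of \<open>c\<close> in \<open>C\<close>.\<close>

definition good :: "'a set \<Rightarrow> bool" where
  "good Y \<longleftrightarrow> (\<exists>d\<in>nbC c. \<exists>x\<in>R. adj x d \<and> Y = cmp R x)"

text \<open>The numbers are positions on the path \<open>p0, l0, c, l1, p1\<close>: the component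
  touches a further neighbour, a leaf or a vertex of \<open>C\<close>, of the vertex at that
  position. Position 2 is \<open>c\<close>, where this is part of \<open>good\<close>.\<close>

definition T0 :: "'a set \<Rightarrow> bool" where "T0 Y \<longleftrightarrow> (\<exists>b\<in>bd C. b \<noteq> l0 \<and> adj b p0 \<and> tch Y b)"
definition T1 :: "'a set \<Rightarrow> bool" where "T1 Y \<longleftrightarrow> (\<exists>a\<in>nbC l0. a \<noteq> c \<and> tch Y a)"
definition T3 :: "'a set \<Rightarrow> bool" where "T3 Y \<longleftrightarrow> (\<exists>a\<in>nbC l1. a \<noteq> c \<and> tch Y a)"
definition T4 :: "'a set \<Rightarrow> bool" where "T4 Y \<longleftrightarrow> (\<exists>b\<in>bd C. b \<noteq> l1 \<and> adj b p1 \<and> tch Y b)"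

lemma swap: "double_leaf adj s V M C t c l1 l0 p1 p0"
  by unfold_locales (use cC l0 l1 p01 in auto)

lemma sc: "s c = (\<not> t)" using side[OF l0(2)] sbd[OF l0(1)] by simp
lemma sNc: "d \<in> nbC c \<Longrightarrow> s d = t" using side[OF nbCD(2)] sc by simp
lemma sA0: "a \<in> nbC l0 \<Longrightarrow> s a = (\<not> t)" using side[OF nbCD(2)] sbd[OF l0(1)] by simp
lemma sA1: "a \<in> nbC l1 \<Longrightarrow> s a = (\<not> t)" using side[OF nbCD(2)] sbd[OF l1(1)] by simp
lemma sp0: "s p0 = (\<not> t)" using side[OF l0(3)] sbd[OF l0(1)] by simp
lemma cA: "c \<in> nbC l0" "c \<in> nbC l1" using cC l0 l1 by (auto simp: nbC_def)

lemma cRn: "c \<notin> R" using cA by (simp add: R_def)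
lemma RC: "R \<subseteq> C" by (auto simp: R_def)
lemma RD: "x \<in> R \<Longrightarrow> x \<in> C \<and> \<not> adj x l0 \<and> \<not> adj x l1 \<and> \<not> adj x c \<and> x \<noteq> c"
  using cRn by (auto simp: R_def nbC_def)

lemma nbr_Nc:
  assumes d: "d \<in> nbC c" and y: "adj d y" "y \<noteq> c" shows "y \<in> R"
proof -
  have sy: "s y = (\<not> t)" using side[OF y(1)] sNc[OF d] by simp
  have yC: "y \<in> C"
    using bdI[of y C d] sym[OF y(1)] nbCD(1)[OF d] sbd[of y] sy by blast
  have dl: "d \<noteq> l0" "d \<noteq> l1" using leaf(2)[OF l0(1)] leaf(2)[OF l1(1)] nbCD(1)[OF d] by blast+
  have "\<not> adj y l0" using c4[OF y(1) nbCD(2)[OF d], of l0] y(2) dl(1) l0(2) sym by blast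
  moreover have "\<not> adj y l1" using c4[OF y(1) nbCD(2)[OF d], of l1] y(2) dl(2) l1(2) sym by blast
  moreover have "\<not> adj y c" using side[of y c] sy sc by auto
  ultimately show ?thesis using yC by (simp add: R_def nbC_def)
qed

lemma goodD:
  assumes "good Y"
  shows "Y \<subseteq> R" "conn Y" "\<exists>d\<in>nbC c. \<exists>x\<in>Y. adj x d" "z \<in> bd Y \<Longrightarrow> z \<notin> R"
proof -
  obtain d x where d: "d \<in> nbC c" "x \<in> R" "adj x d" and Y: "Y = cmp R x" using assms unfolding good_def by blast
  show "Y \<subseteq> R" "conn Y" unfolding Y using cmp_sub cmp_conn[OF d(2)] by blast+
  show "\<exists>d\<in>nbC c. \<exists>x\<in>Y. adj x d" unfolding Y using d cmp_self[OF d(2)] by blast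
  show "z \<in> bd Y \<Longrightarrow> z \<notin> R" unfolding Y by (rule bd_cmp)
qed

lemma good_bd:
  assumes g: "good Y" and z: "z \<in> bd Y"
  shows "z \<in> nbC c \<or> (z \<in> nbC l0 \<and> z \<noteq> c) \<or> (z \<in> nbC l1 \<and> z \<noteq> c) \<or> (z \<in> bd C \<and> z \<noteq> l0 \<and> z \<noteq> l1)"
proof -
  obtain y where y: "y \<in> Y" "adj z y" "adj y z" using z by (rule bdE)
  have yR: "y \<in> R" using goodD(1)[OF g] y by blast
  have "z \<noteq> c" "z \<noteq> l0" "z \<noteq> l1" using y(3) RD[OF yR] by blast+
  moreover have "z \<notin> R" using goodD(4)[OF g z] .
  moreover have "z \<in> C \<or> z \<in> bd C" using bd_subset[of Y z] goodD(1)[OF g] RC z by blast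
  ultimately show ?thesis by (auto simp: R_def)
qed

lemma good_bd_tch: "z \<in> bd Y \<Longrightarrow> tch Y z"
  by (erule bdE) (auto simp: tch_def)

text \<open>Otherwise \<open>b\<close> has a third parent, and \<open>theta_parents\<close> applies
  with the route from \<open>c\<close> through a neighbour \<open>d\<close> of \<open>c\<close>,
  through \<open>Y\<close> and \<open>b\<close>.\<close>

lemma third:
  assumes g: "good Y" and b: "b \<in> bd C" "tch Y b"
  shows "adj b p0 \<or> adj b p1"
proof (rule ccontr)
  assume n: "\<not> (adj b p0 \<or> adj b p1)"
  obtain p2 where p2: "p2 \<in> M" "adj b p2" using parent[OF b(1)] by blast
  obtain d x where d: "d \<in> nbC c" "x \<in> Y" "adj x d" using goodD(3)[OF g] by blast
  note gR = goodD(1)[OF g]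
  let ?Q = "insert b (insert d Y)"
  have c1: "conn (insert d Y)" using conn_insert[OF goodD(2)[OF g]] d by (auto simp: tch_def)
  have cQ: "conn ?Q" using conn_insert[OF c1, of b] b(2) by (auto simp: tch_def)
  have QC: "q \<in> C \<or> q = b" if "q \<in> ?Q" for q using that gR RC nbCD(1)[OF d(1)] by blast
  have an: "anti {l} ?Q" if l: "l \<in> bd C" "l \<noteq> b" "\<And>y. y \<in> R \<Longrightarrow> \<not> adj y l" for l
  proof -
    have "l \<notin> ?Q" using leaf(2)[OF l(1)] QC l(2) by blast
    moreover have "\<not> adj l b" using side[of l b] sbd l(1) b(1) by auto
    moreover have "\<not> adj l d" using side[of l d] sbd[OF l(1)] sNc[OF d(1)] by auto
    moreover have "\<not> adj l y" if "y \<in> Y" for y using l(3) gR that sym by blast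
    ultimately show ?thesis by (auto simp: anti_def)
  qed
  show False
  proof (rule theta_parents[OF cC l0 l1 cQ])
    show "tch ?Q c" using nbCD(2)[OF d(1)] by (auto simp: tch_def)
    show "c \<notin> ?Q" using leaf(2)[OF b(1)] cC gR cRn nbCD(2)[OF d(1)] irrefl by blast
    show "tch ?Q p2" using p2 by (auto simp: tch_def)
    show "?Q \<inter> M = {}" using QC leaf(1)[OF b(1)] inner(1) by blast
    show "x = p2" if "q \<in> ?Q" "x \<in> M" "adj q x" for q x
      using QC[OF that(1)] inner(2)[of q x] that parent_unique[OF b(1) that(2) p2(1) _ p2(2)] by blast
    show "anti {l0} ?Q" using an[OF l0(1)] n l0(3) RD by blast
    show "anti {l1} ?Q" using an[OF l1(1)] n l1(3) RD by blast
    show "par M C p2" using p2 b(1) by (auto simp: par_def)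
  qed (use p01 p2 n in auto)
qed

text \<open>An odd theta with ends \<open>p0\<close> and \<open>l1\<close>: one route is
  \<open>l0, c\<close>, one passes through \<open>M\<close> by way of \<open>p1\<close>, and one
  goes from \<open>b\<close> through \<open>Y\<close> to \<open>a\<close>.\<close>

lemma not_T0_T3:
  assumes g: "good Y" and T: "T0 Y" "T3 Y"
  shows False
proof -
  obtain b where b: "b \<in> bd C" "b \<noteq> l0" "adj b p0" "tch Y b" using T(1) by (auto simp: T0_def)
  obtain a where a: "a \<in> nbC l1" "a \<noteq> c" "tch Y a" using T(2) by (auto simp: T3_def)
  note gR = goodD(1)[OF g]
  obtain S where S: "S \<subseteq> M - {p0}" "conn S" "p1 \<in> S" "tch S p0"
    using conn_minus[OF connM l1(4) l0(4)] p01 by blast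
  let ?Q = "insert b (insert a Y)"
  have c1: "conn (insert a Y)" using conn_insert[OF goodD(2)[OF g] a(3)] .
  have cQ: "conn ?Q" using conn_insert[OF c1, of b] b(4) by (auto simp: tch_def)
  have c0: "conn {l0, c}" using conn_insert[of "{c}" l0] l0(2) by (simp add: tch_def)
  have QC: "q \<in> C \<or> q = b" if "q \<in> ?Q" for q using that gR RC nbCD(1)[OF a(1)] by blast
  have a1: "anti {l0, c} S"
  proof -
    have "\<not> adj l0 q" if "q \<in> S" for q using parent_unique[OF l0(1) _ l0(4) _ l0(3), of q] S(1) that by blast
    moreover have "\<not> adj c q" if "q \<in> S" for q using inner(2)[OF cC] S(1) that by blast
    ultimately show ?thesis using S(1) leaf(1)[OF l0(1)] inner(1)[OF cC] by (auto simp: anti_def)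
  qed
  have a2: "anti {l0, c} ?Q"
  proof -
    have "l0 \<notin> ?Q" using QC leaf(2)[OF l0(1)] b(2) by blast
    moreover have "c \<notin> ?Q" using a(2) leaf(2)[OF b(1)] cC gR cRn by blast
    moreover have "\<not> adj l0 b" using side[of l0 b] sbd l0(1) b(1) by auto
    moreover have "\<not> adj c b" using sibling_unique[OF l0(2) _ l0(3) b(3) cC l0(4)] b(2) by blast
    moreover have "\<not> adj l0 a"
      using c4[of l0 a c l1] nbCD(3)[OF a(1)] sym[OF l0(2)] sym[OF l1(2)] a(2) parent_unique[OF l0(1) l0(4) l1(4) l0(3)] l1(3) p01 by blast
    moreover have "\<not> adj c a" using side[of c a] sA1[OF a(1)] sc by auto
    moreover have "\<not> adj l0 y" "\<not> adj c y" if "y \<in> Y" for y using RD gR that sym by blast+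
    ultimately show ?thesis by (auto simp: anti_def)
  qed
  have a3: "anti S ?Q"
  proof (rule anti_sym)
    have "\<not> adj q x" if "q \<in> ?Q" "x \<in> S" for q x
      using QC[OF that(1)] inner(2)[of q x] parent_unique[OF b(1) _ l0(4) _ b(3), of x] S(1) that(2) by blast
    moreover have "q \<notin> S" if "q \<in> ?Q" for q
      using QC[OF that(1)] inner(1)[of q] leaf(1)[OF b(1)] S(1) by blast
    ultimately show "anti ?Q S" unfolding anti_def by blast
  qed
  have n: "\<not> adj p0 l1" using parent_unique[OF l1(1) l0(4) l1(4) _ l1(3)] p01 sym by blast
  have "s p0 = s l1"
  proof (rule theta[OF c0 S(2) cQ a1 a2 a3])
    show "tch {l0, c} p0" "tch {l0, c} l1" using l0 l1 by (auto simp: tch_def)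
    show "tch S p0" "tch S l1" using S l1(3) sym by (auto simp: tch_def)
    show "tch ?Q p0" "tch ?Q l1" using b a nbCD(2)[OF a(1)] by (auto simp: tch_def)
    show "p0 \<notin> {l0, c} \<union> S \<union> ?Q" using l0(4) leaf(1)[OF l0(1)] inner(1)[OF cC] S(1) QC inner(1) leaf(1)[OF b(1)] by blast
    have "l1 \<noteq> b" using n b(3) sym by blast
    moreover have "l1 \<noteq> l0" using n l0(3) sym by blast
    ultimately show "l1 \<notin> {l0, c} \<union> S \<union> ?Q"
      using leaf[OF l1(1)] cC S(1) QC by blast
  qed (rule n)
  then show False using sp0 sbd[OF l1(1)] by simp
qed

lemma good_start:
  assumes g: "good Y" obtains d x where "d \<in> nbC c" "x \<in> Y" "adj x d" "s x = (\<not> t)" "x \<in> R"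
proof -
  obtain d x where d: "d \<in> nbC c" "x \<in> Y" "adj x d" using goodD(3)[OF g] by blast
  moreover have "s x = (\<not> t)" using side[OF d(3)] sNc[OF d(1)] by simp
  moreover have "x \<in> R" using goodD(1)[OF g] d(2) by blast
  ultimately show ?thesis by (rule that)
qed

text \<open>Otherwise the star at \<open>l0\<close> with \<open>p0\<close> and \<open>nbC l0\<close>
  gives a smaller state inside \<open>Y\<close>: once the neighbours of \<open>nbC l0\<close> are
  removed from \<open>Y\<close>, the boundary consists of such neighbours, among them those of
  \<open>c\<close>, and of leaves of \<open>p0\<close>.\<close>

lemma T34:
  assumes g: "good Y" shows "T3 Y \<or> T4 Y"
proof (rule ccontr)
  assume n: "\<not> (T3 Y \<or> T4 Y)"
  note gR = goodD(1)[OF g]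
  obtain d x where d: "d \<in> nbC c" "x \<in> Y" "adj x d" "s x = (\<not> t)" "x \<in> R" by (rule good_start[OF g])
  let ?Z = "{y\<in>Y. \<forall>a\<in>nbC l0. \<not> adj a y}"
  let ?C = "cmp ?Z x" let ?B = "insert p0 (nbC l0)"
  have xZ: "x \<in> ?Z" using d side[of _ x] sA0 by blast
  have CZ: "?C \<subseteq> ?Z" by (rule cmp_sub)
  have CC: "y \<in> C" if "y \<in> ?C" for y using that CZ gR RC by blast
  have "state (insert l0 ?B) ?C (s l0)"
  proof (rule star_state)
    show "adj b l0" if "b \<in> ?B" for b using that sym[OF l0(3)] nbCD(2) by blast
    show "conn ?C" by (rule cmp_conn[OF xZ])
    show "deg3 v" if "v \<in> ?C" for v using degC CC that by blast
    have "l0 \<notin> ?C" using CC leaf(2)[OF l0(1)] by blast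
    moreover have "\<not> adj l0 y" if "y \<in> ?C" for y using that CZ gR RD sym by blast
    moreover have "\<not> adj p0 y" "p0 \<noteq> y" if "y \<in> ?C" for y using CC[OF that] inner[of y] l0(4) by blast+
    moreover have "\<not> adj a y" "a \<noteq> y" if "y \<in> ?C" "a \<in> nbC l0" for y a
      using that CZ gR RD nbCD(2) by blast+
    ultimately show "anti (insert l0 ?B) ?C" unfolding anti_def by blast
    show "\<exists>b\<in>?B. adj l b" if l: "l \<in> bd ?C" for l
    proof -
      obtain y where y: "y \<in> ?C" "adj l y" "adj y l" using l by (rule bdE)
      have lZ: "l \<notin> ?Z" using bd_cmp[OF l] .
      have yZ: "y \<in> ?Z" using y CZ by blast
      show ?thesis
      proof (cases "l \<in> Y")
        case True then show ?thesis using lZ sym by blast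
      next
        case False
        then have lY: "l \<in> bd Y" using bdI[of l Y y] y yZ by blast
        have tl: "tch Y l" by (rule good_bd_tch[OF lY])
        from good_bd[OF g lY] consider "l \<in> nbC c" | "l \<in> nbC l0" | "l \<in> nbC l1" "l \<noteq> c" | "l \<in> bd C" "l \<noteq> l1" by blast
        then show ?thesis
        proof cases
          case 1 then show ?thesis using cA(1) nbCD(2) by blast
        next
          case 2 then show ?thesis using yZ y(2) by blast
        next
          case 3 then show ?thesis using n tl unfolding T3_def by blast
        next
          case 4 then show ?thesis using third[OF g 4(1) tl] n tl unfolding T4_def by blast
        qed
      qed
    qed
  qed
  then show False by (rule smaller[OF _ _ cC]) (use CC CZ gR cRn in blast)+
qed

text \<open>Otherwise \<open>third\<close> shows that \<open>Y\<close> touches no leaf at all. Then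
  the star at \<open>c\<close> with all its neighbours gives a smaller state; boundary vertices next
  to \<open>l0\<close> or \<open>l1\<close> have these as parents.\<close>

lemma T04:
  assumes g: "good Y" shows "T0 Y \<or> T4 Y"
proof (rule ccontr)
  assume n: "\<not> (T0 Y \<or> T4 Y)"
  note gR = goodD(1)[OF g]
  obtain d x where d: "d \<in> nbC c" "x \<in> Y" "adj x d" "s x = (\<not> t)" "x \<in> R" by (rule good_start[OF g])
  have noleaf: "\<not> tch Y b" if "b \<in> bd C" for b
  proof
    assume tb: "tch Y b"
    have "b \<noteq> l0" "b \<noteq> l1" using tb gR RD unfolding tch_def by blast+
    then show False using third[OF g that tb] n tb that unfolding T0_def T4_def by blast
  qed
  have xC: "x \<in> C" using RC d by blast
  \<comment> \<open>The vertex \<open>x\<close> is itself adjacent to \<open>nbC c\<close> and hence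
    removed, so the new component starts one step further, on the side of
    \<open>nbC c\<close>.\<close>
  obtain w where w: "adj x w" "w \<noteq> d" using deg3_avoid[OF degC[OF xC]] by blast
  have sw: "s w = t" using side[OF w(1)] d(4) by simp
  have wC: "w \<in> C" using noleaf[of w] bdI[of w C x] xC w(1) sym d(2) unfolding tch_def by blast
  have "w \<notin> nbC l0" "w \<notin> nbC l1" using sA0 sA1 sw by blast+
  moreover have "w \<notin> nbC c"
    using c4[of x w d c] w d(3) nbCD(3)[of w c] nbCD(3)[OF d(1)] RD[OF d(5)] by blast
  ultimately have wR: "w \<in> R" using wC by (simp add: R_def)
  have wY: "w \<in> Y" using goodD(4)[OF g] bdI[of w Y x] d(2) w(1) sym wR by blast
  let ?Z = "{y\<in>Y. \<forall>a\<in>nbC c. \<not> adj a y}"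
  let ?C = "cmp ?Z w" let ?B = "{y. adj c y}"
  have wZ: "w \<in> ?Z" using wY sw side[of _ w] sNc by blast
  have CZ: "?C \<subseteq> ?Z" by (rule cmp_sub)
  have CC: "y \<in> C" if "y \<in> ?C" for y using that CZ gR RC by blast
  have "state (insert c ?B) ?C (s c)"
  proof (rule star_state)
    show "adj b c" if "b \<in> ?B" for b using that sym by blast
    show "conn ?C" by (rule cmp_conn[OF wZ])
    show "deg3 v" if "v \<in> ?C" for v using degC CC that by blast
    have 1: "c \<notin> ?C" using CZ gR cRn by blast
    have 2: "\<not> adj c y" if "y \<in> ?C" for y using that CZ gR RD sym by blast
    have 3: "\<not> adj a y" if "y \<in> ?C" "adj c a" for y a
    proof
      assume ay: "adj a y"
      have yZ: "y \<in> ?Z" using that CZ by blast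
      show False
      proof (cases "a \<in> C")
        case True then show ?thesis using yZ ay nbCI[of a c] sym[OF that(2)] by blast
      next
        case False
        then have "a \<in> bd C" using bdI[of a C y] ay CC that by blast
        then show ?thesis using noleaf[of a] ay yZ sym unfolding tch_def by blast
      qed
    qed
    show "anti (insert c ?B) ?C" using 1 2 3 unfolding anti_def by blast
    show "\<exists>b\<in>?B. adj l b" if l: "l \<in> bd ?C" for l
    proof -
      obtain y where y: "y \<in> ?C" "adj l y" "adj y l" using l by (rule bdE)
      have lZ: "l \<notin> ?Z" using bd_cmp[OF l] .
      have yZ: "y \<in> ?Z" using y CZ by blast
      show ?thesis
      proof (cases "l \<in> Y")
        case True then show ?thesis using lZ sym nbCD(3) by blast
      next
        case False
        then have lY: "l \<in> bd Y" using bdI[of l Y y] y yZ by blast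
        have tl: "tch Y l" by (rule good_bd_tch[OF lY])
        from good_bd[OF g lY] consider "l \<in> nbC c" | "l \<in> nbC l0" | "l \<in> nbC l1" | "l \<in> bd C" by blast
        then show ?thesis
        proof cases
          case 1 then show ?thesis using yZ y(2) by blast
        next
          case 2 then show ?thesis using nbCD(2) l0(2) by blast
        next
          case 3 then show ?thesis using nbCD(2) l1(2) by blast
        next
          case 4 then show ?thesis using noleaf tl by blast
        qed
      qed
    qed
  qed
  then show False by (rule smaller[OF _ _ cC]) (use CC CZ gR cRn in blast)+
qed

end

context double_leaf
begin

interpretation sw: double_leaf adj s V M C t c l1 l0 p1 p0 by (rule swap)

lemma sw_simps: "sw.R = R" "sw.good = good" "sw.T0 = T4" "sw.T3 = T1" "sw.T4 = T0" "sw.T1 = T3"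
proof -
  show R: "sw.R = R" by (auto simp: sw.R_def R_def)
  show "sw.good = good" by (auto simp: sw.good_def good_def R fun_eq_iff)
  show "sw.T0 = T4" "sw.T3 = T1" "sw.T4 = T0" "sw.T1 = T3"
    by (simp_all add: sw.T0_def sw.T1_def sw.T3_def sw.T4_def T0_def T1_def T3_def T4_def fun_eq_iff)
qed

text \<open>By reversing the path, \<open>T1\<close> and \<open>T4\<close> exclude each other as
  \<open>T0\<close> and \<open>T3\<close> do, and one of \<open>T0\<close>, \<open>T1\<close> holds.
  If \<open>T3\<close> held, \<open>T0\<close> would fail, which forces \<open>T4\<close> as well as
  \<open>T1\<close>, a contradiction; the other claim is the mirror image.\<close>

lemma good_T: assumes g: "good Y" shows "\<not> T1 Y" "\<not> T3 Y"
  using not_T0_T3[OF g] sw.not_T0_T3[of Y] T34[OF g] sw.T34[of Y] T04[OF g] g unfolding sw_simps by blast+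

text \<open>Since good components do not leave through \<open>l0\<close> or \<open>l1\<close>, the
  set \<open>?D\<close> of \<open>c\<close>, its neighbours and all good components has only leaves
  of \<open>C\<close> on its boundary. Minimality makes it equal to \<open>C\<close>, and the three
  claims are read off.\<close>

lemma dbl_final:
  shows "nbC l0 = {c}" "nbC l1 = {c}" "z \<in> bd C \<Longrightarrow> adj z p0 \<or> adj z p1"
proof -
  let ?D = "({c} \<union> nbC c) \<union> \<Union>{Y. good Y}"
  have "conn ({c} \<union> nbC c)" using conn_adjoin[of "{c}" "nbC c"] nbCD(2) by simp
  then have cD: "conn ?D"
  proof (rule conn_Union)
    fix Y assume "Y \<in> {Y. good Y}"
    then have g: "good Y" by simp
    then obtain d x where "d \<in> nbC c" "x \<in> Y" "adj x d" using goodD(3) by blast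
    then show "conn Y \<and> (({c} \<union> nbC c) \<inter> Y \<noteq> {} \<or> (\<exists>a\<in>{c} \<union> nbC c. \<exists>b\<in>Y. adj a b))"
      using goodD(2)[OF g] sym by blast
  qed
  have DC: "?D \<subseteq> C" using cC nbCD(1) goodD(1) RC by blast
  have "bd ?D \<subseteq> bd C"
  proof
    fix z assume z: "z \<in> bd ?D"
    obtain y where y: "z \<notin> ?D" "y \<in> ?D" "adj z y" "adj y z" using z by (rule bdE)
    have "z \<notin> C"
    proof
      assume zC: "z \<in> C"
      consider "y = c" | "y \<in> nbC c" | Y where "good Y" "y \<in> Y" using y(2) by blast
      then show False
      proof cases
        case 1 then show ?thesis using y nbCI[OF zC] by blast
      next
        case 2
        have "z \<in> R" using nbr_Nc[OF 2 y(4)] y(1) by blast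
        then have "good (cmp R z)" "z \<in> cmp R z" using 2 y(3) cmp_self unfolding good_def by blast+
        then show ?thesis using y(1) by blast
      next
        case 3
        have zY: "z \<in> bd Y" using bdI[of z Y y] 3 y by blast
        have "z \<notin> bd C" using leaf(2) zC by blast
        then show ?thesis
          using good_bd[OF 3(1) zY] good_bd_tch[OF zY] good_T[OF 3(1)] y(1) unfolding T1_def T3_def by blast
      qed
    qed
    then show "z \<in> bd C" using bdI[of z C y] y DC by blast
  qed
  then have "state M ?D t" using state_sub[OF st DC cD] by blast
  then have D: "x \<in> ?D" if "x \<in> C" for x using smaller[OF _ DC that] by blast
  have A: "x = c" if "x \<in> C" "x \<notin> R" "s x = (\<not> t)" for x
    using D[OF that(1)] that(2,3) sNc[of x] goodD(1) by blast
  show "nbC l0 = {c}" using A[OF nbCD(1)] sA0 cA(1) unfolding R_def by blast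
  show "nbC l1 = {c}" using A[OF nbCD(1)] sA1 cA(2) unfolding R_def by blast
  show "adj z p0 \<or> adj z p1" if z: "z \<in> bd C"
  proof -
    obtain y where y: "y \<in> C" "adj z y" "adj y z" using z by (rule bdE)
    consider "y = c" | "y \<in> nbC c" | Y where "good Y" "y \<in> Y" using D[OF y(1)] by blast
    then show ?thesis
    proof cases
      case 1
      have "l0 \<noteq> l1" using parent_unique[OF l0(1) l0(4) l1(4) l0(3)] l1(3) p01 by blast
      then show ?thesis using two_leaves[OF cC l0(1) l1(1) z l0(2) l1(2)] y(3) 1 l0(3) l1(3) by blast
    next
      case 2 then show ?thesis using sNc[OF 2] side[OF y(3)] sbd[OF z] by blast
    next
      case 3 then show ?thesis using third[OF 3(1) z] y(3) unfolding tch_def by blast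
    qed
  qed
qed

end

context minimal_state
begin

lemma dbl_intro:
  assumes "c \<in> C" "l0 \<in> bd C" "l1 \<in> bd C" "adj c l0" "adj c l1" "l0 \<noteq> l1"
    "p0 \<in> M" "p1 \<in> M" "adj l0 p0" "adj l1 p1"
  shows "double_leaf adj s V M C t c l0 l1 p0 p1"
proof unfold_locales
  show "p0 \<noteq> p1" using sibling_unique[of c l0 l1 p0] assms by blast
qed (use assms in auto)

text \<open>By \<open>dbl_final\<close> all leaves hang at \<open>p0\<close> or \<open>p1\<close>,
  so the leaves can be absorbed as two stars and the vertices next to them become the new
  leaves.\<close>

lemma no_double:
  assumes c: "c \<in> C" and l: "l0 \<in> bd C" "l1 \<in> bd C" "adj c l0" "adj c l1"
  shows "l0 = l1"
proof (rule ccontr)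
  assume ne: "l0 \<noteq> l1"
  obtain p0 p1 where p: "p0 \<in> M" "p1 \<in> M" "adj l0 p0" "adj l1 p1" using parent l by metis
  interpret double_leaf adj s V M C t c l0 l1 p0 p1 by (rule dbl_intro[OF c l ne p])
  have one: "nbC b = {x}" if x: "x \<in> C" "b \<in> bd C" "b' \<in> bd C" "adj x b" "adj x b'" "b \<noteq> b'" for x b b'
  proof -
    obtain q q' where q: "q \<in> M" "q' \<in> M" "adj b q" "adj b' q'" using parent x by metis
    interpret d: double_leaf adj s V M C t x b b' q q' by (rule dbl_intro[OF x q])
    show ?thesis by (rule d.dbl_final(1))
  qed
  let ?X0 = "{b\<in>bd C. adj b p0}"
  \<comment> \<open>A vertex with two leaf neighbours would receive two parents, so its leaf at
    \<open>p1\<close> is left out and only the one at \<open>p0\<close> is kept. By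
    \<open>one\<close> the leaf left out has no other neighbour in \<open>C\<close>, so no other
    vertex loses its parent.\<close>
  let ?X1 = "{b\<in>bd C. adj b p1 \<and> (\<forall>x b'. x \<in> C \<and> b' \<in> bd C \<and> adj x b \<and> adj x b' \<longrightarrow> b' = b)}"
  let ?Z = "{y\<in>C. \<forall>b\<in>bd C. \<not> adj y b}"
  \<comment> \<open>A third neighbour of \<open>c\<close> is not a leaf, by
    \<open>two_leaves\<close>, and lies on the side of the leaves. So it has no leaf neighbour and
    can start the new component.\<close>
  obtain d where d: "adj c d" "d \<noteq> l0" "d \<noteq> l1" using deg3_avoid[OF degC[OF c]] by blast
  have "d \<in> C" using two_leaves[OF c l(1,2) _ l(3,4) d(1)] ne d bdI[of d C c] c sym by blast
  moreover have "s d = t" using side[OF d(1)] sc by simp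
  ultimately have dZ: "d \<in> ?Z" using side sbd by blast
  let ?C = "cmp ?Z d"
  have CZ: "?C \<subseteq> ?Z" by (rule cmp_sub)
  have bdin: "z \<in> C \<and> (\<exists>b\<in>bd C. adj z b)" if z: "z \<in> bd ?C" for z
  proof -
    obtain y where y: "y \<in> ?C" "adj z y" "adj y z" using z by (rule bdE)
    have "z \<in> C" using y CZ bdI[of z C y] by blast
    then show ?thesis using bd_cmp[OF z] by blast
  qed
  have "state (M \<union> ?X0 \<union> ?X1) ?C (s p0)"
  proof (rule two_star_state[OF connM p(1,2) p01])
    show "s p0 = s p0" ..
    show "s p1 = s p0" using side[OF p(3)] side[OF p(4)] sbd l(1,2) by auto
    show "x \<notin> M \<and> adj x p0 \<and> (\<forall>q\<in>M. adj x q \<longrightarrow> q = p0)" if "x \<in> ?X0" for x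
      using that leaf(1)[of x] parent_unique[of x _ p0] p(1) by blast
    show "x \<notin> M \<and> adj x p1 \<and> (\<forall>q\<in>M. adj x q \<longrightarrow> q = p1)" if "x \<in> ?X1" for x
      using that leaf(1)[of x] parent_unique[of x _ p1] p(2) by blast
    show "conn ?C" by (rule cmp_conn[OF dZ])
    show "deg3 v" if "v \<in> ?C" for v using degC that CZ by blast
    have 1: "anti M ?C" by (rule anti_subset[OF antiMC order_refl]) (use CZ in blast)
    have 2: "anti X ?C" if "X \<subseteq> bd C" for X
    proof -
      have "x \<notin> ?C" "\<not> adj x y" if "x \<in> X" "y \<in> ?C" for x y
        using \<open>X \<subseteq> bd C\<close> that CZ leaf(2)[of x] sym by blast+
      then show ?thesis unfolding anti_def by blast
    qed
    show "anti (M \<union> ?X0 \<union> ?X1) ?C"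
      unfolding anti_Un using 1 2[of ?X0] 2[of ?X1] by blast
    show "(\<exists>b\<in>?X0 \<union> ?X1. adj z b) \<and> (\<forall>q\<in>M. \<not> adj z q)" if z: "z \<in> bd ?C" for z
    proof
      obtain b where b: "z \<in> C" "b \<in> bd C" "adj z b" using bdin[OF z] by blast
      show "\<forall>q\<in>M. \<not> adj z q" using inner(2)[OF b(1)] by blast
      show "\<exists>b\<in>?X0 \<union> ?X1. adj z b"
      proof (cases "b \<in> ?X0 \<union> ?X1")
        case True then show ?thesis using b by blast
      next
        case False
        then have b1: "adj b p1" using dbl_final(3)[OF b(2)] b(2) by blast
        then obtain x b' where x: "x \<in> C" "b' \<in> bd C" "adj x b" "adj x b'" "b \<noteq> b'" using False b(2) by blast
        have "z = x" using one[OF x(1) b(2) x(2-5)] nbCI[OF b(1,3)] by blast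
        moreover have "\<not> adj b' p1" using sibling_unique[OF x(3,4) b1 _ x(1) p(2)] x(5) by blast
        ultimately show ?thesis using dbl_final(3)[OF x(2)] x by blast
      qed
    qed
    show "b = b'" if z: "z \<in> bd ?C" and b: "b \<in> ?X0 \<union> ?X1" "b' \<in> ?X0 \<union> ?X1" "adj z b" "adj z b'" for z b b'
    proof -
      have zC: "z \<in> C" using bdin[OF z] by blast
      show ?thesis
      proof (cases "b \<in> ?X1 \<or> b' \<in> ?X1")
        case True then show ?thesis using b zC by blast
      next
        case False
        then have "adj b p0" "adj b' p0" using b by blast+
        then show ?thesis using sibling_unique[OF b(3,4) _ _ zC p(1)] by blast
      qed
    qed
  qed
  then show False by (rule smaller[OF _ _ c]) (use CZ l in blast)+
qed

end

section \<open>Jumps over a path\<close>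

text \<open>The hole consists of the induced path \<open>w 0, \<dots>, w K\<close>, the set \<open>S1\<close> leading from \<open>w K\<close> to the tripod
  centre \<open>w (Suc K)\<close>, and a way back from there to \<open>w 0\<close>: \<open>S0\<close> contains \<open>w 0\<close> but not the centre, \<open>R\<close> the
  centre but not \<open>w 0\<close>. The centre may be adjacent to \<open>w 0\<close> and has the parity of an odd index, although
  \<open>Suc K\<close> is even. \<open>U\<close> is the part of the graph off the hole.\<close>

locale frame = theta_free +
  fixes w :: "nat \<Rightarrow> 'a" and K :: nat and S0 S1 R U :: "'a set" and t :: bool
  assumes Kodd: "odd K"
    and path: "i \<le> K \<Longrightarrow> j \<le> K \<Longrightarrow> adj (w i) (w j) \<longleftrightarrow> i = Suc j \<or> j = Suc i"
    and winj: "i \<le> K \<Longrightarrow> j \<le> K \<Longrightarrow> w i = w j \<Longrightarrow> i = j"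
    and sw: "i \<le> K \<Longrightarrow> s (w i) = (odd i = t)"
    and sN: "s (w (Suc K)) = t"
    and S1: "conn S1" "tch S1 (w K)" "tch S1 (w (Suc K))" "i \<le> Suc K \<Longrightarrow> w i \<notin> S1" "i < K \<Longrightarrow> \<not> tch S1 (w i)"
    and S0: "conn S0" "w 0 \<in> S0" "tch S0 (w (Suc K))" "1 \<le> i \<Longrightarrow> i \<le> Suc K \<Longrightarrow> w i \<notin> S0"
      "2 \<le> i \<Longrightarrow> i \<le> K \<Longrightarrow> \<not> tch S0 (w i)" "anti S0 S1"
    and R: "conn R" "w (Suc K) \<in> R" "tch R (w 0)" "i \<le> K \<Longrightarrow> w i \<notin> R" "1 \<le> i \<Longrightarrow> i \<le> K \<Longrightarrow> \<not> tch R (w i)"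
      "R \<inter> S1 = {}"
    and U: "i \<le> Suc K \<Longrightarrow> w i \<notin> U" "U \<inter> R = {}" "U \<inter> S0 = {}" "anti U S1"
      "x \<in> U \<Longrightarrow> y \<in> R \<Longrightarrow> adj x y \<Longrightarrow> y = w (Suc K)" "x \<in> U \<Longrightarrow> y \<in> S0 \<Longrightarrow> adj x y \<Longrightarrow> y = w 0"
    and one: "x \<in> U \<Longrightarrow> i \<le> Suc K \<Longrightarrow> j \<le> Suc K \<Longrightarrow> adj x (w i) \<Longrightarrow> adj x (w j) \<Longrightarrow> i = j"
begin

text \<open>The contacts of \<open>T\<close>. A subset of \<open>U\<close> meets the arcs closing
  the hole only at \<open>w 0\<close> and at the centre, so its contacts describe its adjacency to
  the whole hole.\<close>

definition ct :: "'a set \<Rightarrow> nat set" where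
  "ct T = {i. i \<le> Suc K \<and> tch T (w i)}"

lemma ct_Un: "ct (A \<union> B) = ct A \<union> ct B"
  by (auto simp: ct_def tch_def)

lemma ct_insert: "ct (insert x B) = ct {x} \<union> ct B"
  by (auto simp: ct_def tch_def)

lemma ct_sing: "x \<in> U \<Longrightarrow> i \<le> Suc K \<Longrightarrow> adj x (w i) \<Longrightarrow> ct {x} = {i}"
  using one by (auto simp: ct_def tch_def)

lemma ctD: "i \<in> ct T \<Longrightarrow> tch T (w i)" "i \<in> ct T \<Longrightarrow> i \<le> Suc K"
  by (auto simp: ct_def)

lemma ctI: "x \<in> T \<Longrightarrow> adj x (w i) \<Longrightarrow> i \<le> Suc K \<Longrightarrow> i \<in> ct T"
  by (auto simp: ct_def tch_def)

lemma wN: "i \<le> K \<Longrightarrow> w i \<noteq> w (Suc K)"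
  using R(2,4) by metis

lemma anti_Uw: assumes "T \<subseteq> U" "I \<subseteq> {..Suc K}" "ct T \<inter> I = {}" shows "anti T (w ` I)"
proof -
  have "w i \<notin> T" if "i \<in> I" for i using U(1)[of i] that assms(1,2) by auto
  moreover have "\<not> adj x (w i)" if "x \<in> T" "i \<in> I" for x i
  proof
    assume "adj x (w i)"
    then have "i \<in> ct T" using that assms(2) by (auto simp: ct_def tch_def)
    then show False using assms(3) that by blast
  qed
  ultimately show ?thesis unfolding anti_def by blast
qed

lemma anti_ww: assumes "I \<subseteq> {..K}" "J \<subseteq> {..K}" "\<And>i j. i \<in> I \<Longrightarrow> j \<in> J \<Longrightarrow> Suc i < j \<or> Suc j < i"
  shows "anti (w ` I) (w ` J)"
proof -
  have "w i \<noteq> w j" if "i \<in> I" "j \<in> J" for i j using winj[of i j] assms(1,2) assms(3)[OF that] that by auto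
  moreover have "\<not> adj (w i) (w j)" if "i \<in> I" "j \<in> J" for i j using path[of i j] assms(1,2) assms(3)[OF that] that by auto
  ultimately show ?thesis unfolding anti_def by blast
qed

lemma w_notin: "j \<le> K \<Longrightarrow> I \<subseteq> {..K} \<Longrightarrow> j \<notin> I \<Longrightarrow> w j \<notin> w ` I"
  using winj[of j] by blast

lemma wN_notin: "I \<subseteq> {..K} \<Longrightarrow> w (Suc K) \<notin> w ` I"
  using wN by force

lemma anti_setw: assumes "\<And>i. i \<in> I \<Longrightarrow> w i \<notin> A \<and> \<not> tch A (w i)" shows "anti A (w ` I)"
  using assms unfolding anti_def tch_def by blast

lemma anti_S1w: "I \<subseteq> {..<K} \<Longrightarrow> anti S1 (w ` I)"
  by (rule anti_setw) (use S1(4,5) in \<open>auto simp: subset_iff less_imp_le less_SucI\<close>)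

lemma anti_Rw: "I \<subseteq> {1..K} \<Longrightarrow> anti R (w ` I)"
  by (rule anti_setw) (use R(4,5) in \<open>auto simp: subset_iff\<close>)

lemma anti_S0w: "I \<subseteq> {2..K} \<Longrightarrow> anti S0 (w ` I)"
  by (rule anti_setw) (use S0(4,5) in \<open>auto simp: subset_iff\<close>)

lemma anti_US1: "T \<subseteq> U \<Longrightarrow> anti T S1"
  using U(4) by (rule anti_subset) auto

lemma anti_UR: assumes "T \<subseteq> U" "Suc K \<notin> ct T" shows "anti T R"
proof -
  have "\<not> adj x y" if "x \<in> T" "y \<in> R" for x y
    using U(5)[of x y] that assms unfolding ct_def tch_def by blast
  then show ?thesis using assms(1) U(2) unfolding anti_def by blast
qed

lemma anti_US0: assumes "T \<subseteq> U" "0 \<notin> ct T" shows "anti T S0"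
proof -
  have "\<not> adj x y" if "x \<in> T" "y \<in> S0" for x y
    using U(6)[of x y] that assms unfolding ct_def tch_def by blast
  then show ?thesis using assms(1) U(3) unfolding anti_def by blast
qed

lemma conn_seg: "a \<le> b \<Longrightarrow> b \<le> K \<Longrightarrow> conn (w ` {a..b})"
proof (induction b rule: dec_induct)
  case base then show ?case by simp
next
  case (step b)
  have "tch (w ` {a..b}) (w (Suc b))" using path[of b "Suc b"] step by (auto simp: tch_def)
  then have "conn (insert (w (Suc b)) (w ` {a..b}))" using conn_insert step by simp
  moreover have "{a..Suc b} = insert (Suc b) {a..b}" using step by auto
  ultimately show ?case by simp
qed

lemma conn_segs: assumes "I = {a..b}" "a \<le> b" "b \<le> K" shows "conn (w ` I)"
  using conn_seg assms by simp

lemma tchI: "y \<in> S \<Longrightarrow> adj y x \<Longrightarrow> tch S x" by (auto simp: tch_def)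

lemma tch_mono: "tch S x \<Longrightarrow> S \<subseteq> S' \<Longrightarrow> tch S' x" by (auto simp: tch_def)

lemma conn_Un_tch: "conn S \<Longrightarrow> conn T \<Longrightarrow> tch S x \<Longrightarrow> x \<in> T \<Longrightarrow> conn (S \<union> T)"
  by (rule conn_Un) (auto simp: tch_def)

lemma tch_path: "i \<le> K \<Longrightarrow> j \<le> K \<Longrightarrow> i \<in> I \<Longrightarrow> i = Suc j \<or> j = Suc i \<Longrightarrow> tch (w ` I) (w j)"
  using path[of i j] by (auto simp: tch_def)

section \<open>Arcs of the hole, and thetas formed with one or two jumps\<close>

definition lo :: "nat \<Rightarrow> 'a set" where "lo a = R \<union> w ` {..<a}"

text \<open>The arc from \<open>w b\<close> forward over the centre and on to the vertex before
  \<open>w a\<close>; \<open>lo a\<close> is its part from the centre onwards, and all that remains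
  if \<open>w b\<close> is the centre.\<close>

definition up :: "nat \<Rightarrow> nat \<Rightarrow> 'a set" where
  "up b a = (if b \<le> K then w ` {b..K} \<union> S1 else {}) \<union> lo a"

lemma lo_conn: "a \<le> K \<Longrightarrow> conn (lo a)"
proof (cases a)
  case 0 then show ?thesis using R(1) by (simp add: lo_def)
next
  case (Suc a')
  assume "a \<le> K"
  then have "conn (w ` {..<a})" using Suc by (intro conn_segs[of _ 0 a']) auto
  moreover have "w 0 \<in> w ` {..<a}" using Suc by blast
  ultimately show ?thesis unfolding lo_def using conn_Un_tch[OF R(1) _ R(3)] by blast
qed

lemma lo_tch: "a \<le> K \<Longrightarrow> tch (lo a) (w a)"
proof (cases a)
  case 0 then show ?thesis using R(3) by (simp add: lo_def)
next
  case (Suc a')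
  assume "a \<le> K"
  then have "tch (w ` {..<a}) (w a)" using Suc by (intro tch_path[of a']) auto
  then show ?thesis by (rule tch_mono) (auto simp: lo_def)
qed

lemma up_conn: assumes "a \<le> K" "b \<le> Suc K" shows "conn (up b a)"
proof (cases "b \<le> K")
  case True
  have "conn (S1 \<union> w ` {b..K})" using conn_Un_tch[OF S1(1) conn_seg[of b K] S1(2)] True by auto
  moreover have "tch (S1 \<union> w ` {b..K}) (w (Suc K))" using S1(3) by (rule tch_mono) blast
  moreover have "w (Suc K) \<in> lo a" using R(2) by (simp add: lo_def)
  ultimately have "conn ((S1 \<union> w ` {b..K}) \<union> lo a)" using conn_Un_tch[OF _ lo_conn[OF assms(1)]] by blast
  then show ?thesis using True by (simp add: up_def Un_commute)
qed (simp add: up_def lo_conn[OF assms(1)])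

lemma up_tch: "a \<le> K \<Longrightarrow> tch (up b a) (w a)"
  using lo_tch tch_mono[of "lo a" "w a" "up b a"] by (auto simp: up_def)

lemma up_mem: "b \<le> Suc K \<Longrightarrow> w b \<in> up b a"
  using R(2) by (cases "b \<le> K") (auto simp: up_def lo_def le_Suc_eq)

lemma anti_Uup:
  assumes "T \<subseteq> U" "ct T \<inter> {b..Suc K} = {}" "ct T \<inter> {..<a} = {}" "a \<le> K" "b \<le> Suc K"
  shows "anti T (up b a)"
proof -
  have "anti T (w ` {b..K})" by (rule anti_Uw[OF assms(1)]) (use assms(2) in auto)
  moreover have "anti T (w ` {..<a})" by (rule anti_Uw[OF assms(1) _ assms(3)]) (use assms(4) in auto)
  moreover have "anti T R" by (rule anti_UR[OF assms(1)]) (use assms(2,5) in \<open>auto simp: disjoint_iff\<close>)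
  ultimately show ?thesis using anti_US1[OF assms(1)] by (auto simp: up_def lo_def anti_Un2)
qed

lemma anti_wup:
  assumes "\<And>i. i \<in> I \<Longrightarrow> a < i \<and> Suc i < b" "b \<le> Suc K"
  shows "anti (w ` I) (up b a)"
proof -
  have I: "I \<subseteq> {1..K}" "I \<subseteq> {..<K}" using assms by fastforce+
  have IK: "I \<subseteq> {..K}" using I(1) by auto
  have "anti (w ` I) R" using anti_sym[OF anti_Rw[OF I(1)]] .
  moreover have "anti (w ` I) S1" using anti_sym[OF anti_S1w[OF I(2)]] .
  moreover have "anti (w ` I) (w ` {..<a})"
    if "I \<noteq> {}"
  proof (rule anti_ww[OF IK])
    from that obtain i where "i \<in> I" by blast
    then have "a \<le> K" using assms(1)[of i] assms(2) by linarith
    then show "{..<a} \<subseteq> {..K}" by auto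
  qed (use assms(1) in fastforce)
  moreover have "anti (w ` I) (w ` {b..K})" by (rule anti_ww[OF IK]) (use assms(1) in fastforce)+
  moreover have "anti (w ` I) X" if "I = {}" for X using that by (simp add: anti_def)
  ultimately show ?thesis by (cases "I = {}") (auto simp: up_def lo_def anti_Un2)
qed

text \<open>The jump and the two arcs of the hole form a theta with ends \<open>w a\<close> and
  \<open>w b\<close>. For \<open>b \<le> K\<close> the outer arc uses \<open>R\<close>, which
  contains the centre but not \<open>w 0\<close>; if \<open>w b\<close> is the centre, it uses
  \<open>S0\<close>, which does not contain the centre. The pair of \<open>w 0\<close> and the
  centre is excluded since these two may be adjacent.\<close>

lemma jump_side:
  assumes T: "conn T" "T \<subseteq> U" "ct T = {a, b}" and ab: "a + 2 \<le> b" "\<not> (a = 0 \<and> b = Suc K)"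
  shows "s (w a) = s (w b)"
proof -
  have bN: "b \<le> Suc K" using ctD(2)[of b T] T(3) by blast
  have tT: "tch T (w a)" "tch T (w b)" using ctD(1) T(3) by blast+
  have aK: "a \<le> K" using ab bN by linarith
  have nT: "w i \<notin> T" if "i \<le> Suc K" for i using U(1)[OF that] T(2) by blast
  have a_in: "tch (w ` {a<..<b}) (w a)" using ab bN by (intro tch_path[of "Suc a"]) auto
  show ?thesis
  proof (cases "b \<le> K")
    case True
    have cI: "conn (w ` {a<..<b})" by (rule conn_segs[of _ "Suc a" "b - 1"]) (use ab True in auto)
    let ?O = "w ` {b<..K} \<union> S1 \<union> lo a"
    have cO1: "conn (w ` {b<..K} \<union> S1)"
    proof (cases "b < K")
      case True
      have "conn (S1 \<union> w ` {b<..K})"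
        by (rule conn_Un_tch[OF S1(1) conn_segs[of _ "Suc b" K] S1(2)]) (use True in auto)
      then show ?thesis by (simp add: Un_commute)
    qed (use S1(1) in simp)
    have "tch (w ` {b<..K} \<union> S1) (w (Suc K))" using S1(3) by (rule tch_mono) blast
    then have cO: "conn ?O" using conn_Un_tch[OF cO1 lo_conn[OF aK]] R(2) by (auto simp: lo_def)
    have aTI: "anti T (w ` {a<..<b})" by (rule anti_Uw[OF T(2)]) (use T(3) True in auto)
    have aTO: "anti T ?O"
    proof -
      have "anti T (w ` {b<..K})" by (rule anti_Uw[OF T(2)]) (use T(3) ab in auto)
      moreover have "anti T (w ` {..<a})" by (rule anti_Uw[OF T(2)]) (use T(3) aK ab in auto)
      moreover have "anti T R" using anti_UR[OF T(2)] T(3) ab True by auto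
      ultimately show ?thesis using anti_US1[OF T(2)] by (auto simp: lo_def anti_Un2)
    qed
    have aIO: "anti (w ` {a<..<b}) ?O"
    proof -
      have "anti (w ` {a<..<b}) (w ` {b<..K})" by (rule anti_ww) (use True in auto)
      moreover have "anti (w ` {a<..<b}) (w ` {..<a})" by (rule anti_ww) (use True aK in auto)
      moreover have "anti (w ` {a<..<b}) R" by (rule anti_sym[OF anti_Rw]) (use True in auto)
      moreover have "anti (w ` {a<..<b}) S1" by (rule anti_sym[OF anti_S1w]) (use True in auto)
      ultimately show ?thesis by (auto simp: lo_def anti_Un2)
    qed
    have wn: "w j \<notin> ?O" if "a \<le> j" "j \<le> b" for j
    proof -
      have "w j \<notin> w ` {b<..K}" "w j \<notin> w ` {..<a}" by (rule w_notin; use that True aK in auto)+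
      moreover have "w j \<notin> S1" "w j \<notin> R" using S1(4)[of j] R(4)[of j] that True by auto
      ultimately show ?thesis by (simp add: lo_def)
    qed
    have wi: "w a \<notin> w ` {a<..<b}" "w b \<notin> w ` {a<..<b}" 
      by (rule w_notin; use True aK in auto)+
    have tb: "tch ?O (w b)"
    proof (cases "b < K")
      case True
      then have "tch (w ` {b<..K}) (w b)" by (intro tch_path[of "Suc b"]) auto
      then show ?thesis by (rule tch_mono) blast
    next
      case False
      then have "tch S1 (w b)" using S1(2) \<open>b \<le> K\<close> by simp
      then show ?thesis by (rule tch_mono) blast
    qed
    have ta: "tch ?O (w a)" using lo_tch[OF aK] by (rule tch_mono) blast
    have b_in: "tch (w ` {a<..<b}) (w b)" using ab True by (intro tch_path[of "b - 1"]) auto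
    have na: "\<not> adj (w a) (w b)" using path[of a b] ab True by auto
    show ?thesis
      by (rule theta[OF T(1) cI cO aTI aTO aIO tT(1) a_in ta tT(2) b_in tb _ _ na])
        (use nT wn wi True aK ab in auto)
  next
    case False
    then have bN: "b = Suc K" using bN by simp
    have a1: "1 \<le> a" using ab(2) bN by simp
    have aK': "a < K" using ab bN by simp
    let ?I = "w ` {a<..K} \<union> S1" and ?O = "w ` {..<a} \<union> S0"
    have "conn (S1 \<union> w ` {a<..K})"
      by (rule conn_Un_tch[OF S1(1) conn_segs[of _ "Suc a" K] S1(2)]) (use aK' in auto)
    then have cI: "conn ?I" by (simp add: Un_commute)
    have "conn (w ` {..<a})" by (rule conn_segs[of _ 0 "a - 1"]) (use a1 aK in auto)
    moreover have "w 0 \<in> w ` {..<a} \<inter> S0" using S0(2) a1 by auto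
    ultimately have cO: "conn ?O" using S0(1) by (intro conn_Un) blast+
    have aTI: "anti T ?I"
    proof -
      have "anti T (w ` {a<..K})" by (rule anti_Uw[OF T(2)]) (use T(3) bN in auto)
      then show ?thesis using anti_US1[OF T(2)] by (auto simp: anti_Un2)
    qed
    have aTO: "anti T ?O"
    proof -
      have "anti T (w ` {..<a})" by (rule anti_Uw[OF T(2)]) (use T(3) aK bN in auto)
      moreover have "anti T S0" using anti_US0[OF T(2)] T(3) a1 bN by auto
      ultimately show ?thesis by (auto simp: anti_Un2)
    qed
    have aIO: "anti ?I ?O"
    proof -
      have "anti (w ` {a<..K}) (w ` {..<a})" by (rule anti_ww) (use aK in auto)
      moreover have "anti (w ` {a<..K}) S0" by (rule anti_sym[OF anti_S0w]) (use a1 in auto)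
      moreover have "anti S1 (w ` {..<a})" by (rule anti_S1w) (use aK' in auto)
      moreover have "anti S1 S0" by (rule anti_sym[OF S0(6)])
      ultimately show ?thesis by (auto simp: anti_Un anti_Un2)
    qed
    have "tch (w ` {a<..K}) (w a)" by (rule tch_path[of "Suc a"]) (use aK' in auto)
    then have ai: "tch ?I (w a)" by (rule tch_mono) blast
    have bi: "tch ?I (w b)" using S1(3) bN by (auto intro: tch_mono)
    have "tch (w ` {..<a}) (w a)" by (rule tch_path[of "a - 1"]) (use a1 aK in auto)
    then have ao: "tch ?O (w a)" by (rule tch_mono) blast
    have bo: "tch ?O (w b)" using S0(3) bN by (auto intro: tch_mono)
    have na: "\<not> adj (w a) (w b)" using R(5)[of a] a1 aK R(2) bN sym unfolding tch_def by blast
    have wa: "w a \<notin> ?I \<union> ?O" 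
    proof -
      have "w a \<notin> w ` {a<..K}" "w a \<notin> w ` {..<a}" by (rule w_notin; use aK in auto)+
      then show ?thesis using S1(4)[of a] S0(4)[of a] a1 aK by simp
    qed
    have wb: "w b \<notin> ?I \<union> ?O" 
    proof -
      have "w b \<notin> w ` {a<..K}" "w b \<notin> w ` {..<a}" unfolding bN by (rule wN_notin; use aK in auto)+
      then show ?thesis using S1(4)[of b] S0(4)[of b] bN by simp
    qed
    show ?thesis
      by (rule theta[OF T(1) cI cO aTI aTO aIO tT(1) ai ao tT(2) bi bo _ _ na])
        (use nT wa wb aK bN in auto)
  qed
qed

text \<open>The theta has ends \<open>x\<close> and \<open>w c\<close>: the routes are
  \<open>Z\<close>, the path from \<open>w f\<close> down, and \<open>X\<close> continued round the
  hole. It puts \<open>x\<close> on the side of \<open>w c\<close>, but \<open>insert x Z\<close> is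
  a jump that puts there \<open>w f\<close>, a neighbour of \<open>x\<close>.\<close>

lemma no_tripod:
  assumes Z: "conn Z" "Z \<subseteq> U" "ct Z = {c}" "tch Z x" and x: "x \<in> U" "adj x (w f)"
    and X: "conn X" "X \<subseteq> U" "ct X \<subseteq> {f<..}" "b \<in> ct X" "tch X x" and a: "anti Z X"
    and i: "c + 2 \<le> f" "f + 2 \<le> b"
  shows False
proof -
  have bN: "b \<le> Suc K" using ctD(2)[OF X(4)] .
  have fK: "f \<le> K" "c \<le> K" using i bN by linarith+
  have ctx: "ct {x} = {f}" using ct_sing[OF x(1) _ x(2)] fK by simp
  have cY: "conn (X \<union> up b c)"
    using conn_Un_tch[OF X(1) up_conn[OF fK(2) bN] ctD(1)[OF X(4)] up_mem[OF bN]] .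
  have cI: "conn (w ` {c<..f})" by (rule conn_segs[of _ "Suc c" f]) (use i fK in auto)
  have aZI: "anti Z (w ` {c<..f})" by (rule anti_Uw[OF Z(2)]) (use Z(3) fK in auto)
  have aZY: "anti Z (X \<union> up b c)"
    using a anti_Uup[OF Z(2), of b c] Z(3) i fK bN by (auto simp: anti_Un2)
  have aIX: "anti X (w ` {c<..f})" by (rule anti_Uw[OF X(2)]) (use X(3) fK in auto)
  have aIU: "anti (w ` {c<..f}) (up b c)" by (rule anti_wup[OF _ bN]) (use i in auto)
  have aIY: "anti (w ` {c<..f}) (X \<union> up b c)" using anti_sym[OF aIX] aIU by (simp add: anti_Un2)
  have tx: "tch (w ` {c<..f}) x" using tchI[of "w f" _ x] sym[OF x(2)] i by simp
  have tX: "tch (X \<union> up b c) x" using X(5) by (rule tch_mono) blast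
  have tZ: "tch Z (w c)" using ctD(1)[of c Z] Z(3) by blast
  have tI: "tch (w ` {c<..f}) (w c)" by (rule tch_path[of "Suc c"]) (use i fK in auto)
  have tY: "tch (X \<union> up b c) (w c)" using up_tch[OF fK(2)] by (rule tch_mono) blast
  have na: "\<not> adj x (w c)" using one[OF x(1), of c f] x(2) i fK by auto
  have xZ: "x \<notin> Z" using ctI[of x Z f] x(2) Z(3) i(1) fK(1) by auto
  have xX: "x \<notin> X" using ctI[of x X f] x(2) X(3) fK(1) by auto
  have wU: "w j \<notin> U" if "j \<le> Suc K" for j using U(1) that .
  have xu: "x \<notin> up b c" "x \<notin> w ` {c<..f}"
    using anti_Uup[of "{x}" "Suc K" 0] x(1) wU fK U(2,4) unfolding up_def lo_def anti_def
    by (auto dest!: wU simp: disjoint_iff)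
  have wc: "w c \<notin> up b c"
  proof -
    have "w c \<notin> w ` {b..K}" "w c \<notin> w ` {..<c}" by (rule w_notin; use i fK in auto)+
    then show ?thesis using S1(4)[of c] R(4)[of c] fK by (simp add: up_def lo_def)
  qed
  have wI: "w c \<notin> w ` {c<..f}" by (rule w_notin) (use fK in auto)
  have "s x = s (w c)"
    by (rule theta[OF Z(1) cI cY aZI aZY aIY Z(4) tx tX tZ tI tY _ _ na])
      (use xZ xX xu wc wI wU[of c] fK Z(2) X(2) in auto)
  moreover have "s (w c) = s (w f)"
  proof (rule jump_side[of "insert x Z"])
    show "conn (insert x Z)" by (rule conn_insert[OF Z(1,4)])
    show "insert x Z \<subseteq> U" using x(1) Z(2) by blast
    show "ct (insert x Z) = {c, f}" using ctx Z(3) ct_insert[of x Z] by auto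
  qed (use i fK in auto)
  ultimately show False using side[OF x(2)] by simp
qed

text \<open>A theta with ends at the two lower indices: the segment between them, \<open>Z\<close>
  with the segment from \<open>w b'\<close> down towards \<open>w a\<close>, and \<open>X\<close>
  continued from \<open>w b\<close> round the hole.\<close>

lemma cross_low:
  assumes Z: "conn Z" "Z \<subseteq> U" "ct Z = {a', b'}"
    and X: "conn X" "X \<subseteq> U" "ct X \<subseteq> insert a {b'<..}" "a \<in> ct X" "b \<in> ct X" and an: "anti Z X"
    and i: "a' + 2 \<le> a" "a < b'" "b' + 2 \<le> b"
  shows "s (w a') = s (w a)"
proof -
  have bN: "b \<le> Suc K" using ctD(2)[OF X(5)] .
  have K: "b' \<le> K" "a \<le> K" "a' \<le> K" using i bN by linarith+
  let ?I = "w ` {a'<..<a}" and ?J = "w ` {a<..b'}" and ?Y = "X \<union> up b a'"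
  have cY: "conn ?Y"
    using conn_Un_tch[OF X(1) up_conn[OF K(3) bN] ctD(1)[OF X(5)] up_mem[OF bN]] .
  have cI: "conn ?I" by (rule conn_segs[of _ "Suc a'" "a - 1"]) (use i K in auto)
  have cJ: "conn ?J" by (rule conn_segs[of _ "Suc a" b']) (use i K in auto)
  have tZ: "tch Z (w a')" "tch Z (w b')" using ctD(1) Z(3) by blast+
  have cZJ: "conn (Z \<union> ?J)" using conn_Un_tch[OF Z(1) cJ tZ(2)] i by auto
  have aIZ: "anti Z ?I" by (rule anti_Uw[OF Z(2)]) (use Z(3) i K in auto)
  have aIJ: "anti ?I ?J" by (rule anti_ww) (use i K in auto)
  have aIX: "anti X ?I" by (rule anti_Uw[OF X(2)]) (use X(3) i K in auto)
  have aJX: "anti X ?J" by (rule anti_Uw[OF X(2)]) (use X(3) i K in auto)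
  have aIu: "anti ?I (up b a')" by (rule anti_wup[OF _ bN]) (use i in auto)
  have aJu: "anti ?J (up b a')" by (rule anti_wup[OF _ bN]) (use i in auto)
  have aZu: "anti Z (up b a')" by (rule anti_Uup[OF Z(2) _ _ K(3) bN]) (use Z(3) i in auto)
  have a1: "anti ?I (Z \<union> ?J)" using anti_sym[OF aIZ] aIJ by (simp add: anti_Un2)
  have a2: "anti ?I ?Y" using anti_sym[OF aIX] aIu by (simp add: anti_Un2)
  have a3: "anti (Z \<union> ?J) ?Y" using an anti_sym[OF aJX] aJu aZu by (simp add: anti_Un anti_Un2)
  have t1: "tch ?I (w a')" by (rule tch_path[of "Suc a'"]) (use i K in auto)
  have t2: "tch (Z \<union> ?J) (w a')" using tZ(1) by (rule tch_mono) blast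
  have t3: "tch ?Y (w a')" using up_tch[OF K(3)] by (rule tch_mono) blast
  have t4: "tch ?I (w a)" by (rule tch_path[of "a - 1"]) (use i K in auto)
  have "tch ?J (w a)" by (rule tch_path[of "Suc a"]) (use i K in auto)
  then have t5: "tch (Z \<union> ?J) (w a)" by (rule tch_mono) blast
  have t6: "tch ?Y (w a)" using ctD(1)[OF X(4)] by (rule tch_mono) blast
  have na: "\<not> adj (w a') (w a)" using path[of a' a] i K by auto
  have nm: "w j \<notin> ?I \<union> (Z \<union> ?J) \<union> ?Y" if "j = a' \<or> j = a" for j
  proof -
    have j: "j \<le> K" using that K by auto
    have "w j \<notin> ?I" "w j \<notin> ?J" "w j \<notin> w ` {b..K}" "w j \<notin> w ` {..<a'}"
      by (rule w_notin[OF j]; use that i K in auto)+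
    then show ?thesis using U(1)[of j] S1(4)[of j] R(4)[of j] j Z(2) X(2) by (auto simp: up_def lo_def simp del: image_iff)
  qed
  show ?thesis by (rule theta[OF cI cZJ cY a1 a2 a3 t1 t2 t3 t4 t5 t6 nm nm na]) simp_all
qed

text \<open>A theta with ends at the two middle indices: the segment between them, \<open>Z\<close>
  with the segment from \<open>w a'\<close> up, and \<open>X\<close> with the part of the hole from
  \<open>w b'\<close> to \<open>w b\<close>.\<close>

lemma cross_mid:
  assumes Z: "conn Z" "Z \<subseteq> U" "ct Z = {a', b'}"
    and X: "conn X" "X \<subseteq> U" "ct X = {a, b}" and an: "anti Z X"
    and i: "a' < a" "a + 2 \<le> b'" "b' < b" "\<not> (a' = 0 \<and> b = Suc K)"
  shows "s (w a) = s (w b')"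
proof -
  have bN: "b \<le> Suc K" using ctD(2)[of b X] X(3) by blast
  have K: "b' \<le> K" "a \<le> K" "a' \<le> K" using i bN by linarith+
  let ?I = "w ` {a<..<b'}" and ?J = "w ` {a'..<a}"
  have cI: "conn ?I" by (rule conn_segs[of _ "Suc a" "b' - 1"]) (use i K in auto)
  have cJ: "conn ?J" by (rule conn_segs[of _ "a'" "a - 1"]) (use i K in auto)
  have tZ: "tch Z (w a')" "tch Z (w b')" using ctD(1) Z(3) by blast+
  have tX: "tch X (w a)" "tch X (w b)" using ctD(1) X(3) by blast+
  have cZJ: "conn (Z \<union> ?J)" using conn_Un_tch[OF Z(1) cJ tZ(1)] i by auto
  \<comment> \<open>\<open>D\<close> leads from \<open>w b'\<close> to \<open>w b\<close>. If
    \<open>w b\<close> is the centre, it runs through \<open>S1\<close> and contains the centre;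
    then \<open>a' \<ge> 1\<close> keeps \<open>w 0\<close>, which may be adjacent to the centre,
    out of \<open>?J\<close>.\<close>
  have "\<exists>D. conn D \<and> w b \<in> D \<and> tch D (w b') \<and> anti ?I D \<and> anti ?J D \<and> anti Z D \<and> w a \<notin> D \<and> w b' \<notin> D"
  proof (cases "b \<le> K")
    case True
    let ?D = "w ` {b'<..b}"
    have "conn ?D" by (rule conn_segs[of _ "Suc b'" b]) (use i True in auto)
    moreover have "w b \<in> ?D" using i by simp
    moreover have "tch ?D (w b')" by (rule tch_path[of "Suc b'"]) (use i True in auto)
    moreover have "anti ?I ?D" "anti ?J ?D" by (rule anti_ww; use i K True in auto)+
    moreover have "anti Z ?D" by (rule anti_Uw[OF Z(2)]) (use Z(3) i True in auto)
    moreover have "w a \<notin> ?D" "w b' \<notin> ?D" by (rule w_notin; use i K True in auto)+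
    ultimately show ?thesis by blast
  next
    case False
    then have bb: "b = Suc K" using bN by simp
    have a1: "1 \<le> a'" using i(4) bb by simp
    let ?E = "w ` {b'<..K}" let ?D = "insert (w (Suc K)) (S1 \<union> ?E)"
    have cE: "conn (S1 \<union> ?E)"
    proof (cases "b' < K")
      case True
      show ?thesis by (rule conn_Un_tch[OF S1(1) conn_segs[of _ "Suc b'" K] S1(2)]) (use True in auto)
    qed (use S1(1) in simp)
    have "tch (S1 \<union> ?E) (w (Suc K))" using S1(3) by (rule tch_mono) blast
    then have "conn ?D" by (rule conn_insert[OF cE])
    moreover have "w b \<in> ?D" using bb by simp
    moreover have "tch ?D (w b')"
    proof (cases "b' < K")
      case True
      then have "tch ?E (w b')" by (intro tch_path[of "Suc b'"]) auto
      then show ?thesis by (rule tch_mono) blast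
    next
      case False
      then have "tch S1 (w b')" using S1(2) K(1) by simp
      then show ?thesis by (rule tch_mono) blast
    qed
    moreover have wD: "anti (w ` I) ?D" if I: "\<And>i. i \<in> I \<Longrightarrow> 1 \<le> i \<and> Suc i \<le> b'" for I
    proof -
      have "anti (w ` I) R" by (rule anti_sym[OF anti_Rw]) (use I K in fastforce)
      then have "anti (w ` I) {w (Suc K)}" by (rule anti_subset) (use R(2) in auto)
      moreover have "anti (w ` I) S1" by (rule anti_sym[OF anti_S1w]) (use I K in fastforce)
      moreover have "anti (w ` I) ?E" by (rule anti_ww) (use I K in fastforce)+
      ultimately show ?thesis using anti_Un2[of _ "{w (Suc K)}" "S1 \<union> ?E"] by (simp add: anti_Un2)
    qed
    have "anti ?I ?D" "anti ?J ?D" by (rule wD; use a1 i in auto)+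
    moreover have "anti Z ?D"
    proof -
      have "anti Z (w ` insert (Suc K) {b'<..K})" by (rule anti_Uw[OF Z(2)]) (use Z(3) i K in auto)
      then show ?thesis using anti_US1[OF Z(2)] anti_Un2[of Z S1 "insert (w (Suc K)) ?E"] by simp
    qed
    moreover have "w j \<notin> ?D" if "j \<le> b'" for j
    proof -
      have "w j \<notin> ?E" by (rule w_notin) (use that K in auto)
      then show ?thesis using wN[of j] S1(4)[of j] that K by auto
    qed
    then have "w a \<notin> ?D" "w b' \<notin> ?D" using i by auto
    ultimately show ?thesis by blast
  qed
  then obtain D where D: "conn D" "w b \<in> D" "tch D (w b')" "anti ?I D" "anti ?J D" "anti Z D" "w a \<notin> D" "w b' \<notin> D"
    by blast
  have cXD: "conn (X \<union> D)" using conn_Un_tch[OF X(1) D(1) tX(2) D(2)] .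
  have aIZ: "anti Z ?I" by (rule anti_Uw[OF Z(2)]) (use Z(3) i K in auto)
  have aIJ: "anti ?I ?J" by (rule anti_ww) (use i K in auto)
  have aIX: "anti X ?I" by (rule anti_Uw[OF X(2)]) (use X(3) i K in auto)
  have aJX: "anti X ?J" by (rule anti_Uw[OF X(2)]) (use X(3) i K in auto)
  have a1: "anti ?I (Z \<union> ?J)" using anti_sym[OF aIZ] aIJ by (simp add: anti_Un2)
  have a2: "anti ?I (X \<union> D)" using anti_sym[OF aIX] D(4) by (simp add: anti_Un2)
  have a3: "anti (Z \<union> ?J) (X \<union> D)" using an anti_sym[OF aJX] D(5,6) by (simp add: anti_Un anti_Un2)
  have t1: "tch ?I (w a)" by (rule tch_path[of "Suc a"]) (use i K in auto)
  have "tch ?J (w a)" by (rule tch_path[of "a - 1"]) (use i K in auto)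
  then have t2: "tch (Z \<union> ?J) (w a)" by (rule tch_mono) blast
  have t3: "tch (X \<union> D) (w a)" using tX(1) by (rule tch_mono) blast
  have t4: "tch ?I (w b')" by (rule tch_path[of "b' - 1"]) (use i K in auto)
  have t5: "tch (Z \<union> ?J) (w b')" using tZ(2) by (rule tch_mono) blast
  have t6: "tch (X \<union> D) (w b')" using D(3) by (rule tch_mono) blast
  have na: "\<not> adj (w a) (w b')" using path[of a b'] i K by auto
  have nm: "w j \<notin> ?I \<union> (Z \<union> ?J) \<union> (X \<union> D)" if "j = a \<or> j = b'" for j
  proof -
    have j: "j \<le> K" using that K by auto
    have "w j \<notin> ?I" "w j \<notin> ?J" by (rule w_notin[OF j]; use that i K in auto)+
    moreover have "w j \<notin> U" using U(1)[of j] j by simp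
    moreover have "w j \<notin> D" using D(7,8) that by blast
    ultimately show ?thesis using Z(2) X(2) by blast
  qed
  show ?thesis by (rule theta[OF cI cZJ cXD a1 a2 a3 t1 t2 t3 t4 t5 t6 nm nm na]) simp_all
qed

end

section \<open>Jumps as walks, and pairs of overlapping jumps\<close>

context bipartite_relation
begin

lemma walk_app1: "walk (us @ z # vs) \<Longrightarrow> walk (us @ [z])"
  by (auto simp: walk_def successively_append_iff)

lemma walk_app2: "walk (us @ z # vs) \<Longrightarrow> walk (z # vs)"
  by (auto simp: walk_def successively_append_iff)

lemma walk_app3: "walk (us @ vs) \<Longrightarrow> us \<noteq> [] \<Longrightarrow> walk us"
  by (auto simp: walk_def successively_append_iff)

lemma walk_tl_adj: "walk xs \<Longrightarrow> tl xs \<noteq> [] \<Longrightarrow> adj (hd xs) (hd (tl xs))"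
  by (cases xs) (auto simp: walk_def successively_Cons)

lemma walk_snoc_adj: "walk (us @ z # vs) \<Longrightarrow> us \<noteq> [] \<Longrightarrow> adj (last us) z"
  by (auto simp: walk_def successively_append_iff)

lemma walk_avoid:
  "walk ys \<Longrightarrow> hd ys \<notin> Q \<Longrightarrow> (\<And>y. y \<in> set ys \<Longrightarrow> \<not> tch Q y) \<Longrightarrow> set ys \<inter> Q = {}"
proof (induction ys)
  case Nil then show ?case by simp
next
  case (Cons y ys)
  show ?case
  proof (cases "ys = []")
    case True then show ?thesis using Cons.prems by simp
  next
    case False
    then have w: "walk ys" "adj y (hd ys)" using Cons.prems(1) by (auto simp: walk_def successively_Cons)
    have "hd ys \<notin> Q" using w(2) Cons.prems(3)[of y] sym by (auto simp: tch_def)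
    then have "set ys \<inter> Q = {}" using Cons.IH[OF w(1)] Cons.prems(3) by simp
    then show ?thesis using Cons.prems(2) by simp
  qed
qed

end

context frame
begin

text \<open>An oriented jump: its first vertex sees only \<open>w a\<close>, its last only
  \<open>w b\<close>, and the inner ones see no \<open>w i\<close>. As no vertex of \<open>U\<close>
  has two contacts, it has at least two vertices.\<close>

definition jl :: "nat \<Rightarrow> nat \<Rightarrow> 'a list \<Rightarrow> bool" where
  "jl a b xs \<longleftrightarrow> walk xs \<and> set xs \<subseteq> U \<and> distinct xs \<and> a \<le> Suc K \<and> b \<le> Suc K \<and> a \<noteq> b \<and>
     (\<forall>x\<in>set xs. \<forall>i\<le>Suc K. adj x (w i) \<longleftrightarrow> (x = hd xs \<and> i = a) \<or> (x = last xs \<and> i = b))"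

definition jump :: "nat \<Rightarrow> nat \<Rightarrow> bool" where "jump a b \<longleftrightarrow> (\<exists>xs. jl a b xs)"

lemma jlD:
  assumes "jl a b xs"
  shows "walk xs" "set xs \<subseteq> U" "distinct xs" "a \<le> Suc K" "b \<le> Suc K" "a \<noteq> b" "xs \<noteq> []"
    "adj (hd xs) (w a)" "adj (last xs) (w b)" "hd xs \<noteq> last xs" "conn (set xs)" "tl xs \<noteq> []"
proof -
  note d = assms[unfolded jl_def]
  show h: "walk xs" "set xs \<subseteq> U" "distinct xs" "a \<le> Suc K" "b \<le> Suc K" "a \<noteq> b" using d by simp_all
  show ne: "xs \<noteq> []" using h(1) by (simp add: walk_def)
  then have m: "hd xs \<in> set xs" "last xs \<in> set xs" by simp_all
  show a: "adj (hd xs) (w a)" "adj (last xs) (w b)" using d m by blast+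
  show hl: "hd xs \<noteq> last xs" using a one[of "hd xs" a b] m h(2,4-6) by auto
  show "conn (set xs)" using conn_walk[OF h(1)] .
  show "tl xs \<noteq> []" using hl ne by (cases xs) auto
qed

lemma jl_ct:
  assumes "jl a b xs" "Y \<subseteq> set xs"
  shows "ct Y = (if hd xs \<in> Y then {a} else {}) \<union> (if last xs \<in> Y then {b} else {})"
proof -
  have h: "\<And>x i. x \<in> Y \<Longrightarrow> i \<le> Suc K \<Longrightarrow> adj x (w i) \<longleftrightarrow> (x = hd xs \<and> i = a) \<or> (x = last xs \<and> i = b)"
    using assms unfolding jl_def by blast
  have "a \<le> Suc K" "b \<le> Suc K" using jlD[OF assms(1)] by simp_all
  then show ?thesis using h unfolding ct_def tch_def by auto
qed

lemma jl_ct_all: "jl a b xs \<Longrightarrow> ct (set xs) = {a, b}"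
  using jl_ct[of a b xs "set xs"] jlD(7)[of a b xs] by auto

text \<open>Take a shortest walk in \<open>T\<close> from a contact in \<open>A\<close> to a contact
  in \<open>B\<close>: by minimality, none of its inner vertices has a contact.\<close>

lemma reach:
  assumes T: "conn T" "T \<subseteq> U" "ct T \<subseteq> A \<union> B" "A \<inter> ct T \<noteq> {}" "B \<inter> ct T \<noteq> {}" "A \<inter> B = {}"
  shows "\<exists>a\<in>A \<inter> ct T. \<exists>b\<in>B \<inter> ct T. \<exists>xs. jl a b xs \<and> set xs \<subseteq> T"
proof -
  define P where "P xs \<longleftrightarrow> walk xs \<and> set xs \<subseteq> T \<and> (\<exists>a\<in>A. a \<le> Suc K \<and> adj (hd xs) (w a)) \<and> (\<exists>b\<in>B. b \<le> Suc K \<and> adj (last xs) (w b))" for xs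
  obtain a x where a: "a \<in> A" "a \<le> Suc K" "x \<in> T" "adj x (w a)" using T(4) by (auto simp: ct_def tch_def)
  obtain b y where b: "b \<in> B" "b \<le> Suc K" "y \<in> T" "adj y (w b)" using T(5) by (auto simp: ct_def tch_def)
  obtain xs0 where "walk xs0" "set xs0 \<subseteq> T" "hd xs0 = x" "last xs0 = y" using conn_path[OF T(1) a(3) b(3)] by blast
  then have "P xs0" unfolding P_def using a b by blast
  then obtain xs where Pxs: "P xs" and mn: "\<And>ys. P ys \<Longrightarrow> length xs \<le> length ys"
    using ex_has_least_nat[of P xs0 length] by blast
  have wx: "walk xs" "set xs \<subseteq> T" "xs \<noteq> []" using Pxs by (auto simp: P_def walk_def)
  obtain a where a: "a \<in> A" "a \<le> Suc K" "adj (hd xs) (w a)" using Pxs unfolding P_def by blast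
  obtain b where b: "b \<in> B" "b \<le> Suc K" "adj (last xs) (w b)" using Pxs unfolding P_def by blast
  have hT: "hd xs \<in> T" "last xs \<in> T" using wx by auto
  have dx: "distinct xs"
  proof (rule ccontr)
    assume "\<not> distinct xs"
    then obtain p y q r where x: "xs = p @ [y] @ q @ [y] @ r" using not_distinct_decomp by blast
    have "walk (p @ [y])" using walk_app1[of p y "q @ [y] @ r"] wx(1) x by simp
    moreover have "walk (y # r)" using walk_app2[of "p @ [y] @ q" y r] wx(1) x by simp
    ultimately have "walk (p @ [y] @ r)" by (auto simp: walk_def successively_append_iff)
    moreover have "hd (p @ [y] @ r) = hd xs" "last (p @ [y] @ r) = last xs" unfolding x by (cases p; simp)+
    moreover have "set (p @ [y] @ r) \<subseteq> T" using wx(2) unfolding x by auto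
    ultimately have "P (p @ [y] @ r)" unfolding P_def using a b by metis
    then show False using mn[of "p @ [y] @ r"] unfolding x by simp
  qed
  have hdA: "x = hd xs \<and> i = a" if x: "x \<in> set xs" "i \<in> A" "i \<le> Suc K" "adj x (w i)" for x i
  proof -
    obtain p r where pr: "xs = p @ x # r" using split_list[OF x(1)] by blast
    have "p = []"
    proof (rule ccontr)
      assume "p \<noteq> []"
      moreover have "walk (x # r)" using walk_app2 wx(1) unfolding pr by blast
      then have "P (x # r)" unfolding P_def using x b wx(2) by (auto simp: pr)
      ultimately show False using mn[of "x # r"] pr by simp
    qed
    then have "x = hd xs" using pr by simp
    then show ?thesis using one[of x i a] x a hT T(2) by blast
  qed
  have lastB: "x = last xs \<and> i = b" if x: "x \<in> set xs" "i \<in> B" "i \<le> Suc K" "adj x (w i)" for x i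
  proof -
    obtain p r where pr: "xs = p @ x # r" using split_list[OF x(1)] by blast
    have "r = []"
    proof (rule ccontr)
      assume "r \<noteq> []"
      moreover have "walk (p @ [x])" using walk_app1 wx(1) unfolding pr by blast
      moreover have "hd (p @ [x]) = hd xs" unfolding pr by (cases p) simp_all
      ultimately have "P (p @ [x])" unfolding P_def using x a wx(2) by (auto simp: pr)
      then show False using mn[of "p @ [x]"] pr \<open>r \<noteq> []\<close> by simp
    qed
    then have "x = last xs" using pr by simp
    then show ?thesis using one[of x i b] x b hT T(2) by blast
  qed
  have ctx: "i \<in> A \<or> i \<in> B" if "x \<in> set xs" "i \<le> Suc K" "adj x (w i)" for x i
    using ctI[of x T i] that wx(2) T(3) by blast
  have "jl a b xs" unfolding jl_def
  proof (intro conjI ballI allI impI)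
    show "a \<noteq> b" using a b T(6) by blast
    fix x i assume x: "x \<in> set xs" "i \<le> Suc K"
    show "adj x (w i) \<longleftrightarrow> (x = hd xs \<and> i = a) \<or> (x = last xs \<and> i = b)"
      using ctx[OF x] hdA[OF x(1) _ x(2)] lastB[OF x(1) _ x(2)] a b by blast
  qed (use wx dx a b T(2) in auto)
  moreover have "a \<in> ct T" "b \<in> ct T" using ctI hT a b by blast+
  ultimately show ?thesis using a b wx(2) by blast
qed

lemma jump_of_set:
  assumes "conn T" "T \<subseteq> U" "ct T = {a, b}" "a \<noteq> b" shows "jump a b"
  using reach[of T "{a}" "{b}"] assms unfolding jump_def by auto

lemma jump_parity:
  assumes "jump a b" "a + 2 \<le> b" "b \<le> K" shows "even a \<longleftrightarrow> even b"
proof -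
  obtain xs where "jl a b xs" using assms(1) by (auto simp: jump_def)
  then have "s (w a) = s (w b)" using jump_side[OF jlD(11) jlD(2) jl_ct_all] assms by auto
  then show ?thesis using sw[of a] sw[of b] assms by auto
qed

text \<open>For two jumps that are not anticomplete: the part of \<open>zs\<close> before the first
  vertex that touches \<open>Q\<close> is still anticomplete to \<open>Q\<close>.\<close>

lemma first_touch:
  assumes jz: "jl a' b' zs" and Q: "a' \<notin> ct Q" "\<exists>z\<in>set zs. tch Q z"
  obtains us z vs where "zs = us @ z # vs" "tch Q z" "anti (set us) Q" "z \<notin> Q"
proof -
  note J = jlD[OF jz]
  obtain us z vs where zs: "zs = us @ z # vs" "tch Q z" "\<And>u. u \<in> set us \<Longrightarrow> \<not> tch Q u"
    using split_list_first_prop[OF Q(2)] by blast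
  have hQ: "hd zs \<notin> Q" using ctI[of "hd zs" Q a'] J Q(1) by blast
  have us: "set us \<inter> Q = {}"
  proof (cases "us = []")
    case False
    then have "walk us" "hd us = hd zs" using walk_app3 J(1) zs(1) by auto
    then show ?thesis using walk_avoid[of us Q] hQ zs(3) by simp
  qed simp
  have "anti (set us) Q" using us zs(3) sym unfolding anti_def tch_def by blast
  moreover have "z \<notin> Q"
  proof (cases "us = []")
    case True then show ?thesis using hQ zs(1) by simp
  next
    case False
    then have "adj (last us) z" using walk_snoc_adj J(1) zs(1) by blast
    then show ?thesis using zs(3)[of "last us"] False sym by (auto simp: tch_def)
  qed
  ultimately show ?thesis using that zs by blast
qed

lemma no_touch:
  assumes jz: "jl a' b' zs" and Q: "a' \<notin> ct Q" "\<not> (\<exists>z\<in>set zs. tch Q z)"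
  shows "anti (set zs) Q"
proof -
  note J = jlD[OF jz]
  have "hd zs \<notin> Q" using ctI[of "hd zs" Q a'] J Q(1) by blast
  then have "set zs \<inter> Q = {}" using walk_avoid[OF J(1)] Q(2) by blast
  then show ?thesis using Q(2) sym unfolding anti_def tch_def by blast
qed

lemma jl_prefix:
  assumes "jl a b (us @ z # vs)" "vs \<noteq> []"
  shows "conn (set (us @ [z]))" "set (us @ [z]) \<subseteq> U" "ct (set (us @ [z])) = {a}"
proof -
  let ?xs = "us @ z # vs"
  note J = jlD[OF assms(1)]
  have "walk (us @ [z])" using J(1) by (rule walk_app1)
  then show "conn (set (us @ [z]))" by (rule conn_walk)
  show "set (us @ [z]) \<subseteq> U" using J(2) by auto
  have "hd ?xs \<in> set (us @ [z])" by (cases us) auto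
  moreover have "last ?xs \<notin> set (us @ [z])" using J(3) assms(2) by (auto simp: last_append)
  ultimately show "ct (set (us @ [z])) = {a}" using jl_ct[OF assms(1), of "set (us @ [z])"] by auto
qed

lemma jl_suffix:
  assumes "jl a b (us @ z # vs)" "us \<noteq> []"
  shows "conn (set (z # vs))" "set (z # vs) \<subseteq> U" "ct (set (z # vs)) = {b}"
proof -
  let ?xs = "us @ z # vs"
  note J = jlD[OF assms(1)]
  have "walk (z # vs)" using J(1) by (rule walk_app2)
  then show "conn (set (z # vs))" by (rule conn_walk)
  show "set (z # vs) \<subseteq> U" using J(2) by auto
  have "hd ?xs \<notin> set (z # vs)" using J(3) assms(2) by (cases us) auto
  moreover have "last ?xs \<in> set (z # vs)" by auto
  ultimately show "ct (set (z # vs)) = {b}" using jl_ct[OF assms(1), of "set (z # vs)"] by auto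
qed

lemma jl_front:
  assumes "jl a b (us @ z # [])"
  shows "conn (set us)" "set us \<subseteq> U" "ct (set us) = {a}" "tch (set us) z" "us \<noteq> []"
proof -
  note J = jlD[OF assms]
  show ne: "us \<noteq> []" using J(10) by auto
  then obtain us' u where us: "us = us' @ [u]" by (metis rev_exhaust)
  have e: "us @ z # [] = us' @ u # [z]" using us by simp
  show "conn (set us)" "set us \<subseteq> U" "ct (set us) = {a}"
    using jl_prefix[OF assms[unfolded e]] us by simp_all
  have "adj (last us) z" using walk_snoc_adj[OF J(1) ne] .
  then show "tch (set us) z" using ne by (auto simp: tch_def)
qed

text \<open>If the jumps are anticomplete, the crossing lemmas decide. Otherwise they are spliced at
  the first vertex \<open>z\<close> of \<open>zs\<close> that touches \<open>xs\<close>. Each splice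
  gives a jump with the desired parity, a jump from \<open>a'\<close> that is too long for
  \<open>mx\<close>, a 4-cycle, or the situation of \<open>no_tripod\<close>.\<close>

lemma overlap_wide:
  assumes jz: "jl a' b' zs" and jx: "jl a b xs" and i: "a' < a" "a + 2 \<le> b'" "b' < b" "b' < K"
    and ex: "a' = 0 \<and> b = Suc K \<Longrightarrow> a' + 2 \<le> a" and mx: "\<And>d. b' < d \<Longrightarrow> \<not> jump a' d"
  shows "s (w a) = s (w b')"
proof -
  note Jz = jlD[OF jz] and Jx = jlD[OF jx]
  note cz = jl_ct_all[OF jz] and cx = jl_ct_all[OF jx]
  have K: "a' \<le> K" "a \<le> K" "b' \<le> K" using i by auto
  have Sz: "s (w a') = s (w b')" by (rule jump_side[OF Jz(11) Jz(2) cz]) (use i in auto)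
  have a'Q: "a' \<notin> ct (set xs)" using cx i by auto
  show ?thesis
  proof (cases "\<exists>z\<in>set zs. tch (set xs) z")
    case False
    note an = no_touch[OF jz a'Q False]
    show ?thesis
    proof (cases "a' = 0 \<and> b = Suc K")
      case False
      show ?thesis by (rule cross_mid[OF Jz(11,2) cz Jx(11,2) cx an]) (use i False in auto)
    next
      case True
      \<comment> \<open>\<open>cross_mid\<close> leaves out this pair of outer ends. Here
        \<open>ex\<close> and \<open>b' < K\<close> provide the gaps for
        \<open>cross_low\<close>.\<close>
      have "s (w a') = s (w a)" by (rule cross_low[OF Jz(11,2) cz Jx(11,2) _ _ _ an, where b = b]) (use cx i ex True in auto)
      then show ?thesis using Sz by simp
    qed
  next
    case True
    obtain us z vs where zs: "zs = us @ z # vs" "tch (set xs) z" "anti (set us) (set xs)" "z \<notin> set xs"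
      using first_touch[OF jz a'Q True] .
    obtain x xs' where xs: "xs = x # xs'" using Jx(7) by (cases xs) auto
    have ne: "xs' \<noteq> []" using Jx(12) xs by simp
    have xU: "x \<in> U" "adj x (w a)" using Jx(2,8) xs by simp_all
    have ctx: "ct {x} = {a}" using ct_sing[OF xU(1) _ xU(2)] Jx(4) by simp
    have zU: "z \<in> U" using Jz(2) zs(1) by simp
    show ?thesis
    proof (cases "vs = []")
      case False
      note pre = jl_prefix[OF jz[unfolded zs(1)] False]
      show ?thesis
      proof (cases "tch (set xs') z")
        case True
        note suf = jl_suffix[of a b "[x]" "hd xs'" "tl xs'"]
        have e: "[x] @ hd xs' # tl xs' = xs" "set (hd xs' # tl xs') = set xs'" using xs ne by simp_all
        have sx: "conn (set xs')" "set xs' \<subseteq> U" "ct (set xs') = {b}"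
          using suf jx unfolding e by simp_all
        have "conn (set xs' \<union> set (us @ [z]))" using conn_Un_tch[OF sx(1) pre(1) True] by simp
        moreover have "ct (set xs' \<union> set (us @ [z])) = {a', b}" unfolding ct_Un pre(3) sx(3) by auto
        ultimately have "jump a' b"
          using pre(2) sx(2) i by (intro jump_of_set[of "set xs' \<union> set (us @ [z])"]) auto
        then show ?thesis using mx i by blast
      next
        case False
        have xz: "adj x z" using False zs(2) xs by (auto simp: tch_def)
        show ?thesis
        proof (cases "a' + 2 \<le> a")
          case True
          have "tch (set (us @ [z])) x" using sym[OF xz] by (auto simp: tch_def)
          then have "conn (insert x (set (us @ [z])))" by (rule conn_insert[OF pre(1)])
          moreover have "ct (insert x (set (us @ [z]))) = {a', a}" using ct_insert[of x "set (us @ [z])"] ctx pre(3) by auto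
          ultimately have "s (w a') = s (w a)"
            using jump_side[of "insert x (set (us @ [z]))" a' a] xU pre(2) True i K by simp
          then show ?thesis using Sz by simp
        next
          case False
          then have aa: "a = Suc a'" using i by simp
          show ?thesis
          proof (cases "us = []")
            case True
            \<comment> \<open>The vertices \<open>z\<close>, \<open>x\<close>, \<open>w a\<close>,
              \<open>w a'\<close> would form a 4-cycle.\<close>
            then have "adj z (w a')" using Jz(8) zs(1) by simp
            moreover have "adj (w a) (w a')" using path[of a a'] K aa by simp
            moreover have "z \<noteq> w a" using U(1)[of a] K zU by auto
            ultimately have "w a' = x" using c4[of z "w a'" x "w a"] sym xz xU(2) by blast
            then show ?thesis using U(1)[of a'] K xU(1) by auto
          next
            case False
            note suf = jl_suffix[OF jz[unfolded zs(1)] False]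
            have "tch (set (z # vs)) x" using sym[OF xz] by (auto simp: tch_def)
            then have "conn (insert x (set (z # vs)))" by (rule conn_insert[OF suf(1)])
            moreover have "ct (insert x (set (z # vs))) = {a, b'}" using ct_insert[of x "set (z # vs)"] ctx suf(3) by auto
            ultimately show ?thesis
              using jump_side[of "insert x (set (z # vs))" a b'] xU suf(2) i K by simp
          qed
        qed
      qed
    next
      case True
      have zb: "adj z (w b')" using Jz(9) zs(1) True by simp
      have ctz: "ct {z} = {b'}" using ct_sing[OF zU _ zb] K by simp
      obtain ps y qs where ys: "xs = ps @ y # qs" "adj y z" using zs(2) unfolding tch_def by (meson split_list)
      show ?thesis
      proof (cases "qs = []")
        case False
        note pre = jl_prefix[OF jx[unfolded ys(1)] False]
        have "tch (set (ps @ [y])) z" using ys(2) by (auto simp: tch_def)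
        then have "conn (insert z (set (ps @ [y])))" by (rule conn_insert[OF pre(1)])
        moreover have "ct (insert z (set (ps @ [y]))) = {a, b'}" using ct_insert[of z "set (ps @ [y])"] ctz pre(3) by auto
        ultimately show ?thesis
          using jump_side[of "insert z (set (ps @ [y]))" a b'] zU pre(2) i K by simp
      next
        case qs: True
        have yb: "adj y (w b)" "y \<in> U" using Jx(2,9) ys(1) qs by simp_all
        have cty: "ct {y} = {b}" using ct_sing[OF yb(2) _ yb(1)] Jx(5) by simp
        show ?thesis
        proof (cases "b = Suc b'")
          case True
          then have "adj (w b') (w b)" using path[of b' b] i by simp
          moreover have "z \<noteq> w b" using U(1)[of b] Jx(5) zU by auto
          ultimately have "w b' = y" using c4[of z "w b'" y "w b"] sym zb ys(2) yb(1) by blast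
          then show ?thesis using U(1)[of b'] K yb(2) by auto
        next
          case False
          note fr = jl_front[OF jz[unfolded zs(1) \<open>vs = []\<close>]]
          have "anti (set us) {y}" using zs(3) by (rule anti_subset) (use ys(1) in auto)
          then show ?thesis
            using no_tripod[OF fr(1-4) zU zb, of "{y}" b] cty yb(2) ys(2) i False by (auto simp: tch_def)
        qed
      qed
    qed
  qed
qed

text \<open>The complement of \<open>overlap_wide\<close> for \<open>b' = Suc a\<close>. The jump
  puts \<open>w a'\<close> on the side of \<open>w (Suc a)\<close>, so any splice that puts it on
  the side of \<open>w a\<close> is contradictory; the other splices fail as before.\<close>

lemma overlap_adjacent:
  assumes jz: "jl a' (Suc a) zs" and x: "x \<in> U" "adj x (w a)"
    and X: "conn X" "X \<subseteq> U" "tch X x" "ct X \<subseteq> {Suc a<..}" "b \<in> ct X"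
    and i: "a' + 2 \<le> a" "a + 3 \<le> b" and mx: "\<And>d. Suc a < d \<Longrightarrow> \<not> jump a' d"
  shows False
proof -
  note Jz = jlD[OF jz] and cz = jl_ct_all[OF jz]
  have bN: "b \<le> Suc K" using ctD(2)[OF X(5)] .
  have K: "a' \<le> K" "a \<le> K" "Suc a \<le> K" using i bN by auto
  have ctx: "ct {x} = {a}" using ct_sing[OF x(1) _ x(2)] K by simp
  have Sz: "s (w a') = s (w (Suc a))" by (rule jump_side[OF Jz(11) Jz(2) cz]) (use i K in auto)
  then have na: "s (w a') \<noteq> s (w a)" using sw[of a'] sw[of a] sw[of "Suc a"] K by auto
  let ?Q = "insert x X"
  have ctQ: "ct ?Q = insert a (ct X)" using ct_insert[of x X] ctx by auto
  have a'Q: "a' \<notin> ct ?Q" using ctQ X(4) i by auto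
  have cQ: "conn ?Q" by (rule conn_insert[OF X(1,3)])
  show ?thesis
  proof (cases "\<exists>z\<in>set zs. tch ?Q z")
    case False
    have "s (w a') = s (w a)"
      by (rule cross_low[OF Jz(11,2) cz cQ _ _ _ _ no_touch[OF jz a'Q False], where b = b]) (use ctQ x X i in auto)
    then show ?thesis using na by simp
  next
    case True
    obtain us z vs where zs: "zs = us @ z # vs" "tch ?Q z" "anti (set us) ?Q" "z \<notin> ?Q"
      using first_touch[OF jz a'Q True] .
    have zU: "z \<in> U" using Jz(2) zs(1) by simp
    show ?thesis
    proof (cases "vs = []")
      case False
      note pre = jl_prefix[OF jz[unfolded zs(1)] False]
      show ?thesis
      proof (cases "tch X z")
        case True
        let ?T = "X \<union> set (us @ [z])"
        have "conn ?T" using conn_Un_tch[OF X(1) pre(1) True] by simp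
        moreover have "ct ?T = {a'} \<union> ct X" unfolding ct_Un pre(3) by auto
        moreover have "{a'} \<inter> ct X = {}" using X(4) i by auto
        ultimately obtain d where "d \<in> ct X" "jump a' d"
          using reach[of ?T "{a'}" "ct X"] X(2,5) pre(2) unfolding jump_def by blast
        then show ?thesis using mx X(4) by blast
      next
        case False
        have xz: "adj x z" using False zs(2) by (auto simp: tch_def)
        have "tch (set (us @ [z])) x" using sym[OF xz] by (auto simp: tch_def)
        then have "conn (insert x (set (us @ [z])))" by (rule conn_insert[OF pre(1)])
        moreover have "ct (insert x (set (us @ [z]))) = {a', a}" using ct_insert[of x "set (us @ [z])"] ctx pre(3) by auto
        ultimately have "s (w a') = s (w a)"
          using jump_side[of "insert x (set (us @ [z]))" a' a] x pre(2) i K by simp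
        then show ?thesis using na by simp
      qed
    next
      case True
      have zb: "adj z (w (Suc a))" using Jz(9) zs(1) True by simp
      note fr = jl_front[OF jz[unfolded zs(1) True]]
      show ?thesis
      proof (cases "tch X z")
        case True
        have "anti (set us) X" using zs(3) by (rule anti_subset) auto
        then show ?thesis
          using no_tripod[OF fr(1-4) zU zb X(1,2,4,5) True] i by simp
      next
        case False
        have xz: "adj x z" using False zs(2) by (auto simp: tch_def)
        have "adj (w (Suc a)) (w a)" using path[of "Suc a" a] K by simp
        moreover have "x \<noteq> w (Suc a)" using U(1)[of "Suc a"] K x by auto
        ultimately have "z = w a" using c4[of x z "w a" "w (Suc a)"] sym xz zb x(2) by blast
        then show ?thesis using U(1)[of a] K zU by auto
      qed
    qed
  qed
qed

end

section \<open>Crossed indices and the cut point\<close>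

locale linked_frame = frame +
  assumes link: "conn T \<Longrightarrow> T \<subseteq> U \<Longrightarrow> ct T = {0, Suc K} \<Longrightarrow>
      \<exists>z\<in>T. \<exists>T' i. T' \<subseteq> U \<and> conn T' \<and> z \<in> T' \<and> 2 \<le> i \<and> i \<le> K \<and> ct T' = {i}"
    and apex: "\<exists>a. 2 \<le> a \<and> a \<le> K \<and> jump a (Suc K)"
begin

text \<open>A case on which \<open>jump_side\<close> is silent. The branch from \<open>link\<close>
  turns such a jump into one from \<open>w 0\<close> to \<open>w i\<close>, so \<open>i\<close> is
  even, and into one from \<open>w i\<close> to the centre, so \<open>i\<close> is odd unless
  \<open>i = K\<close>, which is odd anyway.\<close>

lemma no_jump_0: "\<not> jump 0 (Suc K)"
proof
  assume "jump 0 (Suc K)"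
  then obtain zs where jz: "jl 0 (Suc K) zs" by (auto simp: jump_def)
  note J = jlD[OF jz] and c = jl_ct_all[OF jz]
  obtain z T' i where z: "z \<in> set zs" "T' \<subseteq> U" "conn T'" "z \<in> T'" "2 \<le> i" "i \<le> K" "ct T' = {i}"
    using link[OF J(11,2) c] by blast
  have "z \<noteq> hd zs" using ctI[of z T' 0] J(8) z by auto
  moreover have "z \<noteq> last zs" using ctI[of z T' "Suc K"] J(9) z by auto
  moreover obtain us vs where zs: "zs = us @ z # vs" using split_list[OF z(1)] by blast
  ultimately have ne: "us \<noteq> []" "vs \<noteq> []" by auto
  note pre = jl_prefix[OF jz[unfolded zs] ne(2)] and suf = jl_suffix[OF jz[unfolded zs] ne(1)]
  have "conn (set (us @ [z]) \<union> T')" by (rule conn_Un[OF pre(1) z(3)]) (use z in auto)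
  moreover have "ct (set (us @ [z]) \<union> T') = {0, i}" unfolding ct_Un pre(3) z(7) by auto
  ultimately have "s (w 0) = s (w i)"
    using pre(2) z by (intro jump_side[of "set (us @ [z]) \<union> T'"]) auto
  moreover have "s (w i) = t"
  proof (cases "i = K")
    case True then show ?thesis using sw[of K] Kodd by simp
  next
    case False
    have "conn (set (z # vs) \<union> T')" by (rule conn_Un[OF suf(1) z(3)]) (use z in auto)
    moreover have "ct (set (z # vs) \<union> T') = {i, Suc K}" unfolding ct_Un suf(3) z(7) by auto
    ultimately have "s (w i) = s (w (Suc K))"
      using suf(2) z False by (intro jump_side[of "set (z # vs) \<union> T'"]) auto
    then show ?thesis using sN by simp
  qed
  ultimately show False using sw[of 0] by simp
qed

lemma jump_N_odd: assumes "jump a (Suc K)" "1 \<le> a" "a \<le> K" shows "odd a"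
proof (cases "a = K")
  case False
  obtain xs where x: "jl a (Suc K) xs" using assms(1) by (auto simp: jump_def)
  have "s (w a) = s (w (Suc K))" using jump_side[OF jlD(11) jlD(2) jl_ct_all, OF x x x] assms False by auto
  then show ?thesis using sN sw[of a] assms by (cases t) auto
qed (use Kodd in simp)

text \<open>From an even index no jump reaches the centre, so the farthest jump still ends on the
  path.\<close>

lemma even_max:
  assumes "even a" "jump a b" "a < b" "b \<le> K"
  obtains b' where "b \<le> b'" "b' \<le> K" "jump a b'" "\<And>d. b' < d \<Longrightarrow> \<not> jump a d"
proof -
  let ?D = "{d. d \<le> K \<and> jump a d}"
  have fin: "finite ?D" by (rule finite_subset[of _ "{..K}"]) auto
  have bD: "b \<in> ?D" using assms by simp
  have M: "Max ?D \<in> ?D" using Max_in[OF fin] bD by blast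
  have "\<not> jump a d" if "Max ?D < d" for d
  proof
    assume j: "jump a d"
    then have "d \<le> Suc K" using jlD(5) by (auto simp: jump_def)
    moreover have "d \<notin> ?D" using Max_ge[OF fin, of d] that by linarith
    ultimately have "d = Suc K" using j by auto
    then show False using j no_jump_0 jump_N_odd[of a] assms by (cases "a = 0") auto
  qed
  then show ?thesis using that[of "Max ?D"] M Max_ge[OF fin bD] by blast
qed

text \<open>Jumps from \<open>w 1\<close> are excluded: they start at neighbours of \<open>w 1\<close>, which are absorbed together with
  \<open>w 2\<close>. A jump around \<open>c\<close> from \<open>c - 1\<close> to \<open>c + 1\<close> gives no parity information.\<close>

definition cross :: "nat \<Rightarrow> nat \<Rightarrow> nat \<Rightarrow> bool" where
  "cross c a b \<longleftrightarrow> jump a b \<and> a < c \<and> c < b \<and> b \<le> K \<and> a \<noteq> 1 \<and> \<not> (Suc a = c \<and> b = Suc c)"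

text \<open>Let \<open>a\<close> be the least start of a jump crossing \<open>c\<close>. If
  \<open>a\<close> is odd, then by induction \<open>a\<close> is crossed from some even
  \<open>a'\<close>, and the farthest jump from \<open>a'\<close> ends at an even \<open>b'\<close>.
  It overlaps the jump from \<open>a\<close>, which forces \<open>a\<close> and \<open>b'\<close> to
  have equal parity.\<close>

lemma even_crosser:
  "2 \<le> c \<Longrightarrow> (\<And>i. 2 \<le> i \<Longrightarrow> i \<le> c \<Longrightarrow> \<exists>a b. cross i a b) \<Longrightarrow> \<exists>a b. cross c a b \<and> even a"
proof (induction c rule: less_induct)
  case (less c)
  define a where "a = (LEAST a. \<exists>b. cross c a b)"
  have "\<exists>a b. cross c a b" using less.prems by blast
  then have "\<exists>b. cross c a b" unfolding a_def by (rule LeastI_ex)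
  then obtain b where ab: "cross c a b" by blast
  have amin: "a \<le> d" if "cross c d e" for d e unfolding a_def by (rule Least_le) (use that in blast)
  show ?case
  proof (cases "even a")
    case True then show ?thesis using ab by blast
  next
    case False
    note h = ab[unfolded cross_def]
    have a3: "3 \<le> a" using False h by (cases a; cases "a - 1"; cases "a - 2") auto
    have "\<exists>a' b'. cross a a' b' \<and> even a'"
      by (rule less.IH) (use a3 h less.prems(2) in auto)
    then obtain a' b0 where c0: "cross a a' b0" "even a'" by blast
    note h0 = c0(1)[unfolded cross_def]
    obtain b' where b': "b0 \<le> b'" "b' \<le> K" "jump a' b'" "\<And>d. b' < d \<Longrightarrow> \<not> jump a' d"
      using even_max[OF c0(2), of b0] h0 by auto
    have eb: "even b'" using jump_parity[OF b'(3)] c0(2) h0 b' by auto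
    \<comment> \<open>Otherwise the jump from \<open>a' < a\<close> would cross \<open>c\<close>,
      against the choice of \<open>a\<close>.\<close>
    have b'c: "b' \<le> c"
    proof (rule ccontr)
      assume "\<not> b' \<le> c"
      then have "cross c a' b'" using b' h h0 unfolding cross_def by auto
      then show False using amin h0 by fastforce
    qed
    obtain zs where jz: "jl a' b' zs" using b'(3) by (auto simp: jump_def)
    obtain xs where jx: "jl a b xs" using h by (auto simp: jump_def)
    show ?thesis
    proof (cases "b' = Suc a")
      case True
      have "odd b" using jump_parity[of a b] h False b'c True by auto
      \<comment> \<open>A jump from \<open>a\<close> to \<open>a + 2\<close> could cross only
        \<open>c = Suc a\<close>, and this case is excluded in \<open>cross\<close>.\<close>
      moreover have "b \<noteq> a + 2" using h b'c True by auto
      ultimately have b3: "a + 3 \<le> b" using h b'c True False by linarith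
      have "Suc a' \<noteq> a" using h0 b' True by auto
      then have a2: "a' + 2 \<le> a" using h0 by auto
      obtain x xs' where xs: "xs = x # xs'" "xs' \<noteq> []" using jlD(7,12)[OF jx] by (cases xs) auto
      note Jx = jlD[OF jx]
      have "jl a b ([x] @ hd xs' # tl xs')" using jx xs by simp
      from jl_suffix[OF this] have sx: "conn (set xs')" "set xs' \<subseteq> U" "ct (set xs') = {b}"
        using xs(2) by simp_all
      have "tch (set xs') x" using tchI[OF hd_in_set[OF xs(2)] sym] walk_tl_adj[OF Jx(1,12)] xs(1) by simp
      then have False
        using overlap_adjacent[OF jz[unfolded True] _ _ sx(1,2), of x b] Jx(2,8) xs sx(3) a2 b3 b'(4) True by auto
      then show ?thesis ..
    next
      case ne: False
      have "s (w a) = s (w b')"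
        by (rule overlap_wide[OF jz jx _ _ _ _ _ b'(4)]) (use h h0 b' b'c ne in auto)
      then show ?thesis using sw[of a] sw[of b'] h b'(2) eb False by auto
    qed
  qed
qed

text \<open>The overlap argument of \<open>even_crosser\<close>, with the jump into the centre in
  the role of the jump from an odd index.\<close>

lemma jump_N_uncrossed:
  assumes "jump a (Suc K)" "2 \<le> a" "a \<le> K"
  shows "\<exists>i. 2 \<le> i \<and> i \<le> a \<and> \<not> (\<exists>d e. cross i d e)"
proof (rule ccontr)
  assume n: "\<not> ?thesis"
  have "\<exists>d e. cross a d e \<and> even d" using even_crosser[of a] n assms(2) by blast
  then obtain a' b0 where c0: "cross a a' b0" "even a'" by blast
  note h0 = c0(1)[unfolded cross_def]
  obtain b' where b': "b0 \<le> b'" "b' \<le> K" "jump a' b'" "\<And>d. b' < d \<Longrightarrow> \<not> jump a' d"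
    using even_max[OF c0(2), of b0] h0 by auto
  have eb: "even b'" using jump_parity[OF b'(3)] c0(2) h0 b' by auto
  have b'K: "b' < K" using eb Kodd b'(2) by (cases "b' = K") auto
  have oa: "odd a" using jump_N_odd assms by simp
  obtain zs where jz: "jl a' b' zs" using b'(3) by (auto simp: jump_def)
  obtain xs where jx: "jl a (Suc K) xs" using assms(1) by (auto simp: jump_def)
  show False
  proof (cases "b' = Suc a")
    case True
    have "Suc a' \<noteq> a" using h0 b' True by auto
    then have a2: "a' + 2 \<le> a" using h0 by auto
    obtain x xs' where xs: "xs = x # xs'" "xs' \<noteq> []" using jlD(7,12)[OF jx] by (cases xs) auto
    note Jx = jlD[OF jx]
    have "jl a (Suc K) ([x] @ hd xs' # tl xs')" using jx xs by simp
    from jl_suffix[OF this] have sx: "conn (set xs')" "set xs' \<subseteq> U" "ct (set xs') = {Suc K}"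
      using xs(2) by simp_all
    have "tch (set xs') x" using tchI[OF hd_in_set[OF xs(2)] sym] walk_tl_adj[OF Jx(1,12)] xs(1) by simp
    then show False
      using overlap_adjacent[OF jz[unfolded True] _ _ sx(1,2), of x "Suc K"] Jx(2,8) xs sx(3) a2 b'(4) b'K True by auto
  next
    case False
    have "s (w a) = s (w b')"
      by (rule overlap_wide[OF jz jx _ _ _ _ _ b'(4)]) (use h0 b' b'K False assms(2) in auto)
    then show False using sw[of a] sw[of b'] assms b'(2) eb oa by auto
  qed
qed

text \<open>The cut point. It exists because, by \<open>jump_N_uncrossed\<close>, the jump to the centre cannot start
  behind crossed indices only.\<close>

definition r :: nat where "r = (LEAST i. 2 \<le> i \<and> \<not> (\<exists>d e. cross i d e))"

lemma r_props: "2 \<le> r" "\<not> cross r d e" "2 \<le> i \<Longrightarrow> i < r \<Longrightarrow> \<exists>d e. cross i d e"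
proof -
  obtain a where "2 \<le> a" "a \<le> K" "jump a (Suc K)" using apex by blast
  then have "\<exists>i. 2 \<le> i \<and> \<not> (\<exists>d e. cross i d e)" using jump_N_uncrossed by blast
  then have "2 \<le> r \<and> \<not> (\<exists>d e. cross r d e)" unfolding r_def by (rule LeastI_ex)
  then show "2 \<le> r" "\<not> cross r d e" by blast+
  show "\<exists>d e. cross i d e" if "2 \<le> i" "i < r" using not_less_Least[of i] that unfolding r_def by blast
qed

lemma r_jump: "jump a (Suc K) \<Longrightarrow> 2 \<le> a \<Longrightarrow> a \<le> K \<Longrightarrow> r \<le> a"
proof -
  assume "jump a (Suc K)" "2 \<le> a" "a \<le> K"
  then obtain i where i: "2 \<le> i" "i \<le> a" "\<not> (\<exists>d e. cross i d e)" using jump_N_uncrossed by blast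
  have "r \<le> i" unfolding r_def by (rule Least_le) (use i in blast)
  then show "r \<le> a" using i(2) by simp
qed

text \<open>The index \<open>r - 1\<close> is crossed from an even index, and the farthest jump from
  there cannot pass the uncrossed \<open>r\<close>, so it ends exactly at \<open>r\<close>. A start
  at \<open>r - 2\<close> is excluded in \<open>cross\<close>, whence the distance 3.\<close>

lemma r_barrier:
  assumes "2 < r"
  obtains a0 where "even a0" "a0 + 3 \<le> r" "jump a0 r" "\<And>d. r < d \<Longrightarrow> \<not> jump a0 d"
proof -
  have "\<exists>a b. cross (r - 1) a b \<and> even a"
    by (rule even_crosser) (use assms r_props(3) in auto)
  then obtain a0 b0 where c: "cross (r - 1) a0 b0" "even a0" by blast
  note h = c(1)[unfolded cross_def]
  obtain b' where b': "b0 \<le> b'" "b' \<le> K" "jump a0 b'" "\<And>d. b' < d \<Longrightarrow> \<not> jump a0 d"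
    using even_max[OF c(2), of b0] h by auto
  have "b' \<le> r"
  proof (rule ccontr)
    assume "\<not> b' \<le> r"
    then have "cross r a0 b'" using h b' unfolding cross_def by auto
    then show False using r_props(2) by blast
  qed
  then have "b' = r" using h b' by auto
  moreover have "a0 + 3 \<le> r" using h b' \<open>b' \<le> r\<close> by auto
  ultimately show ?thesis using that[of a0] c(2) b' by auto
qed

lemma r_even: "even r"
proof (cases "r = 2")
  case False
  then have "2 < r" using r_props(1) by simp
  then obtain a0 where a0: "even a0" "a0 + 3 \<le> r" "jump a0 r" by (rule r_barrier) blast
  obtain a where a: "2 \<le> a" "a \<le> K" "jump a (Suc K)" using apex by blast
  then have "r \<le> K" using r_jump by fastforce
  then show ?thesis using jump_parity[OF a0(3)] a0 by auto
qed simp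

lemma r_less: "r < K"
proof -
  obtain a where a: "2 \<le> a" "a \<le> K" "jump a (Suc K)" using apex by blast
  then have "r \<le> K" using r_jump by fastforce
  then show ?thesis using r_even Kodd by (cases "r = K") auto
qed

text \<open>Otherwise there is a jump from \<open>a\<close> to some \<open>d > r\<close>. The centre
  is impossible by \<open>no_jump_0\<close> and \<open>r_jump\<close>, and a jump to the path would
  cross \<open>r\<close> unless \<open>Suc a = r\<close>; in that case it overlaps the jump from
  \<open>r_barrier\<close>.\<close>

lemma barrier_low:
  assumes x: "x \<in> U" "adj x (w a)" "a < r" "a \<noteq> 1"
    and X: "conn X" "X \<subseteq> U" "tch X x" "ct X \<subseteq> {r<..}" "b \<in> ct X" "r + 2 \<le> b"
  shows False
proof -
  let ?T = "insert x X"
  have ctx: "ct {x} = {a}" using ct_sing[OF x(1) _ x(2)] x(3) r_less by simp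
  have cT: "ct ?T = {a} \<union> ct X" using ct_insert[of x X] ctx by auto
  have "conn ?T" by (rule conn_insert[OF X(1,3)])
  moreover have "{a} \<inter> ct X = {}" using X(4) x(3) by auto
  ultimately obtain d where d: "d \<in> ct X" "jump a d"
    using reach[of ?T "{a}" "ct X"] cT X(2,5) x(1) unfolding jump_def by blast
  have dN: "d \<le> Suc K" "r < d" using ctD(2)[OF d(1)] d(1) X(4) by auto
  show False
  proof (cases "d \<le> K")
    case False
    then have "d = Suc K" using dN by simp
    then show False using d(2) no_jump_0 r_jump[of a] x(3,4) r_less by (cases "a = 0") auto
  next
    case True
    have ar: "Suc a = r" using r_props(2)[of a d] d(2) x(3,4) dN True unfolding cross_def by auto
    then have "2 < r" using x(4) r_props(1) by auto
    then obtain a0 where a0: "even a0" "a0 + 3 \<le> r" "jump a0 r" "\<And>d. r < d \<Longrightarrow> \<not> jump a0 d" by (rule r_barrier) blast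
    obtain zs where jz: "jl a0 r zs" using a0(3) by (auto simp: jump_def)
    show False
      by (rule overlap_adjacent[OF jz[folded ar] x(1,2) X(1-3)]) (use X a0 ar in auto)
  qed
qed

text \<open>Jumps from \<open>w 1\<close> do not count in \<open>cross\<close> and are treated
  separately. Index 2 is crossed, necessarily from 0; the farthest jump from 0 ends at an even
  index, at most \<open>r\<close>, and overlaps the jump from \<open>w 1\<close>.\<close>

lemma barrier_one:
  assumes "r \<noteq> 2" and x: "x \<in> U" "adj x (w 1)"
    and X: "conn X" "X \<subseteq> U" "tch X x" "ct X \<subseteq> {r<..K}" "ct X \<noteq> {}"
  shows False
proof -
  let ?T = "insert x X"
  have r2: "2 < r" using assms(1) r_props(1) by simp
  have ctx: "ct {x} = {1}" using ct_sing[OF x(1) _ x(2)] by simp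
  have cT: "ct ?T = {1} \<union> ct X" using ct_insert[of x X] ctx by auto
  have "conn ?T" by (rule conn_insert[OF X(1,3)])
  moreover have "{1} \<inter> ct X = {}" using X(4) r2 by auto
  ultimately obtain d xs where d: "d \<in> ct X" "jl 1 d xs"
    using reach[of ?T "{1}" "ct X"] cT X(2,5) x(1) by blast
  have dN: "d \<le> K" "r < d" using d(1) X(4) by auto
  obtain a0 b0 where c: "cross 2 a0 b0" using r_props(3)[of 2] r2 by auto
  note h = c[unfolded cross_def]
  have a0: "a0 = 0" using h by auto
  obtain b' where b': "b0 \<le> b'" "b' \<le> K" "jump 0 b'" "\<And>d. b' < d \<Longrightarrow> \<not> jump 0 d"
    using even_max[of 0 b0] h a0 by auto
  have br: "b' \<le> r"
  proof (rule ccontr)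
    assume "\<not> b' \<le> r"
    then have "cross r 0 b'" using r2 b' unfolding cross_def by auto
    then show False using r_props(2) by blast
  qed
  obtain zs where jz: "jl 0 b' zs" using b'(3) by (auto simp: jump_def)
  have "s (w 1) = s (w b')"
    by (rule overlap_wide[OF jz d(2) _ _ _ _ _ b'(4)]) (use h b' br dN in auto)
  moreover have "even b'" using jump_parity[OF b'(3)] h b' by auto
  ultimately show False using sw[of 1] sw[of b'] b'(2) Kodd by (cases K) auto
qed

end

lemma (in theta_free) cmp_max: assumes "conn T" "x \<in> T" "T \<subseteq> A" shows "T \<subseteq> cmp A x"
proof
  fix y assume "y \<in> T"
  then obtain xs where "walk xs" "set xs \<subseteq> T" "hd xs = x" "last xs = y" using conn_path[OF assms(1,2)] by blast
  then show "y \<in> cmp A x" using assms(3) unfolding cmp_def by blast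
qed

lemma (in theta_free) cmp_least:
  assumes "x \<in> G" "G \<subseteq> A" "\<And>v u. v \<in> G \<Longrightarrow> u \<in> A \<Longrightarrow> adj v u \<Longrightarrow> u \<in> G"
  shows "cmp A x \<subseteq> G"
proof (rule ccontr)
  assume n: "\<not> cmp A x \<subseteq> G"
  have xA: "x \<in> A" using assms by blast
  have c: "conn (cmp A x)" by (rule cmp_conn[OF xA])
  let ?T = "cmp A x \<inter> G"
  have "?T \<subseteq> cmp A x" "?T \<noteq> {}" "?T \<noteq> cmp A x" using n cmp_self[OF xA] assms(1) by blast+
  then obtain a b where "a \<in> ?T" "b \<in> cmp A x - ?T" "adj a b"
    using c unfolding conn_def by (elim conjE allE[of _ ?T]) auto
  then show False using assms(3)[of a b] cmp_sub by blast
qed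

lemma (in theta_free) cmp_sym: "y \<in> cmp A x \<Longrightarrow> x \<in> cmp A y"
proof -
  assume "y \<in> cmp A x"
  then obtain xs where "walk xs" "set xs \<subseteq> A" "hd xs = x" "last xs = y" by (auto simp: cmp_def)
  then have "walk (rev xs) \<and> set (rev xs) \<subseteq> A \<and> hd (rev xs) = y \<and> last (rev xs) = x"
    using walk_rev by (auto simp: hd_rev last_rev walk_def)
  then show ?thesis unfolding cmp_def by blast
qed

section \<open>The layer below one parent\<close>

locale layer = minimal_state +
  fixes p0 g :: 'a
  assumes p0M: "p0 \<in> M" and p0par: "\<exists>b\<in>bd C. adj b p0"
    and gC: "g \<in> C" "\<And>b. b \<in> bd C \<Longrightarrow> adj b p0 \<Longrightarrow> \<not> adj g b"
begin

definition L0 :: "'a set" where "L0 = {b\<in>bd C. adj b p0}"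
definition E :: "'a set" where "E = {x\<in>C. \<exists>b\<in>L0. adj x b}"
definition F :: "'a set" where "F = bd C - L0"
definition C1 :: "'a set" where "C1 = cmp (C - E) g"

lemma L0D: "b \<in> L0 \<Longrightarrow> b \<in> bd C \<and> adj b p0 \<and> adj p0 b \<and> s b = t \<and> b \<notin> C \<and> b \<notin> M"
  using sbd leaf sym by (auto simp: L0_def)
lemma ED: "x \<in> E \<Longrightarrow> x \<in> C \<and> x \<notin> M \<and> s x = (\<not> t)"
  using L0D side inner(1) unfolding E_def by blast
lemma FD: "b \<in> F \<Longrightarrow> b \<in> bd C \<and> \<not> adj b p0 \<and> s b = t \<and> b \<notin> C \<and> b \<notin> M \<and> b \<notin> L0"
  using sbd leaf by (auto simp: F_def L0_def)
lemma gE: "g \<in> C - E" using gC by (auto simp: E_def L0_def)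
lemma C1D: "y \<in> C1 \<Longrightarrow> y \<in> C \<and> y \<notin> E \<and> y \<notin> M"
  using cmp_sub[of "C - E" g] inner(1) unfolding C1_def by blast
lemma connC1: "conn C1" unfolding C1_def by (rule cmp_conn[OF gE])
lemma C1_L0: "y \<in> C1 \<Longrightarrow> b \<in> L0 \<Longrightarrow> \<not> adj y b \<and> \<not> adj b y"
  using C1D[of y] sym unfolding E_def by blast
lemma E_L0: assumes "x \<in> E" obtains b where "b \<in> L0" "adj x b" "adj b x"
  using assms sym unfolding E_def by blast
lemma E_leaf: "x \<in> E \<Longrightarrow> b \<in> bd C \<Longrightarrow> b' \<in> bd C \<Longrightarrow> adj x b \<Longrightarrow> adj x b' \<Longrightarrow> b = b'"
  using no_double[of x b b'] ED[of x] by blast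
lemma E_F: assumes "x \<in> E" "b \<in> F" shows "\<not> adj x b" "\<not> adj b x"
proof -
  obtain b0 where "b0 \<in> L0" "adj x b0" using assms(1) by (rule E_L0)
  then show "\<not> adj x b" using E_leaf[OF assms(1), of b0 b] L0D FD[OF assms(2)] by blast
  then show "\<not> adj b x" using sym by blast
qed
lemma bdC1: "z \<in> bd C1 \<Longrightarrow> z \<in> E \<or> z \<in> F"
proof -
  assume z: "z \<in> bd C1"
  obtain y where y: "y \<in> C1" "adj z y" "adj y z" using z by (rule bdE)
  show ?thesis
  proof (cases "z \<in> C")
    case True then show ?thesis using bd_cmp[of z "C - E" g] z unfolding C1_def by blast
  next
    case False
    then have "z \<in> bd C" using bdI[of z C y] y C1D by blast
    then show ?thesis using C1_L0[OF y(1), of z] y(3) unfolding F_def by blast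
  qed
qed

lemma sub_bd:
  assumes "C' \<subseteq> C1" "z \<in> bd C'" shows "z \<in> C1 \<or> z \<in> E \<or> z \<in> F"
proof (cases "z \<in> C1")
  case False
  then have "z \<in> bd C1" using assms by (auto simp: bd_def)
  then show ?thesis using bdC1 by blast
qed simp

lemma E_ne: "\<exists>x. x \<in> E"
proof -
  obtain b where b: "b \<in> bd C" "adj b p0" using p0par by blast
  obtain y where "y \<in> C" "adj y b" using b(1) by (elim bdE)
  then show ?thesis using b unfolding E_def L0_def by blast
qed

lemma shrink: assumes "state M' C' t'" "C' \<subseteq> C1" shows False
proof -
  obtain x where "x \<in> E" using E_ne by blast
  then show False using smaller[OF assms(1) _ , of x] assms(2) C1D ED by blast
qed

text \<open>Otherwise the boundary of \<open>C1\<close> lies in \<open>E\<close>, and the star at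
  \<open>p0\<close> with all of \<open>L0\<close> gives a smaller state.\<close>

lemma F_nonempty: "\<exists>m. m \<in> F \<and> m \<in> bd C1"
proof (rule ccontr)
  assume n: "\<not> ?thesis"
  have "state (insert p0 L0) C1 (s p0)"
  proof (rule star_state)
    show "adj b p0" if "b \<in> L0" for b using L0D that by blast
    show "conn C1" by (rule connC1)
    show "deg3 v" if "v \<in> C1" for v using degC C1D that by blast
    show "anti (insert p0 L0) C1"
    proof -
      have "p0 \<notin> C1" "\<not> adj p0 y" if "y \<in> C1" for y using inner[of y] inner[of p0] C1D that p0M by blast+
      moreover have "b \<notin> C1" "\<not> adj b y" if "b \<in> L0" "y \<in> C1" for b y using L0D C1D C1_L0 that by blast+
      ultimately show ?thesis unfolding anti_def by blast
    qed
    show "\<exists>b\<in>L0. adj l b" if l: "l \<in> bd C1" for l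
    proof -
      have "l \<in> E" using bdC1[OF l] n l by blast
      then show ?thesis by (meson E_L0)
    qed
  qed
  then show False using shrink by blast
qed

text \<open>The first of three patterns for shrinking to a part of \<open>C1\<close>: all leaves of
  \<open>p0\<close> and of one more parent \<open>p\<close> join \<open>M\<close>. The vertices next
  to them have only one leaf neighbour by \<open>no_double\<close>, hence unique parents.\<close>

lemma two_layers:
  assumes p: "p \<in> M" "p \<noteq> p0" "s p = (\<not> t)" and C': "C' \<subseteq> C1" "conn C'"
    "\<And>y b. y \<in> C' \<Longrightarrow> b \<in> bd C \<Longrightarrow> adj b p \<Longrightarrow> \<not> adj y b"
    and b: "\<And>z. z \<in> bd C' \<Longrightarrow> z \<in> E \<or> (z \<in> C1 \<and> (\<exists>b\<in>bd C. adj b p \<and> adj z b))"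
  shows False
proof -
  let ?X1 = "{b\<in>bd C. adj b p}"
  have sp0: "s p0 = (\<not> t)" using p0par side sbd by blast
  have CC: "y \<in> C" "y \<in> C1" if "y \<in> C'" for y using that C' C1D by blast+
  have zC: "z \<in> C \<and> (\<exists>b\<in>L0 \<union> ?X1. adj z b)" if "z \<in> bd C'" for z
    using b[OF that]
  proof
    assume z: "z \<in> E"
    then obtain b0 where "b0 \<in> L0" "adj z b0" by (rule E_L0)
    then show ?thesis using ED[OF z] by blast
  next
    assume "z \<in> C1 \<and> (\<exists>b\<in>bd C. adj b p \<and> adj z b)"
    then show ?thesis using C1D by blast
  qed
  have bdd: "b \<in> bd C" if "b \<in> L0 \<union> ?X1" for b using that L0D by blast
  have "state (M \<union> L0 \<union> ?X1) C' (\<not> t)"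
  proof (rule two_star_state[OF connM p0M p(1) p(2)[symmetric] sp0 p(3)])
    show "x \<notin> M \<and> adj x p0 \<and> (\<forall>q\<in>M. adj x q \<longrightarrow> q = p0)" if "x \<in> L0" for x
      using that L0D[of x] parent_unique[of x _ p0] p0M by blast
    show "x \<notin> M \<and> adj x p \<and> (\<forall>q\<in>M. adj x q \<longrightarrow> q = p)" if "x \<in> ?X1" for x
      using that leaf(1)[of x] parent_unique[of x _ p] p(1) by blast
    show "conn C'" by (rule C'(2))
    show "deg3 v" if "v \<in> C'" for v using degC CC that by blast
    have 1: "anti M C'" by (rule anti_subset[OF antiMC order_refl]) (use CC in blast)
    have 2: "anti L0 C'" using L0D CC C1_L0 unfolding anti_def by blast
    have 3: "anti ?X1 C'" using leaf(2) CC(1) C'(3) sym unfolding anti_def by blast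
    show "anti (M \<union> L0 \<union> ?X1) C'" unfolding anti_Un using 1 2 3 by blast
    show "(\<exists>b\<in>L0 \<union> ?X1. adj z b) \<and> (\<forall>q\<in>M. \<not> adj z q)" if z: "z \<in> bd C'" for z
      using zC[OF z] inner(2)[of z] by blast
    show "b = b'" if z: "z \<in> bd C'" "b \<in> L0 \<union> ?X1" "b' \<in> L0 \<union> ?X1" "adj z b" "adj z b'" for z b b'
      using no_double[of z b b'] zC[OF z(1)] bdd z by blast
  qed
  then show False using shrink C'(1) by blast
qed

text \<open>The second pattern: one leaf of \<open>p0\<close> joins \<open>M\<close> together with
  its neighbours in \<open>C\<close>. Here no boundary vertex may belong to
  \<open>E\<close>.\<close>

lemma one_leaf:
  assumes l: "l \<in> L0" and C': "C' \<subseteq> C1" "conn C'" "\<And>y e. y \<in> C' \<Longrightarrow> e \<in> nbC l \<Longrightarrow> \<not> adj e y"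
    and b: "\<And>z. z \<in> bd C' \<Longrightarrow> z \<in> F \<or> (z \<in> C1 \<and> (\<exists>e\<in>nbC l. adj z e))"
  shows False
proof -
  have lE: "e \<in> E" if "e \<in> nbC l" for e using nbCD[OF that] l unfolding E_def by blast
  have "state (M \<union> insert l (nbC l)) C' t"
  proof (rule ext_state[OF st p0M])
    show "l \<in> bd C" "adj l p0" using L0D[OF l] by blast+
    show "nbC l \<subseteq> C" using nbCD(1) by blast
    show "adj e l" if "e \<in> nbC l" for e using nbCD(2)[OF that] .
    show "C' \<subseteq> C" using C'(1) C1D by blast
    show "conn C'" by (rule C'(2))
    have "l \<notin> C'" "\<not> adj l y" if "y \<in> C'" for y using that C'(1) C1D L0D[OF l] C1_L0[OF _ l] by blast+
    moreover have "e \<notin> C'" if "e \<in> nbC l" for e using lE[OF that] C'(1) C1D by blast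
    ultimately show "anti (insert l (nbC l)) C'" using C'(3) unfolding anti_def by blast
    show "(z \<in> bd C \<and> \<not> adj z p0 \<and> (\<forall>e\<in>nbC l. \<not> adj z e)) \<or> (z \<in> C \<and> (\<exists>e\<in>nbC l. adj z e))" if "z \<in> bd C'" for z
      using b[OF that] FD[of z] E_F(2)[of _ z] lE C1D[of z] by blast
  qed
  then show False using shrink C'(1) by blast
qed

text \<open>The third pattern: a leaf of \<open>p0\<close> and a path from it into \<open>C\<close>
  join \<open>M\<close>, and the end \<open>u\<close> is the only new parent.\<close>

lemma long_path:
  assumes l: "l \<in> L0" and W: "W \<subseteq> C" "conn (insert l W)" "u \<in> W" "s u \<noteq> t"
    and C': "C' \<subseteq> C1" "conn C'" "anti W C'"
    and b: "\<And>z. z \<in> bd C' \<Longrightarrow> (z \<in> F \<and> (\<forall>e\<in>W. \<not> adj z e)) \<or> (z \<in> C1 \<and> adj z u \<and> (\<forall>e\<in>W. adj z e \<longrightarrow> e = u))"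
  shows False
proof -
  have "state (M \<union> insert l W) C' t"
  proof (rule path_ext_state[OF st p0M _ _ W])
    show "l \<in> bd C" "adj l p0" using L0D[OF l] by blast+
    show "C' \<subseteq> C" using C'(1) C1D by blast
    show "conn C'" by (rule C'(2))
    have "l \<notin> C'" "\<not> adj l y" if "y \<in> C'" for y using that C'(1) C1D L0D[OF l] C1_L0[OF _ l] by blast+
    then show "anti (insert l W) C'" using C'(3) unfolding anti_def by blast
    show "(z \<in> bd C \<and> \<not> adj z p0 \<and> (\<forall>e\<in>W. \<not> adj z e)) \<or> (z \<in> C \<and> adj z u \<and> (\<forall>e\<in>W. adj z e \<longrightarrow> e = u))"
      if "z \<in> bd C'" for z using b[OF that] FD[of z] C1D[of z] by blast
  qed
  then show False using shrink C'(1) by blast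
qed

text \<open>If all vertices of \<open>E\<close> on the boundary of \<open>C1\<close> were neighbours
  of \<open>l\<close>, then \<open>one_leaf\<close> would apply to a component of \<open>C1\<close>
  without the neighbours of \<open>nbC l\<close>.\<close>

lemma two_classes:
  assumes l: "l \<in> L0" shows "\<exists>e. e \<in> E \<and> e \<in> bd C1 \<and> \<not> adj e l"
proof (rule ccontr)
  assume n: "\<not> ?thesis"
  let ?Z = "{y\<in>C1. \<forall>e\<in>nbC l. \<not> adj e y}"
  have snb: "s e = (\<not> t)" if "e \<in> nbC l" for e using side[OF nbCD(2)[OF that]] L0D[OF l] by blast
  have tZ: "y \<in> ?Z" if "y \<in> C1" "s y = (\<not> t)" for y using that snb side by blast
  have "\<exists>y. y \<in> ?Z"
  proof -
    obtain y where y: "y \<in> C1" using conn_ne[OF connC1] by blast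
    show ?thesis
    proof (cases "s y = t")
      case False then show ?thesis using tZ[OF y] by blast
    next
      case True
      \<comment> \<open>Being on side \<open>t\<close>, \<open>y\<close> may be adjacent to
        \<open>nbC l\<close>. But by the absence of 4-cycles it has at most one neighbour adjacent
        to \<open>l\<close>; any other neighbour lies in \<open>C1\<close>, on the side that is
        never removed.\<close>
      have nb: "x \<in> C1 \<or> (x \<in> E \<and> adj x l)" if "adj y x" for x
      proof (cases "x \<in> C1")
        case False
        then have xb: "x \<in> bd C1" using bdI[of x C1 y] y sym[OF that] by blast
        have "x \<notin> F" using FD[of x] True side[OF that] by blast
        then show ?thesis using bdC1[OF xb] n xb by blast
      qed simp
      have yd: "deg3 y" using degC C1D y by blast
      obtain x1 where x1: "adj y x1" using deg3_avoid[OF yd] by blast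
      obtain x2 where x2: "adj y x2" "x2 \<noteq> x1" using deg3_avoid[OF yd] by blast
      have "y \<noteq> l" using y C1D L0D[OF l] by blast
      then have "\<not> (adj x1 l \<and> adj x2 l)" using c4[of y x1 x2 l] x1 x2 sym by blast
      then obtain x where x: "x \<in> C1" "adj y x" using nb[OF x1] nb[OF x2(1)] x1 x2(1) by blast
      then have "s x = (\<not> t)" using side True by blast
      then show ?thesis using tZ[OF x(1)] by blast
    qed
  qed
  then obtain y0 where y0: "y0 \<in> ?Z" by blast
  let ?C = "cmp ?Z y0"
  have CZ: "?C \<subseteq> ?Z" by (rule cmp_sub)
  show False
  proof (rule one_leaf[OF l])
    show "?C \<subseteq> C1" using CZ by blast
    show "conn ?C" by (rule cmp_conn[OF y0])
    show "\<not> adj e y" if "y \<in> ?C" "e \<in> nbC l" for y e using that CZ by blast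
    show "z \<in> F \<or> (z \<in> C1 \<and> (\<exists>e\<in>nbC l. adj z e))" if z: "z \<in> bd ?C" for z
    proof -
      obtain y where y: "y \<in> ?C" "adj z y" using z by (rule bdE)
      have zZ: "z \<notin> ?Z" using bd_cmp[OF z] .
      have "z \<notin> E" if "z \<notin> C1"
      proof
        assume zE: "z \<in> E"
        then have "z \<in> bd C1" using bdI[of z C1 y] that y CZ by blast
        then have "adj z l" using n zE by blast
        then have "z \<in> nbC l" using nbCI ED[OF zE] by blast
        then show False using y CZ by blast
      qed
      then show ?thesis using sub_bd[OF _ z] CZ zZ sym by blast
    qed
  qed
qed

end

section \<open>A shortest path from \<open>E\<close> to a leaf with another parent\<close>

locale layer_path = layer +
  fixes xs :: "'a list" and l p :: 'a
  assumes xs_walk: "walk xs" and xs_set: "set xs \<subseteq> E \<union> F \<union> C1" and xs_ends: "hd xs \<in> E" "last xs \<in> F"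
    and xs_min: "\<And>ys. walk ys \<Longrightarrow> set ys \<subseteq> E \<union> F \<union> C1 \<Longrightarrow> hd ys \<in> E \<Longrightarrow> last ys \<in> F \<Longrightarrow> length xs \<le> length ys"
    and l: "l \<in> L0" "adj (hd xs) l" and p: "p \<in> M" "adj (last xs) p"
begin

abbreviation "n \<equiv> length xs"

lemma xs_ne: "xs \<noteq> []" using xs_walk by (simp add: walk_def)
lemma xs0: "xs ! 0 \<in> E" "xs ! 0 = hd xs" using xs_ends(1) xs_ne by (simp_all add: hd_conv_nth)
lemma xsl: "xs ! (n - 1) \<in> F" "xs ! (n - 1) = last xs" using xs_ends(2) xs_ne by (simp_all add: last_conv_nth)
lemma n0: "0 < n" using xs_ne by simp
lemma FE_disj: "x \<in> E \<Longrightarrow> x \<notin> F" "x \<in> C1 \<Longrightarrow> x \<notin> F" "x \<in> C1 \<Longrightarrow> x \<notin> E"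
  using ED FD C1D by blast+

lemma xs_adj: "Suc i < n \<Longrightarrow> adj (xs ! i) (xs ! Suc i)"
  using xs_walk by (auto simp: walk_def successively_conv_nth)

lemma xs_side: "i < n \<Longrightarrow> s (xs ! i) = (odd i = t)"
proof (induction i)
  case 0 then show ?case using ED[OF xs0(1)] by simp
next
  case (Suc i) then show ?case using side[OF xs_adj[of i]] by auto
qed

lemma n_even: "even n"
  using xs_side[of "n - 1"] FD[OF xsl(1)] n0 by auto

lemma walk_take: "0 < k \<Longrightarrow> walk ys \<Longrightarrow> walk (take k ys)"
  by (auto simp: walk_def successively_conv_nth)

lemma walk_drop: "k < length ys \<Longrightarrow> walk ys \<Longrightarrow> walk (drop k ys)"
  by (auto simp: walk_def successively_conv_nth)

lemma take_last: "i < n \<Longrightarrow> last (take (Suc i) xs) = xs ! i"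
  by (simp add: take_Suc_conv_app_nth)

lemma walk_join: "walk as \<Longrightarrow> walk bs \<Longrightarrow> adj (last as) (hd bs) \<Longrightarrow> walk (as @ bs)"
  by (auto simp: walk_def successively_append_iff)

lemma chord:
  assumes "i < j" "j < n" "adj (xs ! i) (xs ! j)" shows "j = Suc i"
proof -
  let ?ys = "take (Suc i) xs @ drop j xs"
  have "walk ?ys"
    by (rule walk_join) (use assms walk_take[OF _ xs_walk, of "Suc i"] walk_drop[OF _ xs_walk, of j] in \<open>auto simp: take_last hd_drop_conv_nth\<close>)
  moreover have "set ?ys \<subseteq> E \<union> F \<union> C1" using xs_set set_take_subset set_drop_subset by fastforce
  moreover have "hd ?ys \<in> E" using xs_ends xs_ne by (cases xs) auto
  moreover have "last ?ys \<in> F" using xs_ends assms by simp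
  ultimately have "n \<le> length ?ys" by (rule xs_min)
  then show ?thesis using assms by simp
qed

lemma xs_distinct: "i < j \<Longrightarrow> j < n \<Longrightarrow> xs ! i \<noteq> xs ! j"
proof
  assume a: "i < j" "j < n" "xs ! i = xs ! j"
  show False
  proof (cases "Suc j < n")
    case True
    then have "adj (xs ! i) (xs ! Suc j)" using xs_adj a by simp
    then show False using chord[of i "Suc j"] a True by simp
  next
    case False
    then have j: "j = n - 1" using a by simp
    have "i < n" using a by simp
    have "xs ! i \<in> F" using a xsl j by simp
    then have "n \<le> length (take (Suc i) xs)"
      using walk_take[OF _ xs_walk, of "Suc i"] xs_set set_take_subset[of "Suc i" xs] xs_ends xs_ne take_last[OF \<open>i < n\<close>]
      by (intro xs_min) (auto simp: hd_take)
    then show False using a by simp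
  qed
qed

lemma xs_inj: "i < n \<Longrightarrow> j < n \<Longrightarrow> xs ! i = xs ! j \<Longrightarrow> i = j"
  using xs_distinct by (metis linorder_neqE_nat)

lemma xs_mid: assumes "0 < i" "Suc i < n" shows "xs ! i \<in> C1"
proof -
  have i: "i < n" using assms by simp
  have "xs ! i \<notin> E"
  proof
    assume e: "xs ! i \<in> E"
    have "n \<le> length (drop i xs)"
      using walk_drop[OF i xs_walk] xs_set set_drop_subset[of i xs] xs_ends e i
      by (intro xs_min) (auto simp: hd_drop_conv_nth)
    then show False using assms by simp
  qed
  moreover have "xs ! i \<notin> F"
  proof
    assume "xs ! i \<in> F"
    then have "n \<le> length (take (Suc i) xs)"
      using walk_take[OF _ xs_walk, of "Suc i"] xs_set set_take_subset[of "Suc i" xs] xs_ends xs_ne take_last[OF i]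
      by (intro xs_min) (auto simp: hd_take)
    then show False using assms by simp
  qed
  ultimately show ?thesis using xs_set nth_mem[OF i] by blast
qed

text \<open>The ends lie on different sides, so \<open>n\<close> is even, and no vertex of
  \<open>E\<close> is adjacent to \<open>F\<close>.\<close>

lemma n4: "4 \<le> n"
proof -
  have "n \<noteq> 2" using xs_adj[of 0] E_F(1)[OF xs0(1) xsl(1)] by auto
  then show ?thesis using n_even n0 by presburger
qed

lemma xs_C: "Suc i < n \<Longrightarrow> xs ! i \<in> C"
  using xs0(1) xs_mid[of i] ED C1D by (cases i) auto

lemma off_short:
  assumes "x \<in> C1" "i < j" "j < n" "adj (xs ! i) x" "adj x (xs ! j)" shows "j \<le> i + 2"
proof -
  let ?ys = "take (Suc i) xs @ x # drop j xs"
  have 1: "walk (x # drop j xs)" using walk_drop[OF assms(3) xs_walk] assms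
    by (auto simp: walk_def successively_Cons hd_drop_conv_nth)
  have "walk ?ys"
    by (rule walk_join[OF _ 1]) (use assms walk_take[OF _ xs_walk, of "Suc i"] in \<open>auto simp: take_last\<close>)
  moreover have "set ?ys \<subseteq> E \<union> F \<union> C1"
    using xs_set set_take_subset[of "Suc i" xs] set_drop_subset[of j xs] assms(1) by auto
  moreover have "hd ?ys \<in> E" using xs_ends xs_ne by (cases xs) auto
  moreover have "last ?ys \<in> F" using xs_ends assms by simp
  ultimately have "n \<le> length ?ys" by (rule xs_min)
  then show ?thesis using assms by simp
qed

text \<open>Two neighbours on the path have distance at most 2 by minimality, not 1 by parity, and
  not 2 by the absence of 4-cycles.\<close>

lemma off_one:
  assumes x: "x \<in> C1" "x \<notin> set xs" and i: "i < n" "j < n" "adj x (xs ! i)" "adj x (xs ! j)"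
  shows "i = j"
proof -
  have aux: False if "i < j" "j < n" "adj x (xs ! i)" "adj x (xs ! j)" for i j
  proof -
    have "j \<le> i + 2" using off_short[OF x(1) that(1,2) sym[OF that(3)] that(4)] .
    moreover have "j \<noteq> Suc i" using side[OF that(3)] side[OF that(4)] side[OF xs_adj[of i]] that by auto
    ultimately have j: "j = Suc (Suc i)" using that by simp
    have "adj (xs ! Suc i) (xs ! i)" "adj (xs ! Suc i) (xs ! j)" using xs_adj[of i] xs_adj[of "Suc i"] that j sym by auto
    moreover have "x \<noteq> xs ! Suc i" using x(2) that j by auto
    ultimately have "xs ! i = xs ! j" using c4[of x "xs ! i" "xs ! j" "xs ! Suc i"] that by blast
    then show False using xs_inj[of i j] that by simp
  qed
  show ?thesis using aux[of i j] aux[of j i] i by (cases i j rule: linorder_cases) auto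
qed

lemma E_off: assumes x: "x \<in> E" "x \<noteq> hd xs" "i < n" "adj x (xs ! i)" shows "i = 1" "\<not> adj x l"
proof -
  have 1: "walk (x # drop i xs)" using walk_drop[OF x(3) xs_walk] x
    by (auto simp: walk_def successively_Cons hd_drop_conv_nth)
  have "n \<le> length (x # drop i xs)"
    using 1 xs_set set_drop_subset[of i xs] x(1,3) xs_ends by (intro xs_min) auto
  then have "i \<le> 1" using x(3) n4 by simp
  moreover have "i \<noteq> 0"
  proof
    assume "i = 0"
    then show False using side[OF x(4)] ED[OF x(1)] ED[OF xs0(1)] by auto
  qed
  ultimately show i: "i = 1" by simp
  show "\<not> adj x l"
  proof
    assume "adj x l"
    moreover have "adj (xs ! 0) (xs ! 1)" using xs_adj[of 0] n4 by simp
    moreover have "adj (xs ! 0) l" using l xs0 by simp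
    ultimately have "xs ! 1 = l" using c4[of x "xs ! 1" l "xs ! 0"] x(2,4) i xs0 by simp
    then show False using xs_C[of 1] n4 L0D[OF l(1)] by simp
  qed
qed

lemma F_off: assumes x: "x \<in> F" "i < n" "adj x (xs ! i)" shows "i = n - 2"
proof -
  have "adj (last (take (Suc i) xs)) x" using take_last[OF x(2)] sym[OF x(3)] by simp
  then have 1: "walk (take (Suc i) xs @ [x])"
    using walk_take[OF _ xs_walk, of "Suc i"] by (intro walk_join) (auto simp: walk_def)
  have "n \<le> length (take (Suc i) xs @ [x])"
    using 1 xs_set set_take_subset[of "Suc i" xs] x(1) xs_ends xs_ne by (intro xs_min) (auto simp: hd_append hd_take)
  then have "n \<le> i + 2" using x(2) by simp
  moreover have "i \<noteq> n - 1" using side[OF x(3)] FD[OF x(1)] FD[OF xsl(1)] by auto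
  ultimately show ?thesis using x(2) by simp
qed

lemma xs_last_or: "i < n \<Longrightarrow> Suc i < n \<or> xs ! i = last xs"
  using xsl(2) by (metis Suc_lessI diff_Suc_1)

lemma sp: "s p = (\<not> t)" using side[OF p(2)] FD[OF xs_ends(2)] by blast
lemma pp0: "p \<noteq> p0" using p(2) FD[OF xs_ends(2)] by blast

lemma M_off: assumes "q \<in> M" "q \<noteq> p" "i < n" shows "\<not> adj (xs ! i) q"
proof (cases "Suc i < n")
  case True then show ?thesis using inner(2) xs_C assms(1) by blast
next
  case False
  then have "xs ! i = last xs" using xsl assms(3) by (metis Suc_lessI diff_Suc_1)
  then show ?thesis using parent_unique[of "last xs" q p] FD[OF xs_ends(2)] p assms(1,2) by auto
qed

lemma l_off: assumes "i < n" shows "adj l (xs ! i) \<longleftrightarrow> i = 0"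
proof
  assume a: "adj l (xs ! i)"
  have "i \<noteq> n - 1" using side[OF a] L0D[OF l(1)] FD[OF xsl(1)] by auto
  then have "0 < i \<Longrightarrow> xs ! i \<in> C1" using xs_mid[of i] assms by simp
  then show "i = 0" using C1_L0[OF _ l(1)] a by blast
next
  assume "i = 0" then show "adj l (xs ! i)" using l(2) xs0(2) sym by simp
qed

lemma xs_notM: "i < n \<Longrightarrow> xs ! i \<notin> M"
  using xs_C[of i] inner(1) FD[OF xs_ends(2)] xs_last_or[of i] by auto

end

section \<open>The hole closed through a tripod, and its surroundings\<close>

locale path_frame = layer_path +
  fixes m' p' z :: 'a and S0 S1 S2 R :: "'a set"
  assumes m': "m' \<in> F" "m' \<in> bd C1" "adj m' p'" "p' \<in> M"
    and tr: "z \<in> M" "s z = t" "S0 \<subseteq> M" "S1 \<subseteq> M" "S2 \<subseteq> M" "conn S0" "conn S1" "conn S2"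
      "p0 \<in> S0" "p \<in> S1" "p' \<in> S2" "z \<notin> S0 \<union> S1 \<union> S2" "tch S0 z" "tch S1 z" "tch S2 z"
      "anti S0 S1" "anti S0 S2" "anti S1 S2"
    and R: "R \<subseteq> insert z S0 - {p0}" "conn R" "z \<in> R" "tch R p0"
begin

text \<open>The entries \<open>p0\<close> and \<open>l\<close> shift the path by two, so
  \<open>xs ! i\<close> has index \<open>i + 2\<close>, its last vertex has index
  \<open>K = Suc n\<close>, and the centre follows.\<close>

definition w :: "nat \<Rightarrow> 'a" where "w i = (p0 # l # xs @ [z]) ! i"
definition K :: nat where "K = Suc n"
definition U :: "'a set" where
  "U = (C1 - set xs) \<union> (L0 - {l}) \<union> (E - {hd xs}) \<union> {m'} \<union> S2"

lemma w0: "w 0 = p0" by (simp add: w_def)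
lemma w1: "w (Suc 0) = l" by (simp add: w_def)
lemma w2: "i < n \<Longrightarrow> w (Suc (Suc i)) = xs ! i" by (simp add: w_def nth_append)
lemma wN: "w (Suc K) = z" by (simp add: w_def K_def nth_append)
lemma wK: "w K = last xs" using w2[of "n - 1"] xsl(2) n0 by (simp add: K_def)

lemma w_cases: assumes "i \<le> K"
  obtains "i = 0" "w i = p0" | "i = 1" "w i = l" | j where "i = Suc (Suc j)" "j < n" "w i = xs ! j"
proof -
  consider "i = 0" | "i = 1" | j where "i = Suc (Suc j)" by (cases i; cases "i - 1") auto
  then show ?thesis
  proof cases
    case 1 then show ?thesis using that(1) w0 by simp
  next
    case 2 then show ?thesis using that(2) w1 by simp
  next
    case 3 then show ?thesis using that(3)[of j] w2[of j] assms by (simp add: K_def)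
  qed
qed

lemma l_M: "q \<in> M \<Longrightarrow> adj l q \<longleftrightarrow> q = p0"
  using L0D[OF l(1)] parent_unique[of l q p0] p0M by blast

lemma p0xs: "i < n \<Longrightarrow> \<not> adj (xs ! i) p0" using M_off[OF p0M pp0[symmetric]] .

lemma p_notin: "p \<notin> S0" "p \<notin> S2" "p' \<notin> S0" "p' \<notin> S1" "p0 \<notin> S1" "p0 \<notin> S2" "p' \<noteq> p" "p' \<noteq> p0"
  using tr(9-11,16-18) unfolding anti_def by blast+

lemma m'_M: "q \<in> M \<Longrightarrow> adj m' q \<longleftrightarrow> q = p'"
  using FD[OF m'(1)] parent_unique[of m' q p'] m' by blast

lemma path_w: "i \<le> K \<Longrightarrow> j \<le> K \<Longrightarrow> adj (w i) (w j) \<longleftrightarrow> i = Suc j \<or> j = Suc i"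
proof -
  have xx: "adj (xs ! i) (xs ! j) \<longleftrightarrow> i = Suc j \<or> j = Suc i" if "i < n" "j < n" for i j
    using chord[of i j] chord[of j i] xs_adj[of i] xs_adj[of j] sym irrefl that
    by (cases i j rule: linorder_cases) (auto)
  have lp: "adj l p0" "adj p0 l" using L0D[OF l(1)] by blast+
  have lx: "adj (xs ! i) l \<longleftrightarrow> i = 0" "adj l (xs ! i) \<longleftrightarrow> i = 0" if "i < n" for i using l_off[OF that] sym by blast+
  have px: "\<not> adj (xs ! i) p0" "\<not> adj p0 (xs ! i)" if "i < n" for i using p0xs[OF that] sym by blast+
  assume i: "i \<le> K" and j: "j \<le> K"
  show ?thesis
    by (rule w_cases[OF i]; rule w_cases[OF j]) (use lp lx px xx irrefl in auto)
qed

lemma inj_w: "i \<le> K \<Longrightarrow> j \<le> K \<Longrightarrow> w i = w j \<Longrightarrow> i = j"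
proof -
  have lM: "l \<notin> M" "l \<notin> C" using L0D[OF l(1)] by blast+
  have lx: "xs ! i \<noteq> l" if "i < n" for i
    using lM xs_C[of i] FD[OF xs_ends(2)] l(1) xs_last_or[OF that] by auto
  have px: "xs ! i \<noteq> p0" if "i < n" for i using xs_notM[OF that] p0M by blast
  assume i: "i \<le> K" and j: "j \<le> K" and e: "w i = w j"
  show ?thesis
    by (rule w_cases[OF i]; rule w_cases[OF j]) (use e lx px lM p0M xs_inj in auto)
qed

lemma side_w: "i \<le> K \<Longrightarrow> s (w i) = (odd i = t)"
proof -
  have "s p0 = (\<not> t)" using side[of l p0] L0D[OF l(1)] by blast
  moreover assume i: "i \<le> K"
  ultimately show ?thesis
    by - (rule w_cases[OF i], use L0D[OF l(1)] xs_side in auto)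
qed

lemma w_notM: "1 \<le> i \<Longrightarrow> i \<le> K \<Longrightarrow> w i \<notin> M"
  by (rule w_cases[of i]) (use L0D[OF l(1)] xs_notM in auto)

lemma w_M: assumes "1 \<le> i" "i \<le> K" "q \<in> M" "adj q (w i)" shows "i = 1 \<and> q = p0 \<or> i = K \<and> q = p"
  using assms(2)
proof (cases rule: w_cases)
  case 1 then show ?thesis using assms by simp
next
  case 2 then show ?thesis using l_M[OF assms(3)] assms(4) sym by auto
next
  case (3 j)
  have "adj (xs ! j) q" using assms(4) 3 sym by simp
  then have "q = p" "\<not> Suc j < n" using M_off[OF assms(3) _ 3(2)] inner(2)[OF xs_C] assms(3) by blast+
  then show ?thesis using 3 by (simp add: K_def)
qed

lemma contact_S2: assumes "x \<in> S2" "i \<le> Suc K" "adj x (w i)" shows "i = Suc K"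
proof (rule ccontr)
  assume "i \<noteq> Suc K"
  then have i: "i \<le> K" using assms by simp
  show False
  proof (cases "i = 0")
    case True then show ?thesis using assms w0 tr(9,17) sym[of x p0] unfolding anti_def by auto
  next
    case False
    then have "x = p0 \<or> x = p" using w_M[of i x] i assms tr(5) by auto
    then show ?thesis using assms(1) p_notin by blast
  qed
qed

lemma contact_m': assumes "i \<le> Suc K" "adj m' (w i)" shows "i = K - 1"
proof (cases "i = Suc K")
  case True then show ?thesis using assms wN side[OF assms(2)] FD[OF m'(1)] tr(2) by simp
next
  case False
  then have "i \<le> K" using assms by simp
  then show ?thesis
  proof (cases rule: w_cases)
    case 1 then show ?thesis using assms(2) FD[OF m'(1)] by simp
  next
    case 2 then show ?thesis using side[OF assms(2)] FD[OF m'(1)] L0D[OF l(1)] by simp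
  next
    case (3 j) then show ?thesis using F_off[OF m'(1) 3(2)] assms(2) n4 by (simp add: K_def)
  qed
qed

lemma contact_L0: assumes "x \<in> L0" "x \<noteq> l" "i \<le> Suc K" "adj x (w i)" shows "i = 0"
proof (cases "i = Suc K")
  case True then show ?thesis using assms wN side[OF assms(4)] L0D[OF assms(1)] tr(2) by simp
next
  case False
  then have "i \<le> K" using assms by simp
  then show ?thesis
  proof (cases rule: w_cases)
    case 2 then show ?thesis using side[OF assms(4)] L0D[OF assms(1)] L0D[OF l(1)] by simp
  next
    case (3 j)
    have a: "adj (xs ! j) x" using assms(4) 3 sym by simp
    have "j \<noteq> 0" using E_leaf[OF xs0(1), of x l] a l xs0(2) L0D assms(1,2) by metis
    moreover have "j \<noteq> n - 1" using side[OF a] L0D[OF assms(1)] FD[OF xsl(1)] by auto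
    ultimately have "xs ! j \<in> C1" using xs_mid[of j] 3(2) by simp
    then show ?thesis using C1_L0[OF _ assms(1)] a by blast
  qed
qed

lemma contact_E: assumes "x \<in> E" "x \<noteq> hd xs" "i \<le> Suc K" "adj x (w i)"
  shows "i = 1 \<and> adj x l \<or> i = 3 \<and> \<not> adj x l"
proof -
  have xC: "x \<in> C" using ED[OF assms(1)] by blast
  have "i \<noteq> Suc K" using assms wN inner(2)[OF xC tr(1)] by auto
  then have "i \<le> K" using assms by simp
  then show ?thesis
  proof (cases rule: w_cases)
    case 1 then show ?thesis using assms inner(2)[OF xC p0M] by simp
  next
    case 2 then show ?thesis using assms(4) by simp
  next
    case (3 j) then show ?thesis using E_off[OF assms(1,2) 3(2)] assms(4) by simp
  qed
qed

lemma contact_C1: assumes "x \<in> C1" "i \<le> Suc K" "adj x (w i)" shows "2 \<le> i" "i \<le> K"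
proof -
  have xC: "x \<in> C" using C1D[OF assms(1)] by blast
  have "i \<noteq> Suc K" using assms wN inner(2)[OF xC tr(1)] by auto
  then show i: "i \<le> K" using assms by simp
  show "2 \<le> i" using i
  proof (cases rule: w_cases)
    case 1 then show ?thesis using assms inner(2)[OF xC p0M] by simp
  next
    case 2 then show ?thesis using assms C1_L0[OF assms(1) l(1)] by simp
  qed simp
qed

lemma U_cases: assumes "x \<in> U"
  obtains "x \<in> C1" "x \<notin> set xs" | "x \<in> L0" "x \<noteq> l" | "x \<in> E" "x \<noteq> hd xs" | "x = m'" | "x \<in> S2"
  using assms unfolding U_def by blast

lemma one_w: assumes x: "x \<in> U" "i \<le> Suc K" "j \<le> Suc K" "adj x (w i)" "adj x (w j)" shows "i = j"
  using x(1)
proof (cases rule: U_cases)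
  case 1
  have i: "2 \<le> i" "i \<le> K" and j: "2 \<le> j" "j \<le> K" using contact_C1[OF 1(1)] x by blast+
  define i' j' where "i' = i - 2" and "j' = j - 2"
  then have e: "i = Suc (Suc i')" "j = Suc (Suc j')" using i(1) j(1) by simp_all
  have "i' < n" "j' < n" using e i j by (simp_all add: K_def)
  then show ?thesis using off_one[OF 1, of i' j'] x w2 e by simp
next
  case 2 then show ?thesis using contact_L0[OF 2] x by blast
next
  case 3 then show ?thesis using contact_E[OF 3 x(2,4)] contact_E[OF 3 x(3,5)] by auto
next
  case 4 then show ?thesis using contact_m' x by blast
next
  case 5 then show ?thesis using contact_S2 x by blast
qed

lemma U_M: assumes "x \<in> U" "q \<in> M" "adj x q" shows "q = p0 \<and> x \<in> L0 \<or> q = p' \<and> x = m' \<or> x \<in> S2"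
  using assms(1)
proof (cases rule: U_cases)
  case 1 then show ?thesis using inner(2)[of x q] C1D assms by blast
next
  case 2 then show ?thesis using parent_unique[of x q p0] L0D[OF 2(1)] p0M assms by blast
next
  case 3 then show ?thesis using inner(2)[of x q] ED assms by blast
next
  case 4 then show ?thesis using m'_M assms by blast
next
  case 5 then show ?thesis by blast
qed

lemma U_in_M: "x \<in> U \<Longrightarrow> x \<in> M \<Longrightarrow> x \<in> S2"
  using C1D L0D ED FD[OF m'(1)] unfolding U_def by blast

lemma m'_ne: "m' \<noteq> last xs" using m'_M[OF p(1)] p(2) p_notin(7) by auto

lemma w_notU: assumes "i \<le> Suc K" shows "w i \<notin> U"
proof (cases "i = Suc K")
  case True then show ?thesis using wN tr(1,12) U_in_M by auto
next
  case False
  then have "i \<le> K" using assms by simp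
  then show ?thesis
  proof (cases rule: w_cases)
    case 1 then show ?thesis using U_in_M p0M p_notin by auto
  next
    case 2
    have "l \<notin> C" "l \<notin> M" "l \<in> L0" using L0D[OF l(1)] l(1) by blast+
    then show ?thesis using 2 C1D ED FD[OF m'(1)] tr(5) unfolding U_def by auto
  next
    case (3 j)
    have x: "xs ! j \<in> set xs" "xs ! j \<notin> M" using 3 xs_notM by auto
    have L: "xs ! j \<notin> L0" using xs_set x(1) ED L0D FD C1D by blast
    show ?thesis
    proof (cases "j = 0 \<or> j = n - 1")
      case False
      then have "0 < j" "Suc j < n" using 3(2) by linarith+
      then have "xs ! j \<in> C1" by (rule xs_mid)
      then show ?thesis using 3(3) x L C1D FD[OF m'(1)] tr(5) unfolding U_def by auto
    next
      case True
      then consider "xs ! j = hd xs" | "xs ! j = last xs" using xs0 xsl by metis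
      then show ?thesis
      proof cases
        case 1
        then show ?thesis using 3(3) x L xs_ends(1) FE_disj m'(1) tr(5) unfolding U_def by auto
      next
        case 2
        then show ?thesis using 3(3) x L xs_ends(2) FE_disj m'_ne tr(5) unfolding U_def by auto
      qed
    qed
  qed
qed

sublocale fr: frame adj s V w K S0 S1 R U t
proof unfold_locales
  have Rz: "q \<in> S0 \<or> q = z" "q \<noteq> p0" "q \<in> M" if "q \<in> R" for q using that R(1) tr(1,3) by blast+
  show "odd K" using n_even by (simp add: K_def)
  show "adj (w i) (w j) \<longleftrightarrow> i = Suc j \<or> j = Suc i" if "i \<le> K" "j \<le> K" for i j using path_w that .
  show "i = j" if "i \<le> K" "j \<le> K" "w i = w j" for i j using inj_w that .
  show "s (w i) = (odd i = t)" if "i \<le> K" for i using side_w that .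
  show "s (w (Suc K)) = t" using wN tr(2) by simp
  show "conn S1" "conn S0" "conn R" using tr R by blast+
  show "tch S1 (w K)" using tr(10) p(2) wK sym by (auto simp: tch_def)
  show "tch S1 (w (Suc K))" "tch S0 (w (Suc K))" using tr(13,14) wN by simp_all
  show "w i \<notin> S1" if "i \<le> Suc K" for i
    using that w_notM[of i] w0 wN tr(4,12) p_notin(5) by (cases "i = 0"; cases "i = Suc K") auto
  show "\<not> tch S1 (w i)" if "i < K" for i
  proof
    assume "tch S1 (w i)"
    then obtain q where q: "q \<in> S1" "adj q (w i)" by (auto simp: tch_def)
    then show False using w_M[of i q] that tr(4,9,16) w0 p_notin sym[of q p0] unfolding anti_def by (cases "i = 0") auto
  qed
  show "w 0 \<in> S0" using w0 tr(9) by simp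
  show "w i \<notin> S0" if "1 \<le> i" "i \<le> Suc K" for i
    using that w_notM[of i] wN tr(3,12) by (cases "i = Suc K") auto
  show "\<not> tch S0 (w i)" if "2 \<le> i" "i \<le> K" for i
  proof
    assume "tch S0 (w i)"
    then obtain q where q: "q \<in> S0" "adj q (w i)" by (auto simp: tch_def)
    then show False using w_M[of i q] that tr(3) p_notin by auto
  qed
  show "anti S0 S1" by (rule tr(16))
  show "w (Suc K) \<in> R" "tch R (w 0)" using R wN w0 by simp_all
  show "w i \<notin> R" if "i \<le> K" for i
    using that w_notM[of i] w0 Rz[of "w i"] by (cases "i = 0") auto
  show "\<not> tch R (w i)" if "1 \<le> i" "i \<le> K" for i
  proof
    assume "tch R (w i)"
    then obtain q where q: "q \<in> R" "adj q (w i)" by (auto simp: tch_def)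
    then have "q = p" using w_M[of i q] that Rz[of q] by auto
    then show False using Rz[OF q(1)] p_notin(1) tr(10,12) by blast
  qed
  show "R \<inter> S1 = {}" using Rz tr(12,16) unfolding anti_def by blast
  show "w i \<notin> U" if "i \<le> Suc K" for i using w_notU that .
  show "U \<inter> R = {}" using Rz U_in_M tr(12,17) unfolding anti_def by blast
  show "U \<inter> S0 = {}" using tr(3,17) U_in_M unfolding anti_def by blast
  show "anti U S1"
  proof -
    have "x \<notin> S1" if "x \<in> U" for x using that U_in_M tr(4,18) unfolding anti_def by blast
    moreover have "\<not> adj x q" if "x \<in> U" "q \<in> S1" for x q
    proof
      assume "adj x q"
      then have "q = p0 \<or> q = p' \<or> x \<in> S2" using U_M[of x q] that tr(4) by blast
      then show False using that p_notin tr(18) \<open>adj x q\<close> sym unfolding anti_def by blast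
    qed
    ultimately show ?thesis unfolding anti_def by blast
  qed
  show "y = w (Suc K)" if x: "x \<in> U" "y \<in> R" "adj x y" for x y
  proof (rule ccontr)
    assume "y \<noteq> w (Suc K)"
    then have y: "y \<in> S0" "y \<noteq> p0" using Rz[OF x(2)] wN by auto
    have "y = p' \<or> x \<in> S2" using U_M[of x y] x y tr(3) by blast
    then show False using y p_notin tr(17) x(3) sym unfolding anti_def by blast
  qed
  show "y = w 0" if x: "x \<in> U" "y \<in> S0" "adj x y" for x y
  proof (rule ccontr)
    assume "y \<noteq> w 0"
    then have "y \<noteq> p0" using w0 by simp
    then have "y = p' \<or> x \<in> S2" using U_M[of x y] x tr(3) by blast
    then show False using x p_notin tr(17) sym unfolding anti_def by blast
  qed
  show "i = j" if "x \<in> U" "i \<le> Suc K" "j \<le> Suc K" "adj x (w i)" "adj x (w j)" for x i j using one_w that .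
qed

lemma C1U: "y \<in> C1 \<Longrightarrow> y \<notin> set xs \<Longrightarrow> y \<in> U" by (simp add: U_def)
lemma S2U: "S2 \<subseteq> U" by (auto simp: U_def)
lemma m'U: "m' \<in> U" by (simp add: U_def)

lemma ct_S2: "fr.ct S2 = {Suc K}"
  using contact_S2 tr(15) wN by (auto simp: fr.ct_def tch_def)

lemma conn_tail: "conn (insert m' S2)"
  by (rule conn_insert[OF tr(8)]) (use tr(11) m'(3) sym in \<open>auto simp: tch_def\<close>)

lemma C1_xs: assumes "y \<in> C1" "y \<in> set xs" shows "\<exists>i. 3 \<le> i \<and> i < K \<and> y = w i"
proof -
  obtain j where j: "j < n" "y = xs ! j" using assms(2) by (auto simp: in_set_conv_nth)
  have "j \<noteq> 0" using j assms(1) xs0(1) FE_disj by metis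
  moreover have "Suc j < n" using xs_last_or[OF j(1)] j assms(1) xs_ends(2) FE_disj by metis
  ultimately show ?thesis using j w2[of j] by (intro exI[of _ "Suc (Suc j)"]) (auto simp: K_def)
qed

lemma xs_w: assumes "2 \<le> i" "i \<le> K" shows "w i \<in> set xs"
proof -
  have "i - 2 < n" using assms by (simp add: K_def)
  moreover have "Suc (Suc (i - 2)) = i" using assms by simp
  ultimately show ?thesis using w2[of "i - 2"] by simp
qed

text \<open>Walk inside \<open>C1\<close> towards the path up to the first vertex with a contact. A
  path vertex cannot come earlier, since its predecessor on the walk would have a contact.\<close>

lemma climb:
  assumes y: "y \<in> C1" "y \<notin> set xs"
  shows "\<exists>T i. T \<subseteq> C1 - set xs \<and> conn T \<and> y \<in> T \<and> 2 \<le> i \<and> i \<le> K \<and> fr.ct T = {i}"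
proof -
  have x1: "xs ! 1 \<in> C1" "xs ! 1 \<in> set xs" using xs_mid[of 1] n4 by simp_all
  obtain ys where ys: "walk ys" "set ys \<subseteq> C1" "hd ys = y" "last ys = xs ! 1"
    using conn_path[OF connC1 y(1) x1(1)] by blast
  have "ys \<noteq> []" using ys(1) by (simp add: walk_def)
  then have "\<exists>v\<in>set ys. v \<in> set xs \<or> fr.ct {v} \<noteq> {}" using ys(4) x1(2) last_in_set by metis
  then obtain us v vs where v: "ys = us @ v # vs" "v \<in> set xs \<or> fr.ct {v} \<noteq> {}"
      "\<And>u. u \<in> set us \<Longrightarrow> \<not> (u \<in> set xs \<or> fr.ct {u} \<noteq> {})"
    using split_list_first_prop[of ys "\<lambda>v. v \<in> set xs \<or> fr.ct {v} \<noteq> {}"] by blast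
  have vC: "v \<in> C1" "set us \<subseteq> C1" using ys(2) v(1) by auto
  have vn: "v \<notin> set xs"
  proof
    assume vx: "v \<in> set xs"
    have ne: "us \<noteq> []" using vx v(1) ys(3) y(2) by (cases us) auto
    obtain i where i: "i < K" "v = w i" using C1_xs[OF vC(1) vx] by blast
    have "adj (last us) v" using walk_snoc_adj ys(1) v(1) ne by blast
    then have "i \<in> fr.ct {last us}" using i by (intro fr.ctI) auto
    then show False using v(3)[of "last us"] ne by auto
  qed
  obtain i where i: "i \<in> fr.ct {v}" using v(2) vn by blast
  then have iv: "adj v (w i)" "i \<le> Suc K" using fr.ctD[OF i] by (auto simp: tch_def)
  have i2: "2 \<le> i" "i \<le> K" using contact_C1[OF vC(1) iv(2,1)] by blast+
  have ctv: "fr.ct {v} = {i}" using fr.ct_sing[OF C1U[OF vC(1) vn] iv(2,1)] .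
  have "fr.ct (set us) = {}"
  proof (rule ccontr)
    assume "fr.ct (set us) \<noteq> {}"
    then obtain k where k: "k \<in> fr.ct (set us)" by blast
    then obtain u where "u \<in> set us" "adj u (w k)" "k \<le> Suc K" using fr.ctD[OF k] by (auto simp: tch_def)
    then show False using v(3)[of u] fr.ctI[of u "{u}" k] by blast
  qed
  then have "fr.ct (insert v (set us)) = {i}" using fr.ct_insert[of v "set us"] ctv by simp
  then have "fr.ct (set (us @ [v])) = {i}" by simp
  moreover have "walk (us @ [v])" using walk_app1 ys(1) v(1) by blast
  then have "conn (set (us @ [v]))" by (rule conn_walk)
  moreover have "y \<in> set (us @ [v])" using ys(3) v(1) by (cases us) auto
  moreover have "set (us @ [v]) \<subseteq> C1 - set xs" using vC vn v(3) by auto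
  ultimately show ?thesis using i2 by blast
qed

lemma L0_S2_sep:
  assumes "x \<in> L0 \<union> E" "y \<in> insert m' S2" shows "\<not> adj x y"
proof
  assume a: "adj x y"
  show False
  proof (cases "y = m'")
    case True
    show False
    proof (cases "x \<in> E")
      case True then show False using E_F(1)[OF True m'(1)] a \<open>y = m'\<close> by blast
    next
      case False
      then show False using side[OF a] L0D[of x] FD[OF m'(1)] True assms(1) by blast
    qed
  next
    case False
    then have y: "y \<in> S2" "y \<in> M" using assms(2) tr(5) by blast+
    show False
    proof (cases "x \<in> E")
      case True then show False using inner(2)[of x y] ED[OF True] a y by blast
    next
      case False
      then have "x \<in> L0" using assms(1) by blast
      then have "y = p0" using parent_unique[of x y p0] L0D[of x] p0M a y by blast
      then show False using y p_notin by blast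
    qed
  qed
qed

sublocale fr: linked_frame adj s V w K S0 S1 R U t
proof unfold_locales
  fix T assume T: "conn T" "T \<subseteq> U" "fr.ct T = {0, Suc K}"
  \<comment> \<open>Contact \<open>0\<close> comes from \<open>L0\<close> and contact
    \<open>Suc K\<close> from \<open>S2\<close>. No edge joins \<open>L0 \<union> E\<close> to
    \<open>insert m' S2\<close>, so \<open>T\<close> has to pass through \<open>C1\<close>, from
    where \<open>climb\<close> leads to the path.\<close>
  have "\<exists>y\<in>T. y \<in> C1"
  proof (rule ccontr)
    assume n: "\<not> ?thesis"
    let ?A = "T \<inter> (L0 \<union> E)"
    have cov: "x \<in> L0 \<union> E \<or> x \<in> insert m' S2" if "x \<in> T" for x using that T(2) n unfolding U_def by blast
    obtain x0 where x0: "x0 \<in> T" "adj x0 (w 0)" using fr.ctD(1)[of 0 T] T(3) by (auto simp: tch_def)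
    have "K - 1 \<noteq> 0" "Suc K \<noteq> 0" using n4 xs_ne by (simp_all add: K_def)
    then have "x0 \<notin> insert m' S2" using contact_m'[of 0] contact_S2[of x0 0] x0(2) by auto
    then have A0: "x0 \<in> ?A" using cov x0(1) by blast
    obtain x1 where x1: "x1 \<in> T" "adj x1 (w (Suc K))" using fr.ctD(1)[of "Suc K" T] T(3) by (auto simp: tch_def)
    have "x1 \<notin> ?A"
    proof
      assume "x1 \<in> ?A"
      moreover have "x1 \<in> U" using x1 T(2) by blast
      ultimately have "x1 \<in> L0 - {l} \<or> x1 \<in> E - {hd xs}"
        using ED[of x1] L0D[of x1] C1D[of x1] FD[OF m'(1)] tr(5) unfolding U_def by blast
      then show False using contact_L0[of x1 "Suc K"] contact_E[of x1 "Suc K"] x1(2) n4 by (auto simp: K_def)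
    qed
    then have "?A \<subseteq> T" "?A \<noteq> {}" "?A \<noteq> T" using A0 x1 by blast+
    then obtain a b where ab: "a \<in> ?A" "b \<in> T - ?A" "adj a b"
      using T(1) unfolding conn_def by (elim conjE allE[of _ ?A]) auto
    then have "b \<in> insert m' S2" using cov by blast
    then show False using L0_S2_sep[of a b] ab by blast
  qed
  then obtain y where y: "y \<in> T" "y \<in> C1" by blast
  have yn: "y \<notin> set xs"
  proof
    assume "y \<in> set xs"
    then obtain i where "i < K" "y = w i" using C1_xs y by blast
    then show False using w_notU[of i] y T(2) by auto
  qed
  obtain T' i where "T' \<subseteq> C1 - set xs" "conn T'" "y \<in> T'" "2 \<le> i" "i \<le> K" "fr.ct T' = {i}"
    using climb[OF y(2) yn] by blast
  moreover then have "T' \<subseteq> U" using C1U by blast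
  ultimately show "\<exists>z\<in>T. \<exists>T' i. T' \<subseteq> U \<and> conn T' \<and> z \<in> T' \<and> 2 \<le> i \<and> i \<le> K \<and> fr.ct T' = {i}"
    using y by blast
next
  \<comment> \<open>For \<open>apex\<close>: \<open>m'\<close> and \<open>S2\<close> lead to the
    centre; the other end of the jump is a contact of \<open>m'\<close> or is reached by climbing
    from \<open>c\<close>.\<close>
  obtain c where c: "c \<in> C1" "adj m' c" using m'(2) by (rule bdE)
  have ctT: "fr.ct (insert m' S2) = fr.ct {m'} \<union> {Suc K}" using fr.ct_insert[of m' S2] ct_S2 by simp
  have TU: "insert m' S2 \<subseteq> U" using S2U m'U by blast
  show "\<exists>a. 2 \<le> a \<and> a \<le> K \<and> fr.jump a (Suc K)"
  proof (cases "fr.ct {m'} = {}")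
    case False
    then obtain i where i: "i \<in> fr.ct {m'}" by blast
    then have iv: "adj m' (w i)" "i \<le> Suc K" using fr.ctD[OF i] by (auto simp: tch_def)
    have "i = K - 1" using contact_m'[OF iv(2,1)] .
    moreover have "fr.ct {m'} = {i}" using fr.ct_sing[OF m'U iv(2,1)] .
    ultimately have "fr.jump (K - 1) (Suc K)"
      using fr.jump_of_set[OF conn_tail TU, of "K - 1" "Suc K"] ctT n4 by (auto simp: K_def)
    then show ?thesis using n4 by (intro exI[of _ "K - 1"]) (auto simp: K_def)
  next
    case True
    have cn: "c \<notin> set xs"
    proof
      assume "c \<in> set xs"
      then obtain i where "i < K" "c = w i" using C1_xs c by blast
      then show False using fr.ctI[of m' "{m'}" i] c(2) True by auto
    qed
    obtain T i where T: "T \<subseteq> C1 - set xs" "conn T" "c \<in> T" "2 \<le> i" "i \<le> K" "fr.ct T = {i}"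
      using climb[OF c(1) cn] by blast
    have "conn (T \<union> insert m' S2)" by (rule conn_Un[OF T(2) conn_tail]) (use T(3) c(2) sym in blast)
    moreover have "T \<union> insert m' S2 \<subseteq> U" using T(1) C1U TU by blast
    moreover have "fr.ct (T \<union> insert m' S2) = {i, Suc K}" unfolding fr.ct_Un ctT T(6) True by auto
    ultimately have "fr.jump i (Suc K)" using T(5) by (intro fr.jump_of_set) auto
    then show ?thesis using T(4,5) by blast
  qed
qed

lemma Kodd: "odd K" using n_even by (simp add: K_def)

lemma ct_tail0: "fr.ct (insert m' S2) = fr.ct {m'} \<union> {Suc K}" using fr.ct_insert[of m' S2] ct_S2 by simp
lemma tailU: "insert m' S2 \<subseteq> U" using S2U m'U by blast

text \<open>Its only possible contact is the even index \<open>K - 1\<close>, while jumps into the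
  centre start at odd indices.\<close>

lemma ct_m': "fr.ct {m'} = {}"
proof (rule ccontr)
  assume "fr.ct {m'} \<noteq> {}"
  then obtain i where i: "i \<in> fr.ct {m'}" by blast
  then have iv: "adj m' (w i)" "i \<le> Suc K" using fr.ctD[OF i] by (auto simp: tch_def)
  have "i = K - 1" using contact_m'[OF iv(2,1)] .
  moreover have "fr.ct {m'} = {i}" using fr.ct_sing[OF m'U iv(2,1)] .
  ultimately have "fr.jump (K - 1) (Suc K)"
    using fr.jump_of_set[OF conn_tail tailU, of "K - 1" "Suc K"] ct_tail0 n4 by (auto simp: K_def)
  then have "odd (K - 1)" using fr.jump_N_odd[of "K - 1"] n4 by (simp add: K_def)
  then show False using Kodd by simp
qed

lemma ct_tail: "fr.ct (insert m' S2) = {Suc K}" using ct_tail0 ct_m' by simp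

lemma m'_nb: assumes "c \<in> C1" "adj c m'" shows "c \<notin> set xs" "s c = (\<not> t)"
proof
  assume "c \<in> set xs"
  then obtain i where "i < K" "c = w i" using C1_xs assms by blast
  then show False using fr.ctI[of m' "{m'}" i] assms(2) sym ct_m' by auto
next
  show "s c = (\<not> t)" using side[OF assms(2)] FD[OF m'(1)] by blast
qed

text \<open>Prolonged by \<open>m'\<close> and \<open>S2\<close>, the set becomes a jump into the
  centre.\<close>

lemma to_apex:
  assumes "conn T" "T \<subseteq> U" "fr.ct T = {i}" "c \<in> T" "adj c m'" "2 \<le> i" "i \<le> K"
  shows "fr.r \<le> i" "odd i"
proof -
  have "conn (T \<union> insert m' S2)" by (rule conn_Un[OF assms(1) conn_tail]) (use assms(4,5) in blast)
  moreover have "T \<union> insert m' S2 \<subseteq> U" using assms(2) tailU by blast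
  moreover have "fr.ct (T \<union> insert m' S2) = {i, Suc K}" unfolding fr.ct_Un ct_tail assms(3) by auto
  ultimately have j: "fr.jump i (Suc K)" using assms(7) by (intro fr.jump_of_set) auto
  then show "fr.r \<le> i" "odd i" using fr.r_jump[OF j assms(6,7)] fr.jump_N_odd[OF j _ assms(7)] assms(6) by auto
qed

text \<open>\<open>Z\<close> lies beyond the cut point. A walk from \<open>y\<close> inside its
  component either runs into the path, at an index of at least \<open>r + 2\<close>, or reaches
  \<open>c\<close>, from where \<open>m'\<close> and \<open>S2\<close> lead to the centre. The
  second version stays off the centre, as \<open>barrier_one\<close> demands.\<close>

lemma escape:
  assumes c: "c \<in> Z" "adj c m'" and Z: "Z \<subseteq> C1"
    and gd: "\<And>y. y \<in> Z \<Longrightarrow> y \<in> set xs \<Longrightarrow> \<exists>i\<le>K. fr.r + 2 \<le> i \<and> y = w i"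
      "\<And>y. y \<in> Z \<Longrightarrow> y \<notin> set xs \<Longrightarrow> fr.ct {y} \<subseteq> {fr.r<..}"
    and y: "y \<in> cmp Z c" "y \<notin> set xs"
  shows "\<exists>X b. conn X \<and> X \<subseteq> U \<and> y \<in> X \<and> fr.ct X \<subseteq> {fr.r<..} \<and> b \<in> fr.ct X \<and> fr.r + 2 \<le> b"
    "cmp Z c \<inter> set xs \<noteq> {} \<Longrightarrow>
      \<exists>X. conn X \<and> X \<subseteq> U \<and> y \<in> X \<and> fr.ct X \<subseteq> {fr.r<..K} \<and> fr.ct X \<noteq> {}"
proof -
  have cZ: "conn (cmp Z c)" by (rule cmp_conn[OF c(1)])
  have sub: "cmp Z c \<subseteq> Z" by (rule cmp_sub)
  have ctset: "fr.ct X \<subseteq> {fr.r<..} \<and> fr.ct X \<subseteq> {..K}" "X \<subseteq> U" if X: "X \<subseteq> Z - set xs" for X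
  proof -
    have "k > fr.r \<and> k \<le> K" if k: "k \<in> fr.ct X" for k
    proof -
      obtain u where u: "u \<in> X" "adj u (w k)" "k \<le> Suc K" using fr.ctD[OF k] by (auto simp: tch_def)
      have "k \<in> fr.ct {u}" using fr.ctI[of u "{u}" k] u by blast
      moreover have "k \<le> K" using contact_C1[of u k] u X Z by blast
      ultimately show ?thesis using gd(2)[of u] u(1) X by auto
    qed
    then show "fr.ct X \<subseteq> {fr.r<..} \<and> fr.ct X \<subseteq> {..K}" by auto
    show "X \<subseteq> U" using X Z C1U by blast
  qed
  have via: "\<exists>X b. conn X \<and> X \<subseteq> Z - set xs \<and> y \<in> X \<and> b \<in> fr.ct X \<and> fr.r + 2 \<le> b \<and> b \<le> K"
    if ys: "walk ys" "set ys \<subseteq> cmp Z c" "hd ys = y" "\<exists>v\<in>set ys. v \<in> set xs" for ys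
  proof -
    obtain us v vs where v: "ys = us @ v # vs" "v \<in> set xs" "\<And>u. u \<in> set us \<Longrightarrow> u \<notin> set xs"
      using split_list_first_prop[OF ys(4)] by blast
    have ne: "us \<noteq> []" using v(1,2) ys(3) y(2) by (cases us) auto
    have vZ: "v \<in> Z" "set us \<subseteq> Z" using ys(2) v(1) sub by auto
    obtain i where i: "i \<le> K" "fr.r + 2 \<le> i" "v = w i" using gd(1)[OF vZ(1) v(2)] by blast
    have "adj (last us) v" using walk_snoc_adj ys(1) v(1) ne by blast
    then have "i \<in> fr.ct (set us)" using i ne by (intro fr.ctI[of "last us"]) auto
    moreover have "walk us" using walk_app3 ys(1) v(1) ne by blast
    then have "conn (set us)" by (rule conn_walk)
    moreover have "y \<in> set us" using ne v(1) ys(3) by (cases us) auto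
    ultimately show ?thesis using i vZ(2) v(3) by blast
  qed
  show "\<exists>X b. conn X \<and> X \<subseteq> U \<and> y \<in> X \<and> fr.ct X \<subseteq> {fr.r<..} \<and> b \<in> fr.ct X \<and> fr.r + 2 \<le> b"
  proof -
    obtain ys where ys: "walk ys" "set ys \<subseteq> cmp Z c" "hd ys = y" "last ys = c"
      using conn_path[OF cZ y(1) cmp_self[OF c(1)]] by blast
    show ?thesis
    proof (cases "\<exists>v\<in>set ys. v \<in> set xs")
      case True
      then obtain X b where "conn X" "X \<subseteq> Z - set xs" "y \<in> X" "b \<in> fr.ct X" "fr.r + 2 \<le> b" using via[OF ys(1-3)] by blast
      then show ?thesis using ctset[of X] by blast
    next
      case False
      then have X: "set ys \<subseteq> Z - set xs" using ys(2) sub by blast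
      have ne: "ys \<noteq> []" using ys(1) by (simp add: walk_def)
      let ?X = "set ys \<union> insert m' S2"
      have cy: "c \<in> set ys" "y \<in> set ys" using ys(3,4) ne last_in_set hd_in_set by blast+
      have "conn ?X" by (rule conn_Un[OF conn_walk[OF ys(1)] conn_tail]) (use cy c(2) in blast)
      moreover have "?X \<subseteq> U" using ctset(2)[OF X] tailU by blast
      moreover have e: "fr.ct ?X = fr.ct (set ys) \<union> {Suc K}" unfolding fr.ct_Un ct_tail by simp
      then have "fr.ct ?X \<subseteq> {fr.r<..}" using ctset(1)[OF X] fr.r_less by auto
      moreover have "Suc K \<in> fr.ct ?X" "fr.r + 2 \<le> Suc K" using e fr.r_less by auto
      ultimately show ?thesis using cy by blast
    qed
  qed
  show "\<exists>X. conn X \<and> X \<subseteq> U \<and> y \<in> X \<and> fr.ct X \<subseteq> {fr.r<..K} \<and> fr.ct X \<noteq> {}"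
    if ne: "cmp Z c \<inter> set xs \<noteq> {}"
  proof -
    obtain v where v: "v \<in> cmp Z c" "v \<in> set xs" using ne by blast
    obtain ys where ys: "walk ys" "set ys \<subseteq> cmp Z c" "hd ys = y" "last ys = v"
      using conn_path[OF cZ y(1) v(1)] by blast
    have "ys \<noteq> []" using ys(1) by (simp add: walk_def)
    then have "\<exists>v\<in>set ys. v \<in> set xs" using ys(4) v(2) last_in_set by blast
    then obtain X b where X: "conn X" "X \<subseteq> Z - set xs" "y \<in> X" "b \<in> fr.ct X" using via[OF ys(1-3)] by blast
    have "fr.ct X \<subseteq> {fr.r<..K}" using ctset(1)[OF X(2)] by auto
    then show ?thesis using X ctset(2)[OF X(2)] by blast
  qed
qed

text \<open>Such an \<open>e\<close> leads below the cut point, either directly by a contact, which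
  is not 1, or through its own leaf \<open>l'\<close> to \<open>w 0\<close>;
  \<open>barrier_low\<close> excludes both.\<close>

lemma other_class:
  assumes e: "e \<in> E" "\<not> adj e l" and X: "conn X" "X \<subseteq> U" "tch X e" "fr.ct X \<subseteq> {fr.r<..}" "b \<in> fr.ct X" "fr.r + 2 \<le> b"
  shows False
proof -
  have ne: "e \<noteq> hd xs" using e(2) l(2) by auto
  have eU: "e \<in> U" using e(1) ne by (simp add: U_def)
  show False
  proof (cases "\<exists>i\<le>Suc K. i < fr.r \<and> adj e (w i)")
    case True
    then obtain i where i: "i \<le> Suc K" "i < fr.r" "adj e (w i)" by blast
    then have "i \<noteq> 1" using contact_E[OF e(1) ne i(1,3)] e(2) by auto
    then show False using fr.barrier_low[OF eU i(3,2) _ X] by blast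
  next
    case False
    obtain l' where l': "l' \<in> L0" "adj e l'" using e(1) by (rule E_L0)
    have ll: "l' \<noteq> l" using l' e(2) by auto
    have l'U: "l' \<in> U" using l' ll by (simp add: U_def)
    have cte: "fr.ct {e} \<subseteq> {fr.r<..}"
    proof
      fix k assume k: "k \<in> fr.ct {e}"
      then have a: "adj e (w k)" "k \<le> Suc K" using fr.ctD[OF k] by (auto simp: tch_def)
      then have "k = 3" using contact_E[OF e(1) ne a(2,1)] e(2) by auto
      moreover have "\<not> k < fr.r" using False a by blast
      moreover have "fr.r \<noteq> 3" using fr.r_even by auto
      ultimately show "k \<in> {fr.r<..}" by auto
    qed
    let ?X = "insert e X"
    show False
    proof (rule fr.barrier_low[OF l'U, of 0 ?X b])
      show "adj l' (w 0)" using L0D[OF l'(1)] w0 by simp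
      show "0 < fr.r" using fr.r_props(1) by simp
      show "conn ?X" by (rule conn_insert[OF X(1,3)])
      show "?X \<subseteq> U" using eU X(2) by blast
      show "tch ?X l'" using l'(2) by (auto simp: tch_def)
      show "fr.ct ?X \<subseteq> {fr.r<..}" "b \<in> fr.ct ?X" using fr.ct_insert[of e X] cte X(4,5) by auto
    qed (use X in simp_all)
  qed
qed

lemma w2_hd: "w 2 = hd xs" using w2[of 0] n0 xs0(2) by (simp add: numeral_2_eq_2)

text \<open>The cut point is \<open>w 2 = hd xs\<close>, a neighbour of \<open>l\<close>, so the
  pattern is \<open>one_leaf\<close>. Boundary vertices in \<open>E\<close> are not adjacent to
  \<open>l\<close> and are excluded by \<open>other_class\<close>.\<close>

lemma r_two: assumes r2: "fr.r = 2" shows False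
proof -
  obtain c where c: "c \<in> C1" "adj m' c" "adj c m'" using m'(2) by (rule bdE)
  let ?Z = "{y\<in>C1. \<forall>e\<in>nbC l. \<not> adj e y}"
  let ?C = "cmp ?Z c"
  have snb: "s e = (\<not> t)" if "e \<in> nbC l" for e using side[OF nbCD(2)[OF that]] L0D[OF l(1)] by blast
  have hl: "hd xs \<in> nbC l" using nbCI[of "hd xs" l] ED[OF xs_ends(1)] l(2) by blast
  have cZ: "c \<in> ?Z" using c(1) m'_nb(2)[OF c(1,3)] snb side by blast
  have CZ: "?C \<subseteq> ?Z" by (rule cmp_sub)
  have g1: "\<exists>i\<le>K. fr.r + 2 \<le> i \<and> y = w i" if y: "y \<in> ?Z" "y \<in> set xs" for y
  proof -
    obtain i where i: "3 \<le> i" "i < K" "y = w i" using C1_xs[of y] y by blast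
    have "i \<noteq> 3"
    proof
      assume "i = 3"
      then have "adj (w 2) y" using path_w[of 2 3] i by simp
      then show False using y(1) hl w2_hd by auto
    qed
    then show ?thesis using i r2 by (intro exI[of _ i]) auto
  qed
  have g2: "fr.ct {y} \<subseteq> {fr.r<..}" if y: "y \<in> ?Z" "y \<notin> set xs" for y
  proof
    fix k assume k: "k \<in> fr.ct {y}"
    then have a: "adj y (w k)" "k \<le> Suc K" using fr.ctD[OF k] by (auto simp: tch_def)
    have "2 \<le> k" using contact_C1[of y k] y a by blast
    moreover have "k \<noteq> 2" using a(1) sym y(1) hl w2_hd by auto
    ultimately show "k \<in> {fr.r<..}" using r2 by auto
  qed
  have ZC: "?Z \<subseteq> C1" by blast
  show False
  proof (rule one_leaf[OF l(1)])
    show "?C \<subseteq> C1" using CZ by blast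
    show "conn ?C" by (rule cmp_conn[OF cZ])
    show "\<not> adj e y" if "y \<in> ?C" "e \<in> nbC l" for y e using that CZ by blast
    show "z' \<in> F \<or> (z' \<in> C1 \<and> (\<exists>e\<in>nbC l. adj z' e))" if z: "z' \<in> bd ?C" for z'
    proof -
      obtain y where y: "y \<in> ?C" "adj z' y" "adj y z'" using z by (rule bdE)
      have zZ: "z' \<notin> ?Z" using bd_cmp[OF z] .
      have "z' \<notin> E"
      proof
        assume zE: "z' \<in> E"
        have nl: "\<not> adj z' l" using nbCI[of z' l] ED[OF zE] y CZ by blast
        then have ne: "z' \<noteq> hd xs" using l(2) by auto
        have yx: "y \<notin> set xs"
        proof
          assume "y \<in> set xs"
          then obtain i where i: "i \<le> K" "fr.r + 2 \<le> i" "y = w i" using g1[of y] y CZ by blast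
          then have "i = 1 \<or> i = 3" using contact_E[OF zE ne, of i] y(2) by auto
          then show False using i r2 by auto
        qed
        obtain X b where X: "conn X" "X \<subseteq> U" "y \<in> X" "fr.ct X \<subseteq> {fr.r<..}" "b \<in> fr.ct X" "fr.r + 2 \<le> b"
          using escape(1)[OF cZ c(3) ZC g1 g2 y(1) yx] by blast
        have "tch X z'" using X(3) y(3) by (auto simp: tch_def)
        then show False using other_class[OF zE nl X(1,2) _ X(4-6)] by blast
      qed
      then show ?thesis using sub_bd[of ?C z'] z CZ zZ sym by blast
    qed
  qed
qed

text \<open>The pattern is \<open>long_path\<close>: \<open>l\<close> and the path up to the cut
  point \<open>w r\<close> join \<open>M\<close>, and \<open>w r\<close> becomes the new parent. By
  parity, \<open>4 \<le> r\<close> and \<open>r + 3 \<le> K\<close>.\<close>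

lemma r_mid: assumes r: "fr.r \<noteq> 2" "fr.r \<noteq> K - 1" shows False
proof -
  have r4: "4 \<le> fr.r" 
  proof -
    have "even k \<Longrightarrow> 2 \<le> k \<Longrightarrow> k \<noteq> 2 \<Longrightarrow> 4 \<le> k" for k :: nat by presburger
    then show ?thesis using fr.r_props(1) fr.r_even r(1) by blast
  qed
  have rK: "fr.r + 3 \<le> K" 
  proof -
    have "k < j \<Longrightarrow> even k \<Longrightarrow> odd j \<Longrightarrow> k \<noteq> j - 1 \<Longrightarrow> k + 3 \<le> j" for k j :: nat by presburger
    then show ?thesis using fr.r_less fr.r_even Kodd r(2) by blast
  qed
  obtain c where c: "c \<in> C1" "adj m' c" "adj c m'" using m'(2) by (rule bdE)
  note cn = m'_nb[OF c(1,3)]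
  let ?u = "w fr.r"
  let ?Z = "{y\<in>C1. y \<noteq> ?u \<and> \<not> adj y ?u}"
  \<comment> \<open>\<open>?Z\<close> only removes \<open>?u\<close> and its neighbours, whereas
    \<open>G0\<close> demands that everything lies beyond the cut point. The two have the same
    component of \<open>c\<close>, since a step out of \<open>G0\<close> inside \<open>?Z\<close>
    would contradict \<open>barrier_low\<close>.\<close>
  define G0 where "G0 = {y\<in>?Z. (y \<in> set xs \<longrightarrow> (\<exists>i\<le>K. fr.r + 2 \<le> i \<and> y = w i)) \<and> (y \<notin> set xs \<longrightarrow> fr.ct {y} \<subseteq> {fr.r<..})}"
  have ux: "?u \<in> set xs" using xs_w[of fr.r] r4 rK by simp
  have su: "s ?u = (\<not> t)" using side_w[of fr.r] fr.r_even rK by simp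
  have ctc: "fr.ct {c} \<subseteq> {fr.r<..}"
  proof
    fix k assume k: "k \<in> fr.ct {c}"
    then have a: "adj c (w k)" "k \<le> Suc K" using fr.ctD[OF k] by (auto simp: tch_def)
    have k2: "2 \<le> k" "k \<le> K" using contact_C1[OF c(1) a(2,1)] by blast+
    have cU: "c \<in> U" using C1U[OF c(1) cn(1)] .
    have "fr.r \<le> k" "odd k" using to_apex[of "{c}" k c] fr.ct_sing[OF cU a(2,1)] cU c(3) k2 by auto
    then show "k \<in> {fr.r<..}" using fr.r_even by (cases "k = fr.r") auto
  qed
  have cG: "c \<in> G0" using c(1) cn ctc su side[of c ?u] ux unfolding G0_def by auto
  have G0D: "y \<in> C1" "y \<noteq> ?u" "\<not> adj y ?u" "y \<in> set xs \<Longrightarrow> \<exists>i\<le>K. fr.r + 2 \<le> i \<and> y = w i"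
    "y \<notin> set xs \<Longrightarrow> fr.ct {y} \<subseteq> {fr.r<..}" if "y \<in> G0" for y using that unfolding G0_def by blast+
  have G0C: "G0 \<subseteq> C1" using G0D(1) by blast
  let ?G = "cmp G0 c"
  have GG: "?G \<subseteq> G0" by (rule cmp_sub)
  have esc1: "\<exists>X b. conn X \<and> X \<subseteq> U \<and> y \<in> X \<and> fr.ct X \<subseteq> {fr.r<..} \<and> b \<in> fr.ct X \<and> fr.r + 2 \<le> b"
    if "y \<in> ?G" "y \<notin> set xs" for y
    by (rule escape(1)[OF cG c(3) G0C _ _ that]) (use G0D(4,5) in blast)+
  have esc2: "\<exists>X. conn X \<and> X \<subseteq> U \<and> y \<in> X \<and> fr.ct X \<subseteq> {fr.r<..K} \<and> fr.ct X \<noteq> {}"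
    if "y \<in> ?G" "y \<notin> set xs" "?G \<inter> set xs \<noteq> {}" for y
    by (rule escape(2)[OF cG c(3) G0C _ _ that]) (use G0D(4,5) in blast)+
  have lowadj: "\<not> adj v (w i)" if vi: "v \<in> G0" "i \<le> fr.r" for v i
  proof
    assume a: "adj v (w i)"
    show False
    proof (cases "v \<in> set xs")
      case True
      then obtain j where "j \<le> K" "fr.r + 2 \<le> j" "v = w j" using G0D(4)[OF vi(1)] by blast
      then show False using path_w[of j i] a vi(2) by auto
    next
      case False
      have "i \<in> fr.ct {v}" using fr.ctI[of v "{v}" i] a vi(2) rK by auto
      then show False using G0D(5)[OF vi(1) False] vi(2) by auto
    qed
  qed
  have CG: "cmp ?Z c \<subseteq> ?G"
  proof (rule cmp_least)
    show "c \<in> ?G" by (rule cmp_self[OF cG])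
    show "?G \<subseteq> ?Z" using GG unfolding G0_def by blast
    fix v u assume v: "v \<in> ?G" and u: "u \<in> ?Z" and a: "adj v u"
    have vG: "v \<in> G0" using v GG by blast
    have "u \<in> G0"
    proof (rule ccontr)
      assume nu: "u \<notin> G0"
      show False
      proof (cases "u \<in> set xs")
        case True
        then obtain i where i: "3 \<le> i" "i < K" "u = w i" using C1_xs[of u] u by blast
        have "\<not> fr.r + 2 \<le> i"
        proof
          assume "fr.r + 2 \<le> i"
          then have "\<exists>i\<le>K. fr.r + 2 \<le> i \<and> u = w i" using i(2,3) by (intro exI[of _ i]) simp
          then show False using nu u True unfolding G0_def by blast
        qed
        moreover have "i \<noteq> Suc fr.r" using u i path_w[of i fr.r] rK by auto
        ultimately have "i \<le> fr.r" by linarith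
        then show False using lowadj[OF vG] a i by blast
      next
        case False
        then have "\<not> fr.ct {u} \<subseteq> {fr.r<..}" using nu u unfolding G0_def by blast
        then obtain i where i: "i \<in> fr.ct {u}" "i \<notin> {fr.r<..}" by blast
        then have i': "i \<le> fr.r" by simp
        have iv: "adj u (w i)" "i \<le> Suc K" using fr.ctD[OF i(1)] by (auto simp: tch_def)
        have uC: "u \<in> C1" using u by blast
        have uU: "u \<in> U" by (rule C1U[OF uC False])
        have "i \<noteq> fr.r" using u iv by auto
        then have ir: "i < fr.r" using i' by simp
        have i1: "i \<noteq> 1" using contact_C1[OF uC iv(2,1)] by simp
        have vx: "v \<notin> set xs"
        proof
          assume "v \<in> set xs"
          then obtain j where j: "j \<le> K" "fr.r + 2 \<le> j" "v = w j" using G0D(4)[OF vG] by blast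
          then have "i = j" using one_w[OF uU iv(2), of j] iv(1) sym[OF a] by simp
          then show False using ir j by simp
        qed
        obtain X b where X: "conn X" "X \<subseteq> U" "v \<in> X" "fr.ct X \<subseteq> {fr.r<..}" "b \<in> fr.ct X" "fr.r + 2 \<le> b"
          using esc1[OF v vx] by blast
        have "tch X u" using X(3) a by (auto simp: tch_def)
        then show False using fr.barrier_low[OF uU iv(1) ir i1 X(1,2) _ X(4-6)] by blast
      qed
    qed
    then show "u \<in> ?G" using cmp_step[OF v _ a] by blast
  qed
  let ?C = "cmp ?Z c"
  have cZ: "c \<in> ?Z" using cG unfolding G0_def by blast
  have CG0: "?C \<subseteq> G0" using CG GG by blast
  have CC1: "?C \<subseteq> C1" using CG0 G0C by blast
  let ?W = "w ` {2..fr.r}"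
  show False
  proof (rule long_path[OF l(1), of ?W ?u ?C])
    show "?W \<subseteq> C"
    proof
      fix x assume "x \<in> ?W"
      then obtain i where i: "2 \<le> i" "i \<le> fr.r" "x = w i" by auto
      have "Suc (Suc (i - 2)) = i" "Suc (i - 2) < n" "i - 2 < n" using i rK by (auto simp: K_def)
      then show "x \<in> C" using w2[of "i - 2"] xs_C[of "i - 2"] i by simp
    qed
    have "{1..fr.r} = insert 1 {2..fr.r}" using r4 by auto
    then have "w ` {1..fr.r} = insert l ?W" using w1 by simp
    then show "conn (insert l ?W)" using fr.conn_seg[of 1 fr.r] r4 rK by simp
    show "?u \<in> ?W" using r4 by simp
    show "s ?u \<noteq> t" using su by simp
    show "?C \<subseteq> C1" by (rule CC1)
    show "conn ?C" by (rule cmp_conn[OF cZ])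
    have "w i \<notin> ?C" if "2 \<le> i" "i \<le> fr.r" for i
    proof
      assume "w i \<in> ?C"
      then have iG: "w i \<in> G0" using CG0 by blast
      have "w i \<in> set xs" using xs_w that rK by simp
      then obtain j where "j \<le> K" "fr.r + 2 \<le> j" "w i = w j" using G0D(4)[OF iG] by blast
      then show False using inj_w[of i j] that rK by simp
    qed
    moreover have "\<not> adj (w i) y" if "i \<le> fr.r" "y \<in> ?C" for i y using lowadj[of y i] that CG0 sym by blast
    ultimately show "anti ?W ?C" unfolding anti_def by auto
    show "(z' \<in> F \<and> (\<forall>e\<in>?W. \<not> adj z' e)) \<or> (z' \<in> C1 \<and> adj z' ?u \<and> (\<forall>e\<in>?W. adj z' e \<longrightarrow> e = ?u))"
      if zb: "z' \<in> bd ?C" for z'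
    proof -
      obtain y where y: "y \<in> ?C" "adj z' y" "adj y z'" using zb by (rule bdE)
      have yG: "y \<in> G0" "y \<in> ?G" using y(1) CG0 CG by blast+
      have zZ: "z' \<notin> ?Z" using bd_cmp[OF zb] .
      have zC1: "adj z' ?u \<and> (\<forall>e\<in>?W. adj z' e \<longrightarrow> e = ?u)" if z1: "z' \<in> C1"
      proof -
        have "z' \<noteq> ?u" using lowadj[OF yG(1), of fr.r] y(3) by auto
        then have zu: "adj z' ?u" using zZ z1 by blast
        have iu: "i = fr.r" if i: "2 \<le> i" "i \<le> fr.r" "adj z' (w i)" for i
        proof (cases "z' \<in> set xs")
          case False
          then show ?thesis using one_w[OF C1U[OF z1 False], of i fr.r] i zu rK by simp
        next
          case True
          then obtain k where k: "3 \<le> k" "k < K" "z' = w k" using C1_xs[OF z1] by blast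
          have "\<not> k \<le> fr.r" using lowadj[OF yG(1), of k] y(3) k by auto
          then have "k = Suc fr.r" using path_w[of k fr.r] zu k rK by auto
          then show ?thesis using path_w[of k i] i k rK by auto
        qed
        show ?thesis
        proof (intro conjI ballI impI)
          fix e assume e: "e \<in> ?W" "adj z' e"
          obtain i where i: "2 \<le> i" "i \<le> fr.r" "e = w i" using e(1) by auto
          then have "i = fr.r" using iu e(2) by blast
          then show "e = ?u" using i(3) by blast
        qed (rule zu)
      qed
      have zE: False if zE: "z' \<in> E"
      proof -
        have ne: "z' \<noteq> hd xs" using lowadj[OF yG(1), of 2] y(3) w2_hd r4 by auto
        have yx: "y \<notin> set xs"
        proof
          assume "y \<in> set xs"
          then obtain i where i: "i \<le> K" "fr.r + 2 \<le> i" "y = w i" using G0D(4)[OF yG(1)] by blast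
          then have "i = 1 \<or> i = 3" using contact_E[OF zE ne, of i] y(2) by auto
          then show False using i r4 by auto
        qed
        show False
        proof (cases "adj z' l")
          case False
          obtain X b where X: "conn X" "X \<subseteq> U" "y \<in> X" "fr.ct X \<subseteq> {fr.r<..}" "b \<in> fr.ct X" "fr.r + 2 \<le> b"
            using esc1[OF yG(2) yx] by blast
          have "tch X z'" using X(3) y(3) by (auto simp: tch_def)
          then show False using other_class[OF zE False X(1,2) _ X(4-6)] by blast
        next
          case True
          have zU: "z' \<in> U" using zE ne by (simp add: U_def)
          have a1: "adj z' (w 1)" using True w1 by simp
          \<comment> \<open>A neighbour of \<open>l\<close> has contact 1, so
            \<open>barrier_one\<close> is used, and the centre must be avoided. If the component
            misses the path, \<open>escape\<close> does not help, and a contact is found by climbing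
            from \<open>c\<close>: by \<open>to_apex\<close> it is odd and beyond \<open>r\<close>,
            so the climb stays in \<open>G0\<close>.\<close>
          have "\<exists>X. conn X \<and> X \<subseteq> U \<and> y \<in> X \<and> fr.ct X \<subseteq> {fr.r<..K} \<and> fr.ct X \<noteq> {}"
          proof (cases "?G \<inter> set xs = {}")
            case False
            show ?thesis by (rule esc2[OF yG(2) yx False])
          next
            case True
            have GU: "?G \<subseteq> U" using True GG G0C C1U by blast
            have ctG: "k > fr.r \<and> k \<le> K" if k: "k \<in> fr.ct ?G" for k
            proof -
              obtain v where v: "v \<in> ?G" "adj v (w k)" "k \<le> Suc K" using fr.ctD[OF k] by (auto simp: tch_def)
              have "k \<in> fr.ct {v}" using fr.ctI[of v "{v}" k] v by blast
              moreover have "v \<in> G0" "v \<notin> set xs" using v GG True by blast+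
              ultimately show ?thesis using G0D(1,5)[of v] contact_C1[of v k] v(2,3) by auto
            qed
            obtain T i where T: "T \<subseteq> C1 - set xs" "conn T" "c \<in> T" "2 \<le> i" "i \<le> K" "fr.ct T = {i}"
              using climb[OF c(1) cn(1)] by blast
            have TU: "T \<subseteq> U" using T(1) C1U by blast
            have i: "fr.r \<le> i" "odd i" using to_apex[OF T(2) TU T(6,3) c(3) T(4,5)] by blast+
            then have ir: "fr.r < i" using fr.r_even by (cases "i = fr.r") auto
            have "T \<subseteq> G0"
            proof
              fix v assume v: "v \<in> T"
              have ctv: "fr.ct {v} \<subseteq> {i}" using v T(6) by (auto simp: fr.ct_def tch_def)
              then have "\<not> adj v ?u" using fr.ctI[of v "{v}" fr.r] ir rK by auto
              then show "v \<in> G0" using v T(1) ctv ir ux unfolding G0_def by auto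
            qed
            then have "T \<subseteq> ?G" using cmp_max[OF T(2,3)] by blast
            moreover obtain v where "v \<in> T" "adj v (w i)" using fr.ctD(1)[of i T] T(6) by (auto simp: tch_def)
            ultimately have "i \<in> fr.ct ?G" using T(5) by (intro fr.ctI[of v]) auto
            then have "fr.ct ?G \<noteq> {}" by blast
            moreover have "fr.ct ?G \<subseteq> {fr.r<..K}" using ctG by auto
            moreover have "conn ?G" by (rule cmp_conn[OF cG])
            ultimately show ?thesis using GU yG(2) by blast
          qed
          then obtain X where X: "conn X" "X \<subseteq> U" "y \<in> X" "fr.ct X \<subseteq> {fr.r<..K}" "fr.ct X \<noteq> {}" by blast
          have "tch X z'" using X(3) y(3) by (auto simp: tch_def)
          then show False using fr.barrier_one[OF r(1) zU a1 X(1,2) _ X(4,5)] by blast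
        qed
      qed
      \<comment> \<open>Leaves in \<open>F\<close> see the inside of the path only at index
        \<open>K - 1\<close>, which lies beyond \<open>r\<close>.\<close>
      have zF: "\<forall>e\<in>?W. \<not> adj z' e" if zF: "z' \<in> F"
      proof
        fix e assume "e \<in> ?W"
        then obtain i where i: "2 \<le> i" "i \<le> fr.r" "e = w i" by auto
        have j: "Suc (Suc (i - 2)) = i" "i - 2 < n" using i rK by (auto simp: K_def)
        show "\<not> adj z' e"
        proof
          assume "adj z' e"
          then have "i - 2 = n - 2" using F_off[OF zF j(2)] w2[OF j(2)] j(1) i(3) by simp
          then show False using i rK n4 by (simp add: K_def)
        qed
      qed
      show ?thesis using sub_bd[OF CC1 zb] zC1 zE zF by blast
    qed
  qed
qed

text \<open>By \<open>to_apex\<close> a contact reached from \<open>y\<close> is odd and at least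
  \<open>K - 1\<close>, so it is \<open>K\<close>; but \<open>w K\<close> is a leaf of
  \<open>p\<close>, which \<open>Z2\<close> avoids. So the component of \<open>y\<close> has no
  contacts and joins \<open>e\<close> to the centre by \<open>m'\<close> and \<open>S2\<close>. This
  gives a jump into the centre from index 3, too low for \<open>r_jump\<close>, or through the leaf
  of \<open>e\<close> from index 0.\<close>

lemma r_top:
  assumes r: "fr.r = K - 1"
    and Z2: "Z2 = {y\<in>C1. \<forall>b\<in>bd C. adj b p \<longrightarrow> \<not> adj y b}"
    and y: "y \<in> Z2" "adj y m'" and e: "e \<in> E" "\<not> adj e l" and c: "c \<in> cmp Z2 y" "adj e c"
  shows False
proof -
  have ZC: "Z2 \<subseteq> C1" using Z2 by blast
  have noK: "\<not> adj u (w K)" if "u \<in> Z2" for u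
    using that Z2 wK FD[OF xs_ends(2)] p(2) by auto
  define G where "G = {v\<in>Z2. v \<notin> set xs \<and> fr.ct {v} = {}}"
  have GC: "G \<subseteq> C1 - set xs" "G \<subseteq> Z2" using ZC unfolding G_def by blast+
  have GU: "G \<subseteq> U" using GC C1U by blast
  have ctG: "fr.ct T = {}" if "T \<subseteq> G" for T
  proof (rule ccontr)
    assume "fr.ct T \<noteq> {}"
    then obtain k where k: "k \<in> fr.ct T" by blast
    then obtain u where "u \<in> T" "adj u (w k)" "k \<le> Suc K" using fr.ctD[OF k] by (auto simp: tch_def)
    then show False using that fr.ctI[of u "{u}" k] unfolding G_def by blast
  qed
  have nocon: False if T: "conn T" "T \<subseteq> insert u G" "y \<in> T" "u \<in> T" and u: "u \<in> Z2" "u \<notin> set xs" "fr.ct {u} \<noteq> {}" for T u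
  proof -
    obtain i where i: "i \<in> fr.ct {u}" using u(3) by blast
    then have iv: "adj u (w i)" "i \<le> Suc K" using fr.ctD[OF i] by (auto simp: tch_def)
    have uU: "u \<in> U" using C1U u(1,2) ZC by blast
    have i2: "2 \<le> i" "i \<le> K" using contact_C1[of u i] u(1) ZC iv by blast+
    have "fr.ct T = fr.ct {u} \<union> fr.ct (T - {u})" using fr.ct_insert[of u "T - {u}"] T(4) insert_Diff by metis
    also have "\<dots> = {i}" using fr.ct_sing[OF uU iv(2,1)] ctG[of "T - {u}"] T(2) by blast
    finally have "fr.r \<le> i" "odd i" using to_apex[OF T(1) _ _ T(3) y(2) i2] T(2) uU GU by blast+
    then have "i = K" using r i2 Kodd by (cases "i = K - 1") auto
    then show False using noK[OF u(1)] iv(1) by blast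
  qed
  have yC: "y \<in> C1" using y(1) ZC by blast
  note yn = m'_nb[OF yC y(2)]
  have yG: "y \<in> G"
  proof (rule ccontr)
    assume "y \<notin> G"
    then have "fr.ct {y} \<noteq> {}" using y(1) yn(1) unfolding G_def by blast
    then show False using nocon[of "{y}" y] y(1) yn(1) by auto
  qed
  let ?G = "cmp G y"
  have GG: "?G \<subseteq> G" by (rule cmp_sub)
  have cG: "conn ?G" by (rule cmp_conn[OF yG])
  have yGG: "y \<in> ?G" by (rule cmp_self[OF yG])
  have "cmp Z2 y \<subseteq> ?G"
  proof (rule cmp_least[OF yGG])
    show "?G \<subseteq> Z2" using GG GC by blast
    fix v u assume v: "v \<in> ?G" and u: "u \<in> Z2" and a: "adj v u"
    have ux: "u \<notin> set xs"
    proof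
      assume "u \<in> set xs"
      then obtain i where "i < K" "u = w i" using C1_xs[of u] u ZC by blast
      then have "i \<in> fr.ct {v}" using a by (intro fr.ctI) auto
      then show False using v GG unfolding G_def by blast
    qed
    have "u \<in> G"
    proof (rule ccontr)
      assume "u \<notin> G"
      then have n: "fr.ct {u} \<noteq> {}" using u ux unfolding G_def by blast
      have "conn (insert u ?G)" by (rule conn_insert[OF cG]) (use v a in \<open>auto simp: tch_def\<close>)
      then show False using nocon[of "insert u ?G" u] n u ux GG yGG by blast
    qed
    then show "u \<in> ?G" using cmp_step[OF v _ a] by blast
  qed
  then have cGG: "c \<in> ?G" using c(1) by blast
  have ne: "e \<noteq> hd xs" using e(2) l(2) by auto
  have eU: "e \<in> U" using e(1) ne by (simp add: U_def)
  let ?T = "?G \<union> insert m' S2"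
  have cT: "conn ?T" by (rule conn_Un[OF cG conn_tail]) (use yGG y(2) in blast)
  have TU: "?T \<subseteq> U" using GG GU tailU by blast
  have ctT: "fr.ct ?T = {Suc K}" unfolding fr.ct_Un ct_tail ctG[OF GG] by simp
  have cT2: "conn (insert e ?T)" by (rule conn_insert[OF cT]) (use cGG c(2) sym in \<open>auto simp: tch_def\<close>)
  show False
  proof (cases "fr.ct {e} = {}")
    case False
    then obtain i where i: "i \<in> fr.ct {e}" by blast
    then have iv: "adj e (w i)" "i \<le> Suc K" using fr.ctD[OF i] by (auto simp: tch_def)
    have i3: "i = 3" using contact_E[OF e(1) ne iv(2,1)] e(2) by blast
    have "fr.ct (insert e ?T) = {3, Suc K}"
      using fr.ct_insert[of e ?T] ctT fr.ct_sing[OF eU iv(2,1)] i3 by auto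
    then have "fr.jump 3 (Suc K)" using fr.jump_of_set[OF cT2] eU TU n4 by (auto simp: K_def)
    then have "fr.r \<le> 3" using fr.r_jump[of 3] n4 by (simp add: K_def)
    then show False using r n4 by (simp add: K_def)
  next
    case True
    obtain l' where l': "l' \<in> L0" "adj e l'" using e(1) by (rule E_L0)
    have ll: "l' \<noteq> l" using l' e(2) by auto
    have l'U: "l' \<in> U" using l' ll by (simp add: U_def)
    have "adj l' (w 0)" using L0D[OF l'(1)] w0 by simp
    then have ctl: "fr.ct {l'} = {0}" using fr.ct_sing[OF l'U] by simp
    have "conn (insert l' (insert e ?T))" by (rule conn_insert[OF cT2]) (use l'(2) in \<open>auto simp: tch_def\<close>)
    moreover have "fr.ct (insert l' (insert e ?T)) = {0, Suc K}"
      using fr.ct_insert[of l' "insert e ?T"] fr.ct_insert[of e ?T] ctT ctl True by auto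
    ultimately have "fr.jump 0 (Suc K)" using fr.jump_of_set[of "insert l' (insert e ?T)"] l'U eU TU by auto
    then show False using fr.no_jump_0 by blast
  qed
qed

end

section \<open>The contradiction for a layer, and the end of the minimal state\<close>

context layer_path
begin

text \<open>The pattern \<open>two_layers\<close> with \<open>p0\<close> and \<open>p\<close> can
  fail only at a boundary vertex in \<open>F\<close>. Its parent is a third one, so there is a
  tripod, and the boundary vertex itself serves as \<open>m'\<close>. After \<open>r_two\<close> and
  \<open>r_mid\<close> only the top position of the cut point remains.\<close>

lemma layer_path_impossible: False
proof -
  obtain e' where e': "e' \<in> E" "e' \<in> bd C1" "\<not> adj e' l" using two_classes[OF l(1)] by blast
  obtain c where c: "c \<in> C1" "adj e' c" using e'(2) by (rule bdE)
  define Z2 where "Z2 = {y\<in>C1. \<forall>b\<in>bd C. adj b p \<longrightarrow> \<not> adj y b}"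
  have "s c = t" using side[OF c(2)] ED[OF e'(1)] by auto
  then have cZ: "c \<in> Z2" using c(1) side sbd unfolding Z2_def by blast
  let ?C = "cmp Z2 c"
  have CZ: "?C \<subseteq> Z2" by (rule cmp_sub)
  show False
  proof (rule two_layers[OF p(1) pp0 sp, of ?C])
    show "?C \<subseteq> C1" using CZ unfolding Z2_def by blast
    show "conn ?C" by (rule cmp_conn[OF cZ])
    show "\<not> adj y b" if "y \<in> ?C" "b \<in> bd C" "adj b p" for y b using that CZ unfolding Z2_def by blast
    show "z \<in> E \<or> (z \<in> C1 \<and> (\<exists>b\<in>bd C. adj b p \<and> adj z b))" if zb: "z \<in> bd ?C" for z
    proof -
      obtain y where y: "y \<in> ?C" "adj z y" "adj y z" using zb by (rule bdE)
      have yZ: "y \<in> Z2" "y \<in> C1" using y(1) CZ unfolding Z2_def by blast+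
      have zZ: "z \<notin> Z2" using bd_cmp[OF zb] .
      have "z \<notin> F"
      proof
        assume zF: "z \<in> F"
        have zp: "\<not> adj z p" using yZ(1) y(3) FD[OF zF] unfolding Z2_def by blast
        obtain p' where p': "p' \<in> M" "adj z p'" using parent[of z] FD[OF zF] by blast
        have d: "p0 \<noteq> p" "p0 \<noteq> p'" "p \<noteq> p'" using pp0 p'(2) FD[OF zF] zp by auto
        have "par M C p0" "par M C p" "par M C p'"
          using p0M p0par p FD[OF xs_ends(2)] p' FD[OF zF] by (auto simp: par_def)
        then have "tri M t p0 p p'" using triM d by blast
        then obtain o' S0 S1 S2 where h: "o' \<in> M" "s o' = t" "S0 \<subseteq> M" "S1 \<subseteq> M" "S2 \<subseteq> M"
          "conn S0" "conn S1" "conn S2" "p0 \<in> S0" "p \<in> S1" "p' \<in> S2" "o' \<notin> S0 \<union> S1 \<union> S2"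
          "tch S0 o'" "tch S1 o'" "tch S2 o'" "anti S0 S1" "anti S0 S2" "anti S1 S2" by (rule tri_obtain)
        have cz: "conn (insert o' S0)" by (rule conn_insert[OF h(6,13)])
        have "o' \<noteq> p0" using h(9,12) by blast
        \<comment> \<open>\<open>R\<close> is the part of the leg of \<open>p0\<close> and the
          centre that remains connected to the centre after removal of \<open>p0\<close>.\<close>
        then obtain R where R: "R \<subseteq> insert o' S0 - {p0}" "conn R" "o' \<in> R" "tch R p0"
          using conn_minus[OF cz, of o' p0] h(9) by blast
        have zb1: "z \<in> bd C1" using bdI[of z C1 y] zF FE_disj y(2) yZ by blast
        interpret B: path_frame adj s V M C t p0 g xs l p z p' o' S0 S1 S2 R
          by unfold_locales (use zF zb1 p' h R in simp_all)
        have "B.fr.r = B.K - 1" using B.r_two B.r_mid by blast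
        then show False using B.r_top[OF _ Z2_def yZ(1) y(3) e'(1,3) cmp_sym[OF y(1)] c(2)] by blast
      qed
      then show ?thesis using sub_bd[of ?C z] zb CZ zZ unfolding Z2_def by blast
    qed
  qed
qed

end


lemma (in layer) layer_impossible: False
proof -
  obtain l0 where l0: "l0 \<in> L0" using p0par unfolding L0_def by blast
  obtain e1 where e1: "e1 \<in> E" "e1 \<in> bd C1" using two_classes[OF l0] by blast
  obtain m1 where m1: "m1 \<in> F" "m1 \<in> bd C1" using F_nonempty by blast
  obtain c where c: "c \<in> C1" "adj e1 c" using e1(2) by (rule bdE)
  obtain d where d: "d \<in> C1" "adj d m1" using m1(2) by (rule bdE)
  obtain ys where ys: "walk ys" "set ys \<subseteq> C1" "hd ys = c" "last ys = d" using conn_path[OF connC1 c(1) d(1)] by blast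
  define P where "P xs \<longleftrightarrow> walk xs \<and> set xs \<subseteq> E \<union> F \<union> C1 \<and> hd xs \<in> E \<and> last xs \<in> F" for xs
  have "walk (e1 # ys @ [m1])"
    using ys c(2) d(2) by (auto simp: walk_def successively_Cons successively_append_iff hd_append)
  then have "P (e1 # ys @ [m1])" using ys(2) e1(1) m1(1) unfolding P_def by auto
  then obtain xs where xs: "P xs" and mn: "\<And>zs. P zs \<Longrightarrow> length xs \<le> length zs"
    using ex_has_least_nat[of P _ length] by blast
  have X: "walk xs" "set xs \<subseteq> E \<union> F \<union> C1" "hd xs \<in> E" "last xs \<in> F" using xs unfolding P_def by blast+
  obtain l where l: "l \<in> L0" "adj (hd xs) l" using X(3) by (rule E_L0)
  obtain p where p: "p \<in> M" "adj (last xs) p" using parent[of "last xs"] FD[OF X(4)] by blast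
  interpret layer_path adj s V M C t p0 g xs l p
  proof unfold_locales
    show "length xs \<le> length ys" if "walk ys" "set ys \<subseteq> E \<union> F \<union> C1" "hd ys \<in> E" "last ys \<in> F" for ys
      using mn[of ys] that unfolding P_def by blast
  qed (use X l p in blast)+
  show False by (rule layer_path_impossible)
qed

text \<open>A layer has to be found: a vertex \<open>e\<close> next to a leaf has another neighbour
  \<open>g\<close>, which lies in \<open>C\<close> by \<open>no_double\<close> and on the side of
  the leaves, hence next to no leaf.\<close>

lemma (in minimal_state) minimal_state_impossible: False
proof -
  obtain l where l: "l \<in> bd C" using bdC_ne by blast
  obtain p0 where p0: "p0 \<in> M" "adj l p0" using parent[OF l] by blast
  obtain e where e: "e \<in> C" "adj l e" "adj e l" using l by (rule bdE)
  obtain g where g: "adj e g" "g \<noteq> l" using deg3_avoid[OF degC[OF e(1)]] by blast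
  have gC: "g \<in> C"
  proof (rule ccontr)
    assume "g \<notin> C"
    then have "g \<in> bd C" using bdI[of g C e] e(1) sym[OF g(1)] by blast
    then show False using no_double[OF e(1) l _ e(3) g(1)] g(2) by blast
  qed
  have sg: "s g = t" using side[OF g(1)] side[OF e(3)] sbd[OF l] by auto
  interpret layer adj s V M C t p0 g
  proof unfold_locales
    show "\<not> adj g b" if "b \<in> bd C" for b using side[of g b] sbd[OF that] sg by auto
  qed (use p0 l gC in blast)+
  show False by (rule layer_impossible)
qed

section \<open>From states to vertices of low degree\<close>

context theta_free
begin

lemma no_state: "\<not> state M C t"
proof
  assume "state M C t"
  then have "\<exists>n M C t. state M C t \<and> card C = n" by blast
  then obtain n where n: "\<exists>M C t. state M C t \<and> card C = n"
    and mn: "\<And>k. k < n \<Longrightarrow> \<not> (\<exists>M C t. state M C t \<and> card C = k)"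
    using exists_least_iff[of "\<lambda>n. \<exists>M C t. state M C t \<and> card C = n"] by blast
  obtain M' C' t' where S: "state M' C' t'" "card C' = n" using n by blast
  interpret minimal_state adj s V M' C' t'
  proof unfold_locales
    show "state M' C' t'" by (rule S(1))
    show "card C' \<le> card C''" if "state M'' C'' t''" for M'' C'' t''
      using mn[of "card C''"] that S(2) by (metis not_le)
  qed
  show False by (rule minimal_state_impossible)
qed

text \<open>The vertex \<open>v\<close> comes with a neighbour, so the lemma can be applied a second
  time with \<open>v\<close> in the role of \<open>x\<close>.\<close>

lemma exists_low_degree:
  assumes "adj x a" shows "\<exists>v u. v \<noteq> x \<and> adj v u \<and> \<not> deg3 v"
proof (rule ccontr)
  assume n: "\<not> ?thesis"
  have dg: "deg3 v" if "v \<noteq> x" "adj v u" for v u using n that by blast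
  have ax: "a \<noteq> x" using assms irrefl by blast
  obtain c where c: "adj a c" "c \<noteq> x" using deg3_avoid[OF dg[OF ax sym[OF assms]]] by blast
  let ?A = "{v. v \<noteq> x \<and> \<not> adj x v \<and> deg3 v}"
  have "\<not> adj x c" using side[OF assms] side[OF c(1)] side[of x c] by auto
  then have cA: "c \<in> ?A" using c dg[OF c(2) sym[OF c(1)]] by simp
  let ?C = "cmp ?A c"
  have CA: "?C \<subseteq> ?A" by (rule cmp_sub)
  have "state {x} ?C (\<not> s x)"
  proof (rule init_state)
    show "conn ?C" by (rule cmp_conn[OF cA])
    show "adj z x" if z: "z \<in> bd ?C" for z
    proof -
      obtain y where y: "y \<in> ?C" "adj z y" using z by (rule bdE)
      have zx: "z \<noteq> x" using y CA by blast
      then show ?thesis using bd_cmp[OF z] dg[OF zx y(2)] sym by blast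
    qed
  qed (use CA in auto)
  then show False using no_state by blast
qed

end

lemma degree_card:
  assumes "finite_graph V E"
  shows "vertex_degree E v = card {y. {v, y} \<in> E}"
proof -
  have "{e \<in> E. v \<in> e} = (\<lambda>y. {v, y}) ` {y. {v, y} \<in> E}"
  proof (intro equalityI subsetI)
    fix e assume e: "e \<in> {e \<in> E. v \<in> e}"
    then have "card e = 2" using assms by (simp add: finite_graph_def)
    then obtain a b where "e = {a, b}" by (auto simp: card_2_iff)
    then have "e = {v, b} \<or> e = {v, a}" using e by auto
    then show "e \<in> (\<lambda>y. {v, y}) ` {y. {v, y} \<in> E}" using e by blast
  qed auto
  moreover have "inj_on (\<lambda>y. {v, y}) {y. {v, y} \<in> E}" by (auto simp: inj_on_def doubleton_eq_iff)
  ultimately show ?thesis by (simp add: vertex_degree_def card_image)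
qed

theorem theorem4p2:
  fixes V :: "'a set" and E :: "'a set set"
  assumes "linear_balanceable V E"
    and "card V \<ge> 2"
  shows "card {v \<in> V. vertex_degree E v \<le> 2} \<ge> 2"
proof (rule ccontr)
  let ?B = "{v \<in> V. vertex_degree E v \<le> 2}"
  assume "\<not> 2 \<le> card ?B"
  then have B1: "card ?B \<le> 1" by simp
  obtain s where "theta_free (\<lambda>x y. {x, y} \<in> E) s V" using linear_balanceable_theta_free[OF assms(1)] by blast
  then interpret theta_free "\<lambda>x y. {x, y} \<in> E" s V .
  have fg: "finite_graph V E"
    using assms(1) by (simp add: linear_balanceable_def balanceable_def bipartite_graph_def)
  have low: "v \<in> ?B" if "v \<in> V" "\<not> deg3 v" for v
    using that degree_card[OF fg, of v] by (simp add: deg3_def)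
  have finB: "finite ?B" using finV by simp
  have uniq: "u = v" if "u \<in> ?B" "v \<in> ?B" for u v
    using B1 card_le_Suc0_iff_eq[OF finB] that by simp
  have nolow: "\<exists>u. u \<in> V \<and> u \<noteq> x \<and> u \<in> ?B \<and> (\<exists>y. {u, y} \<in> E)" if "{x, a} \<in> E" for x a
    using exists_low_degree[OF that] low adjV by blast
  obtain x0 y0 where xy: "x0 \<in> V" "y0 \<in> V" "x0 \<noteq> y0"
  proof -
    have "V \<noteq> {}" using assms(2) by auto
    then obtain x0 where "x0 \<in> V" by blast
    moreover have "\<not> V \<subseteq> {x0}" using assms(2) card_mono[of "{x0}" V] by auto
    ultimately show ?thesis using that by blast
  qed
  have "\<exists>x a. {x, a} \<in> E"
  proof -
    \<comment> \<open>At most one vertex has low degree by assumption, so one of the two has degree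
      at least 3, and there is an edge.\<close>
    have "x0 \<notin> ?B \<or> y0 \<notin> ?B" using uniq xy(3) by blast
    then obtain v where "deg3 v" using low xy by blast
    then show ?thesis using deg3_avoid[of v] by blast
  qed
  then obtain x a where "{x, a} \<in> E" by blast
  then obtain u y where u: "u \<in> ?B" "{u, y} \<in> E" using nolow by blast
  \<comment> \<open>The second application excludes the low-degree vertex \<open>u\<close> found in
    the first one.\<close>
  then obtain u' where "u' \<noteq> u" "u' \<in> ?B" using nolow[OF u(2)] by blast
  then show False using uniq u(1) by blast
qed

end
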